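(* Let $G$ be a group with neutral element $\varepsilon$ and let $R$ be a graded Artinian $G$-graded ring. Let $Re_1,\ldots,Re_t$ (with $e_1,\ldots,e_t$ primitive idempotents of $R_\varepsilon$) be a system of representatives for the isoshift types of principal graded indecomposable left $R$-modules. Let $S_i=Re_i/J^{\rm gr}(R)e_i$ and $S'_i=e_iR/e_iJ^{\rm gr}(R)$ for any $1\leq i\leq t$. Then the following are equivalent. (1) $R$ is graded quasi-Frobenius. (2) There exist a permutation $\pi$ of $\{1,\ldots,t\}$ and some $\sigma_1,\ldots,\sigma_t\in G$ such that $\mathrm{soc}^{\rm gr}(Re_i)\simeq S_{\pi(i)}(\sigma_i)$ as graded left $R$-modules and $\mathrm{soc}^{\rm gr}(e_{\pi(i)}R)\simeq(\sigma_i)S'_i$ as graded right $R$-modules for any $1\leq i\leq t$.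
   Context: Rings are associative with identity; a $G$-graded ring is $R=\bigoplus_{g\in G}R_g$ with $R_gR_h\subset R_{gh}$. Graded left (right) $R$-modules are $M=\bigoplus_gM_g$ with $R_gM_h\subset M_{gh}$ (resp. $M_gR_h\subset M_{gh}$); isomorphisms are degree-preserving. For $\sigma\in G$, a graded left module $M$ has shift $M(\sigma)$ with $M(\sigma)_g=M_{g\sigma}$; a graded right module $M$ has shift $(\sigma)M$ with $((\sigma)M)_g=M_{\sigma g}$. Two graded modules have the same isoshift type if one is isomorphic to a shift of the other. $\mathrm{soc}^{\rm gr}(M)$ is the sum of the graded simple submodules of $M$. $J^{\rm gr}(R)$ is the intersection of all maximal graded left ideals (a graded two-sided ideal). $R$ is graded Artinian if it satisfies DCC on graded left ideals and on graded right ideals; then $R$ is a finite direct sum of indecomposable graded left submodules, unique up to isomorphism and permutation, called the principal graded indecomposable left $R$-modules; each is of the form $Re$ with $e$ a primitive idempotent of $R_\varepsilon$. $R$ is graded quasi-Frobenius if it satisfies ACC on graded left ideals and is injective as an object in the category $R-gr$ of graded left $R$-modules with degree-preserving $R$-linear maps; equivalently, $R$ is graded Artinian and $\mathrm{ann}_r(\mathrm{ann}_\ell(A))=A$, $\mathrm{ann}_\ell(\mathrm{ann}_r(U))=U$ for all graded right ideals $A$ and graded left ideals $U$. *)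

theory Defs
  imports "HOL-Algebra.Algebra"
begin

section \<open>Graded rings and graded modules\<close>

record ('a, 'g) gring = "'a ring" +
  ring_part :: "'g \<Rightarrow> 'a set"

text \<open>Graded left and graded right modules share one record type. For a right module,
  \<open>smult M r x\<close> stands for the product \<open>x r\<close>. Submodules, homomorphisms, simplicity, socles and
  quotients are then given by the same formulas on both sides; only the module axioms, the
  compatibility of the grading with the action, and the shifts depend on the side. As for the
  library's \<open>module\<close> record, the fields \<open>mult\<close> and \<open>one\<close> of a module carry no meaning.\<close>

record ('a, 'b, 'g) gmodule = "('a, 'b) module" +
  mod_part :: "'g \<Rightarrow> 'b set"

definition is_decomp ::
    "('b, 'm) ring_scheme \<Rightarrow> 'i set \<Rightarrow> ('i \<Rightarrow> 'b set) \<Rightarrow> ('i \<Rightarrow> 'b) \<Rightarrow> 'b \<Rightarrow> bool" where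
  "is_decomp M I D c x \<longleftrightarrow>
     (\<forall>i\<in>I. c i \<in> D i) \<and> (\<forall>i. i \<notin> I \<longrightarrow> c i = \<zero>\<^bsub>M\<^esub>) \<and> finite {i. c i \<noteq> \<zero>\<^bsub>M\<^esub>} \<and>
     x = (\<Oplus>\<^bsub>M\<^esub>i\<in>{i. c i \<noteq> \<zero>\<^bsub>M\<^esub>}. c i)"

definition internal_direct_sum ::
    "('b, 'm) ring_scheme \<Rightarrow> 'i set \<Rightarrow> ('i \<Rightarrow> 'b set) \<Rightarrow> bool" where
  "internal_direct_sum M I D \<longleftrightarrow>
     (\<forall>i\<in>I. additive_subgroup (D i) M) \<and> (\<forall>x\<in>carrier M. \<exists>!c. is_decomp M I D c x)"

locale graded_ring = G: group G + ring R
  for G :: "('g, 'k) monoid_scheme" and R :: "('a, 'g) gring" (structure) +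
  assumes ring_grading: "internal_direct_sum R (carrier G) (ring_part R)"
    and ring_part_mult:
      "\<lbrakk>g \<in> carrier G; h \<in> carrier G; a \<in> ring_part R g; b \<in> ring_part R h\<rbrakk>
        \<Longrightarrow> a \<otimes> b \<in> ring_part R (g \<otimes>\<^bsub>G\<^esub> h)"

text \<open>The library's \<open>module\<close> locale requires a commutative ring.\<close>

locale left_module = R: ring R + M: abelian_group M
  for R :: "('a, 'k) ring_scheme" and M :: "('a, 'b, 'm) module_scheme" +
  assumes smult_closed:
      "\<lbrakk>r \<in> carrier R; x \<in> carrier M\<rbrakk> \<Longrightarrow> r \<odot>\<^bsub>M\<^esub> x \<in> carrier M"
    and smult_l_distr:
      "\<lbrakk>r \<in> carrier R; s \<in> carrier R; x \<in> carrier M\<rbrakk>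
        \<Longrightarrow> (r \<oplus>\<^bsub>R\<^esub> s) \<odot>\<^bsub>M\<^esub> x = r \<odot>\<^bsub>M\<^esub> x \<oplus>\<^bsub>M\<^esub> s \<odot>\<^bsub>M\<^esub> x"
    and smult_r_distr:
      "\<lbrakk>r \<in> carrier R; x \<in> carrier M; y \<in> carrier M\<rbrakk>
        \<Longrightarrow> r \<odot>\<^bsub>M\<^esub> (x \<oplus>\<^bsub>M\<^esub> y) = r \<odot>\<^bsub>M\<^esub> x \<oplus>\<^bsub>M\<^esub> r \<odot>\<^bsub>M\<^esub> y"
    and smult_assoc:
      "\<lbrakk>r \<in> carrier R; s \<in> carrier R; x \<in> carrier M\<rbrakk>
        \<Longrightarrow> (r \<otimes>\<^bsub>R\<^esub> s) \<odot>\<^bsub>M\<^esub> x = r \<odot>\<^bsub>M\<^esub> (s \<odot>\<^bsub>M\<^esub> x)"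
    and smult_one: "x \<in> carrier M \<Longrightarrow> \<one>\<^bsub>R\<^esub> \<odot>\<^bsub>M\<^esub> x = x"

locale graded_left_module = graded_ring G R + left_module R M
  for G :: "('g, 'k) monoid_scheme" and R :: "('a, 'g) gring"
    and M :: "('a, 'b, 'g) gmodule" +
  assumes mod_grading: "internal_direct_sum M (carrier G) (mod_part M)"
    and smult_mod_part:
      "\<lbrakk>g \<in> carrier G; h \<in> carrier G; r \<in> ring_part R g; x \<in> mod_part M h\<rbrakk>
        \<Longrightarrow> r \<odot>\<^bsub>M\<^esub> x \<in> mod_part M (g \<otimes>\<^bsub>G\<^esub> h)"

definition left_regular :: "('a, 'g) gring \<Rightarrow> ('a, 'a, 'g) gmodule" where
  "left_regular R =
     \<lparr>carrier = carrier R, monoid.mult = monoid.mult R, one = one R, ring.zero = ring.zero R, ring.add = ring.add R,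
      smult = (\<lambda>r x. r \<otimes>\<^bsub>R\<^esub> x), mod_part = ring_part R\<rparr>"

definition right_regular :: "('a, 'g) gring \<Rightarrow> ('a, 'a, 'g) gmodule" where
  "right_regular R =
     \<lparr>carrier = carrier R, monoid.mult = monoid.mult R, one = one R, ring.zero = ring.zero R, ring.add = ring.add R,
      smult = (\<lambda>r x. x \<otimes>\<^bsub>R\<^esub> r), mod_part = ring_part R\<rparr>"

definition left_shift ::
    "('g, 'k) monoid_scheme \<Rightarrow> ('a, 'b, 'g) gmodule \<Rightarrow> 'g \<Rightarrow> ('a, 'b, 'g) gmodule" where
  "left_shift G M \<sigma> = M\<lparr>mod_part := (\<lambda>g. mod_part M (g \<otimes>\<^bsub>G\<^esub> \<sigma>))\<rparr>"

definition right_shift ::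
    "('g, 'k) monoid_scheme \<Rightarrow> 'g \<Rightarrow> ('a, 'b, 'g) gmodule \<Rightarrow> ('a, 'b, 'g) gmodule" where
  "right_shift G \<sigma> M = M\<lparr>mod_part := (\<lambda>g. mod_part M (\<sigma> \<otimes>\<^bsub>G\<^esub> g))\<rparr>"


section \<open>Submodules, quotients, homomorphisms\<close>

definition graded_submodule ::
    "('g, 'k) monoid_scheme \<Rightarrow> ('a, 'g) gring \<Rightarrow> 'b set \<Rightarrow> ('a, 'b, 'g) gmodule \<Rightarrow> bool" where
  "graded_submodule G R N M \<longleftrightarrow>
     additive_subgroup N M \<and> (\<forall>r\<in>carrier R. \<forall>x\<in>N. r \<odot>\<^bsub>M\<^esub> x \<in> N) \<and>
     (\<forall>x\<in>N. \<forall>c. is_decomp M (carrier G) (mod_part M) c x \<longrightarrow> (\<forall>g\<in>carrier G. c g \<in> N))"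

definition sub_gmodule :: "('a, 'b, 'g) gmodule \<Rightarrow> 'b set \<Rightarrow> ('a, 'b, 'g) gmodule" where
  "sub_gmodule M N = M\<lparr>carrier := N, mod_part := (\<lambda>g. mod_part M g \<inter> N)\<rparr>"

definition quot_gmodule :: "('a, 'b, 'g) gmodule \<Rightarrow> 'b set \<Rightarrow> ('a, 'b set, 'g) gmodule" where
  "quot_gmodule M N =
     \<lparr>carrier = a_rcosets\<^bsub>M\<^esub> N, monoid.mult = undefined, one = undefined, ring.zero = N, ring.add = set_add M,
      smult = (\<lambda>r U. \<Union>x\<in>U. N +>\<^bsub>M\<^esub> (r \<odot>\<^bsub>M\<^esub> x)),
      mod_part = (\<lambda>g. (\<lambda>x. N +>\<^bsub>M\<^esub> x) ` mod_part M g)\<rparr>"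

definition graded_hom ::
    "('g, 'k) monoid_scheme \<Rightarrow> ('a, 'g) gring \<Rightarrow> ('a, 'b, 'g) gmodule \<Rightarrow> ('a, 'c, 'g) gmodule
      \<Rightarrow> ('b \<Rightarrow> 'c) set" where
  "graded_hom G R M N =
     {f. f \<in> carrier M \<rightarrow> carrier N \<and>
         (\<forall>x\<in>carrier M. \<forall>y\<in>carrier M. f (x \<oplus>\<^bsub>M\<^esub> y) = f x \<oplus>\<^bsub>N\<^esub> f y) \<and>
         (\<forall>r\<in>carrier R. \<forall>x\<in>carrier M. f (r \<odot>\<^bsub>M\<^esub> x) = r \<odot>\<^bsub>N\<^esub> f x) \<and>
         (\<forall>g\<in>carrier G. f ` mod_part M g \<subseteq> mod_part N g)}"

definition graded_iso ::
    "('g, 'k) monoid_scheme \<Rightarrow> ('a, 'g) gring \<Rightarrow> ('a, 'b, 'g) gmodule \<Rightarrow> ('a, 'c, 'g) gmodule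
      \<Rightarrow> bool" where
  "graded_iso G R M N \<longleftrightarrow> (\<exists>f\<in>graded_hom G R M N. bij_betw f (carrier M) (carrier N))"

definition same_left_isoshift_type ::
    "('g, 'k) monoid_scheme \<Rightarrow> ('a, 'g) gring \<Rightarrow> ('a, 'b, 'g) gmodule \<Rightarrow> ('a, 'c, 'g) gmodule
      \<Rightarrow> bool" where
  "same_left_isoshift_type G R M N \<longleftrightarrow>
     (\<exists>\<sigma>\<in>carrier G. graded_iso G R M (left_shift G N \<sigma>)) \<or>
     (\<exists>\<sigma>\<in>carrier G. graded_iso G R N (left_shift G M \<sigma>))"


section \<open>Simple and indecomposable modules, the graded socle\<close>

definition graded_simple ::
    "('g, 'k) monoid_scheme \<Rightarrow> ('a, 'g) gring \<Rightarrow> ('a, 'b, 'g) gmodule \<Rightarrow> bool" where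
  "graded_simple G R M \<longleftrightarrow>
     carrier M \<noteq> {\<zero>\<^bsub>M\<^esub>} \<and>
     (\<forall>N. graded_submodule G R N M \<longrightarrow> N = {\<zero>\<^bsub>M\<^esub>} \<or> N = carrier M)"

definition graded_indecomposable ::
    "('g, 'k) monoid_scheme \<Rightarrow> ('a, 'g) gring \<Rightarrow> ('a, 'b, 'g) gmodule \<Rightarrow> bool" where
  "graded_indecomposable G R M \<longleftrightarrow>
     carrier M \<noteq> {\<zero>\<^bsub>M\<^esub>} \<and>
     (\<forall>A B. graded_submodule G R A M \<and> graded_submodule G R B M \<and>
            A <+>\<^bsub>M\<^esub> B = carrier M \<and> A \<inter> B = {\<zero>\<^bsub>M\<^esub>}
        \<longrightarrow> A = {\<zero>\<^bsub>M\<^esub>} \<or> B = {\<zero>\<^bsub>M\<^esub>})"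

definition sum_of_submodules :: "('b, 'm) ring_scheme \<Rightarrow> 'b set set \<Rightarrow> 'b set" where
  "sum_of_submodules M \<N> =
     {\<Oplus>\<^bsub>M\<^esub>N\<in>F. c N | F c. finite F \<and> F \<subseteq> \<N> \<and> (\<forall>N\<in>F. c N \<in> N)}"

definition graded_soc ::
    "('g, 'k) monoid_scheme \<Rightarrow> ('a, 'g) gring \<Rightarrow> ('a, 'b, 'g) gmodule \<Rightarrow> ('a, 'b, 'g) gmodule"
  where
  "graded_soc G R M =
     sub_gmodule M (sum_of_submodules M
       {N. graded_submodule G R N M \<and> graded_simple G R (sub_gmodule M N)})"


section \<open>Graded ideals, graded Artinian rings\<close>

abbreviation graded_left_ideal ::
    "('g, 'k) monoid_scheme \<Rightarrow> ('a, 'g) gring \<Rightarrow> 'a set \<Rightarrow> bool" where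
  "graded_left_ideal G R I \<equiv> graded_submodule G R I (left_regular R)"

abbreviation graded_right_ideal ::
    "('g, 'k) monoid_scheme \<Rightarrow> ('a, 'g) gring \<Rightarrow> 'a set \<Rightarrow> bool" where
  "graded_right_ideal G R I \<equiv> graded_submodule G R I (right_regular R)"

definition maximal_graded_left_ideal ::
    "('g, 'k) monoid_scheme \<Rightarrow> ('a, 'g) gring \<Rightarrow> 'a set \<Rightarrow> bool" where
  "maximal_graded_left_ideal G R I \<longleftrightarrow>
     graded_left_ideal G R I \<and> I \<noteq> carrier R \<and>
     (\<forall>K. graded_left_ideal G R K \<and> I \<subseteq> K \<longrightarrow> K = I \<or> K = carrier R)"

definition graded_jacobson ::
    "('g, 'k) monoid_scheme \<Rightarrow> ('a, 'g) gring \<Rightarrow> 'a set" where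
  "graded_jacobson G R = {x \<in> carrier R. \<forall>I. maximal_graded_left_ideal G R I \<longrightarrow> x \<in> I}"

definition dcc :: "('b set \<Rightarrow> bool) \<Rightarrow> bool" where
  "dcc P \<longleftrightarrow> (\<forall>I :: nat \<Rightarrow> 'b set.
     (\<forall>n. P (I n)) \<and> (\<forall>n. I (Suc n) \<subseteq> I n) \<longrightarrow> (\<exists>n. \<forall>m\<ge>n. I m = I n))"

definition acc :: "('b set \<Rightarrow> bool) \<Rightarrow> bool" where
  "acc P \<longleftrightarrow> (\<forall>I :: nat \<Rightarrow> 'b set.
     (\<forall>n. P (I n)) \<and> (\<forall>n. I n \<subseteq> I (Suc n)) \<longrightarrow> (\<exists>n. \<forall>m\<ge>n. I m = I n))"

definition graded_artinian :: "('g, 'k) monoid_scheme \<Rightarrow> ('a, 'g) gring \<Rightarrow> bool" where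
  "graded_artinian G R \<longleftrightarrow> dcc (graded_left_ideal G R) \<and> dcc (graded_right_ideal G R)"


section \<open>Principal graded indecomposable modules\<close>

text \<open>The summands of a decomposition are nonzero and independent, hence pairwise distinct, so a finite set
  of them suffices.\<close>

definition principal_graded_indecomposable ::
    "('g, 'k) monoid_scheme \<Rightarrow> ('a, 'g) gring \<Rightarrow> 'a set \<Rightarrow> bool" where
  "principal_graded_indecomposable G R P \<longleftrightarrow>
     (\<exists>\<D>. finite \<D> \<and> P \<in> \<D> \<and>
        (\<forall>D\<in>\<D>. graded_left_ideal G R D \<and>
                 graded_indecomposable G R (sub_gmodule (left_regular R) D)) \<and>
        internal_direct_sum (left_regular R) \<D> (\<lambda>D. D))"

definition primitive_idempotent_in_unit_part ::
    "('g, 'k) monoid_scheme \<Rightarrow> ('a, 'g) gring \<Rightarrow> 'a \<Rightarrow> bool" where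
  "primitive_idempotent_in_unit_part G R e \<longleftrightarrow>
     e \<in> ring_part R \<one>\<^bsub>G\<^esub> \<and> e \<noteq> \<zero>\<^bsub>R\<^esub> \<and> e \<otimes>\<^bsub>R\<^esub> e = e \<and>
     (\<forall>f\<in>ring_part R \<one>\<^bsub>G\<^esub>. \<forall>f'\<in>ring_part R \<one>\<^bsub>G\<^esub>.
        f \<otimes>\<^bsub>R\<^esub> f = f \<and> f' \<otimes>\<^bsub>R\<^esub> f' = f' \<and> f \<otimes>\<^bsub>R\<^esub> f' = \<zero>\<^bsub>R\<^esub> \<and> f' \<otimes>\<^bsub>R\<^esub> f = \<zero>\<^bsub>R\<^esub> \<and>
        e = f \<oplus>\<^bsub>R\<^esub> f' \<longrightarrow> f = \<zero>\<^bsub>R\<^esub> \<or> f' = \<zero>\<^bsub>R\<^esub>)"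

definition left_principal :: "('a, 'g) gring \<Rightarrow> 'a \<Rightarrow> ('a, 'a, 'g) gmodule" where
  "left_principal R e = sub_gmodule (left_regular R) ((\<lambda>r. r \<otimes>\<^bsub>R\<^esub> e) ` carrier R)"

definition right_principal :: "('a, 'g) gring \<Rightarrow> 'a \<Rightarrow> ('a, 'a, 'g) gmodule" where
  "right_principal R e = sub_gmodule (right_regular R) ((\<lambda>r. e \<otimes>\<^bsub>R\<^esub> r) ` carrier R)"

definition left_top ::
    "('g, 'k) monoid_scheme \<Rightarrow> ('a, 'g) gring \<Rightarrow> 'a \<Rightarrow> ('a, 'a set, 'g) gmodule" where
  "left_top G R e =
     quot_gmodule (left_principal R e) ((\<lambda>j. j \<otimes>\<^bsub>R\<^esub> e) ` graded_jacobson G R)"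

definition right_top ::
    "('g, 'k) monoid_scheme \<Rightarrow> ('a, 'g) gring \<Rightarrow> 'a \<Rightarrow> ('a, 'a set, 'g) gmodule" where
  "right_top G R e =
     quot_gmodule (right_principal R e) ((\<lambda>j. e \<otimes>\<^bsub>R\<^esub> j) ` graded_jacobson G R)"

definition principal_isoshift_representatives ::
    "('g, 'k) monoid_scheme \<Rightarrow> ('a, 'g) gring \<Rightarrow> nat \<Rightarrow> (nat \<Rightarrow> 'a) \<Rightarrow> bool" where
  "principal_isoshift_representatives G R t e \<longleftrightarrow>
     (\<forall>i\<in>{1..t}. primitive_idempotent_in_unit_part G R (e i) \<and>
        principal_graded_indecomposable G R (carrier (left_principal R (e i)))) \<and>
     (\<forall>i\<in>{1..t}. \<forall>j\<in>{1..t}. i \<noteq> j \<longrightarrow>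
        \<not> same_left_isoshift_type G R (left_principal R (e i)) (left_principal R (e j))) \<and>
     (\<forall>P. principal_graded_indecomposable G R P \<longrightarrow>
        (\<exists>i\<in>{1..t}. same_left_isoshift_type G R
           (sub_gmodule (left_regular R) P) (left_principal R (e i))))"


section \<open>Graded quasi-Frobenius rings\<close>

text \<open>HOL cannot quantify over all modules on all types inside a formula. Injectivity in the
  category of graded left modules is therefore expressed relative to a type \<open>'m\<close>: the extension
  property is required for all graded left modules whose carrier is a subset of \<open>'m\<close>. If \<open>'m\<close> is
  too small this is weaker than injectivity; it should contain a copy of the carrier type of
  \<open>R\<close>, so that shifts of \<open>R\<close> and graded left ideals are among the test modules.\<close>

definition graded_injective ::
    "'m itself \<Rightarrow> ('g, 'k) monoid_scheme \<Rightarrow> ('a, 'g) gring \<Rightarrow> ('a, 'b, 'g) gmodule \<Rightarrow> bool"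
  where
  "graded_injective (_ :: 'm itself) G R E \<longleftrightarrow>
     graded_left_module G R E \<and>
     (\<forall>(M :: ('a, 'm, 'g) gmodule) (N :: ('a, 'm, 'g) gmodule) i f.
        graded_left_module G R M \<and> graded_left_module G R N \<and>
        i \<in> graded_hom G R M N \<and> inj_on i (carrier M) \<and> f \<in> graded_hom G R M E \<longrightarrow>
        (\<exists>h\<in>graded_hom G R N E. \<forall>x\<in>carrier M. h (i x) = f x))"

definition graded_quasi_frobenius ::
    "'m itself \<Rightarrow> ('g, 'k) monoid_scheme \<Rightarrow> ('a, 'g) gring \<Rightarrow> bool" where
  "graded_quasi_frobenius T G R \<longleftrightarrow>
     acc (graded_left_ideal G R) \<and> graded_injective T G R (left_regular R)"

end

(* Write J for the graded Jacobson radical. A primitive idempotent f of the unit component has a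
   local corner ring, and a homogeneous x lies in J iff every yx in the unit component is nilpotent;
   hence J is the same from both sides, and everything can be transported to the opposite ring.

   By a graded Baer criterion, R is injective iff every homogeneous map from a graded left ideal to
   R is a right multiplication.

   If so, two minimal left subideals of Re_i coincide, since a projection between them would be
   multiplication by an element of the local corner. So soc(Re_i) = Rx with x in e_(pi i) R e_i
   homogeneous. Extending isomorphisms between simple left ideals shows that pi is injective, and
   extending rw |-> rx for 0 /= w in e_(pi i) R homogeneous shows x in wR, so that
   soc(e_(pi i) R) = xR.

   Conversely, let soc(Re_i) = Rx and soc(e_(pi i) R) = yR. Then x lies in Ry, so xJ = 0, and the
   left and the right annihilator of J agree. Passing to right annihilators then turns a composition
   series of left ideals into a series of right ideals whose steps are simple or trivial. By
   symmetry both composition lengths of R agree, so no step is trivial, and this is exactly what is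
   needed to extend a homogeneous map along the composition series. *)

theory Submission
  imports Defs
begin

section \<open>Homogeneous components\<close>

text \<open>For a homogeneous \<open>x\<close> of degree other than the neutral one,
  \<open>1 - x\<close> is not homogeneous, so quasi-regularity says nothing about \<open>x\<close>
  directly. Such an \<open>x\<close> is first multiplied into the unit component by an element of
  inverse degree; there Fitting's lemma, a consequence of both chain conditions, lets nilpotency of
  \<open>z\<close> replace invertibility of \<open>1 - z\<close>.

  The chain conditions do not yield finite generation or finite length at once. Maximal graded
  subideals come from a form of Nakayama's lemma for arbitrary graded left ideals, and they yield
  composition series; lengths are compared by counting the factors that an ideal hits.

  Modules are translated away. An isomorphism of \<open>soc(Re)\<close> with the shift of
  \<open>Re'/Je'\<close> by \<open>\<sigma>\<close> is recorded by the preimage \<open>x\<close> of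
  the class of \<open>e'\<close>, an element of \<open>e'Re\<close> of degree
  \<open>inv \<sigma>\<close>. An isomorphism of \<open>Rf\<close> with a shift of \<open>Re\<close>
  is recorded by a pair of mutually inverse homogeneous elements. Injectivity is recorded by maps
  from left ideals to \<open>R\<close> of arbitrary degree \<open>g\<close>, so that shifts
  disappear there too.\<close>

definition component ::
    "('b, 'm) ring_scheme \<Rightarrow> 'i set \<Rightarrow> ('i \<Rightarrow> 'b set) \<Rightarrow> 'i \<Rightarrow> 'b \<Rightarrow> 'b" where
  "component M I D i x = (THE c. is_decomp M I D c x) i"

text \<open>\<open>R\<close>, its opposite and its regular modules are different records over the
  same additive structure. Sums, subgroups and gradings depend on that structure only, so they can
  be moved from one record to another.\<close>

lemma finsum_add_cong:
  assumes "carrier M = carrier N" "ring.add M = ring.add N" "ring.zero M = ring.zero N"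
  shows "finsum M f A = finsum N f A"
  unfolding finsum_def finprod_def using assms by simp

lemma additive_subgroup_add_cong:
  assumes "carrier M = carrier N" "ring.add M = ring.add N" "ring.zero M = ring.zero N"
  shows "additive_subgroup H M \<longleftrightarrow> additive_subgroup H N"
  unfolding additive_subgroup_def subgroup_def m_inv_def using assms by simp

lemma is_decomp_add_cong:
  assumes "carrier M = carrier N" "ring.add M = ring.add N" "ring.zero M = ring.zero N"
  shows "is_decomp M I D c x \<longleftrightarrow> is_decomp N I D c x"
  unfolding is_decomp_def using assms by (simp add: finsum_add_cong[of M N])

lemma internal_direct_sum_add_cong:
  assumes "carrier M = carrier N" "ring.add M = ring.add N" "ring.zero M = ring.zero N"
  shows "internal_direct_sum M I D \<longleftrightarrow> internal_direct_sum N I D"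
  unfolding internal_direct_sum_def
  by (simp add: is_decomp_add_cong[OF assms] additive_subgroup_add_cong[OF assms] assms(1))

lemma (in abelian_group) additive_subgroup_iff:
  "additive_subgroup H G \<longleftrightarrow>
     H \<subseteq> carrier G \<and> \<zero> \<in> H \<and> (\<forall>x\<in>H. \<forall>y\<in>H. x \<oplus> y \<in> H) \<and> (\<forall>x\<in>H. \<ominus> x \<in> H)"
  unfolding additive_subgroup_def subgroup_def by (auto simp: a_inv_def)

lemma (in abelian_group) additive_subgroup_finsum_closed:
  assumes H: "additive_subgroup H G" and "finite A" "\<And>i. i \<in> A \<Longrightarrow> f i \<in> H"
  shows "finsum G f A \<in> H"
proof -
  interpret additive_subgroup H G by fact
  show ?thesis using assms(2,3)
  proof (induction A rule: finite_induct)
    case (insert a A)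
    have "f \<in> A \<rightarrow> carrier G" "f a \<in> carrier G" using insert a_subset by auto
    then show ?case using insert by (simp add: finsum_insert)
  qed simp
qed

locale direct_sum = abelian_group M for M (structure) +
  fixes I :: "'i set" and D
  assumes direct_sum: "internal_direct_sum M I D"
begin

abbreviation cmp :: "'i \<Rightarrow> 'a \<Rightarrow> 'a" where "cmp \<equiv> component M I D"

lemma part_subgroup: "i \<in> I \<Longrightarrow> additive_subgroup (D i) M"
  using direct_sum by (simp add: internal_direct_sum_def)

lemma part_closed [simp]:
  assumes "i \<in> I"
  shows "\<zero> \<in> D i" "x \<in> D i \<Longrightarrow> y \<in> D i \<Longrightarrow> x \<oplus> y \<in> D i" "x \<in> D i \<Longrightarrow> \<ominus> x \<in> D i"
    "x \<in> D i \<Longrightarrow> x \<in> carrier M"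
  using part_subgroup[OF assms] by (auto simp: additive_subgroup_iff)

lemma decomp_component:
  "x \<in> carrier M \<Longrightarrow> is_decomp M I D (\<lambda>i. cmp i x) x"
  unfolding component_def using direct_sum
  unfolding internal_direct_sum_def by (simp add: theI'[of "\<lambda>c. is_decomp M I D c x"])

lemma decomp_closed:
  assumes "is_decomp M I D c x" shows "x \<in> carrier M" "c i \<in> carrier M"
proof -
  have c: "c i \<in> carrier M" for i
    using assms part_closed by (cases "i \<in> I") (auto simp: is_decomp_def)
  then show "c i \<in> carrier M" .
  show "x \<in> carrier M" using assms c by (auto simp: is_decomp_def)
qed

lemma decomp_unique:
  assumes "is_decomp M I D c x" shows "c i = cmp i x"
proof -
  have "x \<in> carrier M" using decomp_closed[OF assms] by simp
  with assms decomp_component[OF this] direct_sum have "c = (\<lambda>i. cmp i x)"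
    unfolding internal_direct_sum_def by blast
  then show ?thesis by simp
qed

text \<open>\<open>is_decomp\<close> sums over the exact support; any finite \<open>F\<close>
  outside of which \<open>c\<close> vanishes gives the same sum and is easier to produce.\<close>

lemma decompI:
  assumes "\<And>i. i \<in> I \<Longrightarrow> c i \<in> D i" "\<And>i. i \<notin> I \<Longrightarrow> c i = \<zero>" "finite F"
    "\<And>i. i \<notin> F \<Longrightarrow> c i = \<zero>" "x = finsum M c F"
  shows "is_decomp M I D c x"
proof -
  have c: "c i \<in> carrier M" for i using assms(1,2) by (cases "i \<in> I") auto
  have sub: "{i. c i \<noteq> \<zero>} \<subseteq> F" using assms(4) by auto
  have "finsum M c {i. c i \<noteq> \<zero>} = finsum M c F"
    using assms(3) sub c by (intro add.finprod_mono_neutral_cong_left) auto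
  then show ?thesis using assms sub unfolding is_decomp_def
    by (auto intro: finite_subset)
qed

lemma component_in: "\<lbrakk>i \<in> I; x \<in> carrier M\<rbrakk> \<Longrightarrow> cmp i x \<in> D i"
  using decomp_component[of x] by (simp add: is_decomp_def)

lemma component_closed [simp]: "x \<in> carrier M \<Longrightarrow> cmp i x \<in> carrier M"
  using decomp_closed(2)[OF decomp_component] .

lemma component_homogeneous:
  assumes "i \<in> I" "x \<in> D i"
  shows "cmp j x = (if j = i then x else \<zero>)"
proof -
  have x: "x \<in> carrier M" using assms by simp
  have "is_decomp M I D (\<lambda>j. if j = i then x else \<zero>) x"
    using assms x by (intro decompI[where F = "{i}"]) auto
  from decomp_unique[OF this, of j] show ?thesis by simp
qed

lemma component_zero: "cmp j \<zero> = \<zero>"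
proof -
  have "is_decomp M I D (\<lambda>j. \<zero>) \<zero>" by (intro decompI[where F = "{}"]) auto
  from decomp_unique[OF this, of j] show ?thesis by simp
qed

lemma component_support: "x \<in> carrier M \<Longrightarrow> finite {i. cmp i x \<noteq> \<zero>}"
  using decomp_component[of x] by (simp add: is_decomp_def)

lemma component_sum: "x \<in> carrier M \<Longrightarrow> x = finsum M (\<lambda>i. cmp i x) {i. cmp i x \<noteq> \<zero>}"
  using decomp_component[of x] by (simp add: is_decomp_def)

lemma component_outside: "x \<in> carrier M \<Longrightarrow> i \<notin> I \<Longrightarrow> cmp i x = \<zero>"
  using decomp_component[of x] by (simp add: is_decomp_def)

lemma component_add:
  assumes x: "x \<in> carrier M" and y: "y \<in> carrier M"
  shows "cmp j (x \<oplus> y) = cmp j x \<oplus> cmp j y"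
proof -
  let ?X = "{i. cmp i x \<noteq> \<zero>}" let ?Y = "{i. cmp i y \<noteq> \<zero>}"
  have fin: "finite (?X \<union> ?Y)" using x y component_support by auto
  have "x = finsum M (\<lambda>i. cmp i x) (?X \<union> ?Y)"
    by (subst component_sum[OF x], rule add.finprod_mono_neutral_cong_left) (use fin x in auto)
  moreover have "y = finsum M (\<lambda>i. cmp i y) (?X \<union> ?Y)"
    by (subst component_sum[OF y], rule add.finprod_mono_neutral_cong_left) (use fin y in auto)
  ultimately have s: "x \<oplus> y = finsum M (\<lambda>i. cmp i x \<oplus> cmp i y) (?X \<union> ?Y)"
    using x y by (subst finsum_addf) (auto simp: Pi_def)
  have "is_decomp M I D (\<lambda>i. cmp i x \<oplus> cmp i y) (x \<oplus> y)"
    by (rule decompI[OF _ _ fin _ s]) (use x y in \<open>auto simp: component_in component_outside\<close>)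
  from decomp_unique[OF this, of j] show ?thesis by simp
qed

text \<open>The homogeneous case keeps \<open>y = cmp i x\<close>: if \<open>x\<close> lies in a
  graded ideal, then so do the elements from which the induction starts.\<close>

lemma homogeneous_induct [consumes 1, case_names zero homogeneous add]:
  assumes x: "x \<in> carrier M"
    and zero: "P \<zero>"
    and hom: "\<And>i y. \<lbrakk>i \<in> I; y \<in> D i; y = cmp i x\<rbrakk> \<Longrightarrow> P y"
    and add: "\<And>y z. \<lbrakk>y \<in> carrier M; z \<in> carrier M; P y; P z\<rbrakk> \<Longrightarrow> P (y \<oplus> z)"
  shows "P x"
proof -
  have "P (finsum M (\<lambda>i. cmp i x) F)" if "finite F" for F
    using that
  proof (induction F rule: finite_induct)
    case empty then show ?case using zero by simp
  next
    case (insert i F)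
    have "P (cmp i x)"
      by (cases "i \<in> I") (use x hom zero component_in component_outside in auto)
    then show ?case using insert x add by (simp add: Pi_def)
  qed
  then show ?thesis using component_sum[OF x] component_support[OF x] by metis
qed

lemma mem_subgroup_if_components:
  assumes "additive_subgroup K M" "x \<in> carrier M" "\<And>i. i \<in> I \<Longrightarrow> cmp i x \<in> K"
  shows "x \<in> K"
  using assms(2)
proof (induction rule: homogeneous_induct)
qed (use assms in \<open>auto simp: additive_subgroup_iff\<close>)

lemma eq_zero_if_components:
  "x \<in> carrier M \<Longrightarrow> (\<And>i. i \<in> I \<Longrightarrow> cmp i x = \<zero>) \<Longrightarrow> x = \<zero>"
  using mem_subgroup_if_components[of "{\<zero>}" x] by (auto simp: additive_subgroup_iff)

lemma component_minus: "x \<in> carrier M \<Longrightarrow> cmp j (\<ominus> x) = \<ominus> cmp j x"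
  by (metis a_inv_closed component_add component_closed component_zero minus_equality l_neg)

end

text \<open>Both sides are additive in \<open>x\<close>, so homogeneous \<open>x\<close> suffice,
  and there injectivity of \<open>p\<close> keeps all other components zero. Multiplication by a
  homogeneous element is the main case, \<open>p\<close> being a translation of the group.\<close>

lemma component_additive_map:
  assumes "direct_sum M I D" "direct_sum N I' D'"
    and h: "h \<in> carrier M \<rightarrow> carrier N"
      "\<And>x y. \<lbrakk>x \<in> carrier M; y \<in> carrier M\<rbrakk> \<Longrightarrow> h (x \<oplus>\<^bsub>M\<^esub> y) = h x \<oplus>\<^bsub>N\<^esub> h y"
    and p: "inj_on p I" "p ` I \<subseteq> I'" "\<And>i. i \<in> I \<Longrightarrow> h ` D i \<subseteq> D' (p i)"
    and i: "i \<in> I" and x: "x \<in> carrier M"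
  shows "component N I' D' (p i) (h x) = h (component M I D i x)"
proof -
  interpret M: direct_sum M I D by fact
  interpret N: direct_sum N I' D' by fact
  have hz: "h \<zero>\<^bsub>M\<^esub> = \<zero>\<^bsub>N\<^esub>"
    using h M.zero_closed
    by (metis M.l_zero N.add.one_unique N.add.r_cancel_one' PiE)
  show ?thesis using x
  proof (induction rule: M.homogeneous_induct)
    case zero then show ?case by (simp add: hz M.component_zero N.component_zero)
  next
    case (homogeneous j y)
    then have "h y \<in> D' (p j)" "p j \<in> I'" using p by auto
    then show ?case using homogeneous p(1) i
      by (auto simp: M.component_homogeneous[of j] N.component_homogeneous[of "p j"] hz inj_on_eq_iff)
  next
    case (add y z)
    then show ?case using h by (simp add: M.component_add N.component_add Pi_iff)
  qed
qed

section \<open>Graded rings, their opposites and their one-sided ideals\<close>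

text \<open>Empty outside the group, so that membership in \<open>H g\<close> includes
  \<open>g \<in> carrier G\<close>; the values of \<open>ring_part\<close> outside the carrier are
  arbitrary.\<close>

definition hpart :: "('g, 'k) monoid_scheme \<Rightarrow> ('a, 'g) gring \<Rightarrow> 'g \<Rightarrow> 'a set" where
  "hpart G R g = (if g \<in> carrier G then ring_part R g else {})"

text \<open>Reversing the ring multiplication also reverses the product of degrees. The opposite of
  a graded ring is thus graded over the opposite group, with the same homogeneous parts, and graded
  right ideals become graded left ideals.\<close>

definition op_group :: "('g, 'k) monoid_scheme \<Rightarrow> ('g, 'k) monoid_scheme" where
  "op_group G = G\<lparr>monoid.mult := \<lambda>x y. y \<otimes>\<^bsub>G\<^esub> x\<rparr>"

definition op_ring :: "('a, 'g) gring \<Rightarrow> ('a, 'g) gring" where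
  "op_ring R = R\<lparr>monoid.mult := \<lambda>x y. y \<otimes>\<^bsub>R\<^esub> x\<rparr>"

lemma op_group_simps [simp]:
  "carrier (op_group G) = carrier G" "x \<otimes>\<^bsub>op_group G\<^esub> y = y \<otimes>\<^bsub>G\<^esub> x"
  "\<one>\<^bsub>op_group G\<^esub> = \<one>\<^bsub>G\<^esub>" "op_group (op_group G) = G"
  by (simp_all add: op_group_def)

lemma inv_op_group [simp]: "inv\<^bsub>op_group G\<^esub> x = inv\<^bsub>G\<^esub> x"
  unfolding m_inv_def by (simp add: conj_commute)

lemma op_ring_simps [simp]:
  "carrier (op_ring R) = carrier R" "x \<otimes>\<^bsub>op_ring R\<^esub> y = y \<otimes>\<^bsub>R\<^esub> x"
  "\<one>\<^bsub>op_ring R\<^esub> = \<one>\<^bsub>R\<^esub>" "ring.add (op_ring R) = ring.add R"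
  "\<zero>\<^bsub>op_ring R\<^esub> = \<zero>\<^bsub>R\<^esub>" "ring_part (op_ring R) = ring_part R" "op_ring (op_ring R) = R"
  by (simp_all add: op_ring_def)

lemma finsum_op_ring [simp]: "finsum (op_ring R) = finsum R"
  by (simp add: finsum_def)

lemma hpart_op [simp]: "hpart (op_group G) (op_ring R) = hpart G R"
  by (simp add: hpart_def fun_eq_iff)

lemma component_op [simp]: "component (op_ring R) = component R"
  unfolding component_def is_decomp_def by simp

lemma graded_left_ideal_op:
  "graded_left_ideal (op_group G) (op_ring R) I \<longleftrightarrow> graded_right_ideal G R I"
proof -
  have a: "carrier (left_regular (op_ring R)) = carrier (right_regular R)"
    "ring.add (left_regular (op_ring R)) = ring.add (right_regular R)"
    "ring.zero (left_regular (op_ring R)) = ring.zero (right_regular R)"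
    by (simp_all add: left_regular_def right_regular_def)
  show ?thesis unfolding graded_submodule_def
    by (simp add: is_decomp_add_cong[OF a] additive_subgroup_add_cong[OF a])
      (simp add: left_regular_def right_regular_def)
qed

lemma graded_right_ideal_op:
  "graded_right_ideal (op_group G) (op_ring R) I \<longleftrightarrow> graded_left_ideal G R I"
  using graded_left_ideal_op[of "op_group G" "op_ring R" I] by simp

lemma graded_artinian_op: "graded_artinian (op_group G) (op_ring R) \<longleftrightarrow> graded_artinian G R"
  by (auto simp: graded_artinian_def graded_left_ideal_op graded_right_ideal_op)

text \<open>Without a minimal element, dependent choice would produce a strictly descending chain.
  The property \<open>Q\<close> is kept apart from \<open>P\<close> because the chain condition is
  known for \<open>P\<close>.\<close>

lemma dcc_minimal:
  assumes "dcc P" "P I" "Q I"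
  shows "\<exists>K. P K \<and> Q K \<and> (\<forall>L. P L \<and> Q L \<and> L \<subseteq> K \<longrightarrow> L = K)"
proof (rule ccontr)
  assume c: "\<not> ?thesis"
  have "\<exists>f. \<forall>n. (P (f n) \<and> Q (f n)) \<and> f (Suc n) \<subset> f n"
  proof (rule dependent_nat_choice)
    show "\<exists>K. P K \<and> Q K" using assms by blast
    show "\<exists>L. (P L \<and> Q L) \<and> L \<subset> K" if K: "P K \<and> Q K" for K n
    proof -
      from c have "\<not> (P K \<and> Q K \<and> (\<forall>L. P L \<and> Q L \<and> L \<subseteq> K \<longrightarrow> L = K))" by metis
      with K have "\<exists>L. P L \<and> Q L \<and> L \<subseteq> K \<and> L \<noteq> K" by simp
      then show ?thesis by (simp add: psubset_eq conj_ac)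
    qed
  qed
  then obtain f where f: "\<And>n. P (f n)" "\<And>n. f (Suc n) \<subset> f n" by blast
  then obtain n where n: "\<forall>m\<ge>n. f m = f n"
    using assms(1) unfolding dcc_def by (meson psubset_imp_subset)
  have "f (Suc n) = f n" by (rule n[rule_format]) simp
  with f(2)[of n] show False by simp
qed

context graded_ring
begin

sublocale direct_sum R "carrier G" "ring_part R"
  by (unfold_locales) (rule ring_grading)

abbreviation H where "H \<equiv> hpart G R"
abbreviation gl :: "'a set \<Rightarrow> bool" where "gl \<equiv> graded_left_ideal G R"

lemma H_D: "x \<in> H g \<Longrightarrow> g \<in> carrier G" "x \<in> H g \<Longrightarrow> x \<in> carrier R"
  by (auto simp: hpart_def split: if_splits)

lemma H_add: "x \<in> H g \<Longrightarrow> y \<in> H g \<Longrightarrow> x \<oplus> y \<in> H g"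
  and H_minus: "x \<in> H g \<Longrightarrow> \<ominus> x \<in> H g"
  and H_mult: "x \<in> H g \<Longrightarrow> y \<in> H h \<Longrightarrow> x \<otimes> y \<in> H (g \<otimes>\<^bsub>G\<^esub> h)"
  and H_component: "x \<in> carrier R \<Longrightarrow> g \<in> carrier G \<Longrightarrow> cmp g x \<in> H g"
  by (auto simp: hpart_def component_in ring_part_mult split: if_splits)

lemma H_diff: "x \<in> H g \<Longrightarrow> y \<in> H g \<Longrightarrow> x \<ominus> y \<in> H g"
  by (simp add: a_minus_def H_add H_minus)

lemma component_H: "x \<in> H g \<Longrightarrow> cmp h x = (if h = g then x else \<zero>)"
  by (intro component_homogeneous) (auto simp: hpart_def split: if_splits)

lemma component_H_same [simp]: "x \<in> H g \<Longrightarrow> cmp g x = x"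
  by (simp add: component_H)

lemma component_diff: "x \<in> carrier R \<Longrightarrow> y \<in> carrier R \<Longrightarrow> cmp g (x \<ominus> y) = cmp g x \<ominus> cmp g y"
  by (simp add: a_minus_def component_add component_minus)

lemma component_H_mult:
  assumes a: "a \<in> H g" and x: "x \<in> carrier R" and h: "h \<in> carrier G"
  shows "cmp (g \<otimes>\<^bsub>G\<^esub> h) (a \<otimes> x) = a \<otimes> cmp h x"
proof (rule component_additive_map[where h = "\<lambda>x. a \<otimes> x" and p = "\<lambda>h. g \<otimes>\<^bsub>G\<^esub> h"])
  show "direct_sum R (carrier G) (ring_part R)" by (rule direct_sum_axioms)
  then show "direct_sum R (carrier G) (ring_part R)" .
  show "inj_on (\<lambda>h. g \<otimes>\<^bsub>G\<^esub> h) (carrier G)" using H_D[OF a] by (intro inj_onI) simp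
qed (use a H_D[OF a] x h in \<open>auto simp: r_distr hpart_def ring_part_mult\<close>)

lemma component_mult_H:
  assumes a: "a \<in> H g" and x: "x \<in> carrier R" and h: "h \<in> carrier G"
  shows "cmp (h \<otimes>\<^bsub>G\<^esub> g) (x \<otimes> a) = cmp h x \<otimes> a"
proof (rule component_additive_map[where h = "\<lambda>x. x \<otimes> a" and p = "\<lambda>h. h \<otimes>\<^bsub>G\<^esub> g"])
  show "direct_sum R (carrier G) (ring_part R)" by (rule direct_sum_axioms)
  then show "direct_sum R (carrier G) (ring_part R)" .
  show "inj_on (\<lambda>h. h \<otimes>\<^bsub>G\<^esub> g) (carrier G)" using H_D[OF a] by (intro inj_onI) simp
qed (use a H_D[OF a] x h in \<open>auto simp: l_distr hpart_def ring_part_mult\<close>)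

lemma component_mult_H':
  assumes "a \<in> H g" "x \<in> carrier R" "k \<in> carrier G"
  shows "cmp k (x \<otimes> a) = cmp (k \<otimes>\<^bsub>G\<^esub> inv\<^bsub>G\<^esub> g) x \<otimes> a"
  using component_mult_H[of a g x "k \<otimes>\<^bsub>G\<^esub> inv\<^bsub>G\<^esub> g"] assms H_D[OF assms(1)]
  by (simp add: G.m_assoc)

lemma component_H_mult':
  assumes "a \<in> H g" "x \<in> carrier R" "k \<in> carrier G"
  shows "cmp k (a \<otimes> x) = a \<otimes> cmp (inv\<^bsub>G\<^esub> g \<otimes>\<^bsub>G\<^esub> k) x"
  using component_H_mult[of a g x "inv\<^bsub>G\<^esub> g \<otimes>\<^bsub>G\<^esub> k"] assms H_D[OF assms(1)]
  by (simp add: G.m_assoc[symmetric])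

text \<open>The neutral component \<open>u\<close> of \<open>1\<close> is a left identity: comparing
  degrees in \<open>1 y = y\<close> gives \<open>u y = y\<close> for homogeneous \<open>y\<close>.
  Then \<open>u = u 1 = 1\<close>.\<close>

lemma one_H: "\<one> \<in> H \<one>\<^bsub>G\<^esub>"
proof -
  let ?u = "cmp \<one>\<^bsub>G\<^esub> \<one>"
  have "?u \<otimes> x = x" if "x \<in> carrier R" for x
    using that
  proof (induction rule: homogeneous_induct)
    case (homogeneous g y)
    then have y: "y \<in> H g" by (simp add: hpart_def)
    from component_mult_H[OF y, of \<one> "\<one>\<^bsub>G\<^esub>"] H_D[OF y] y show ?case by simp
  qed (auto simp: r_distr)
  from this[of \<one>] have "?u = \<one>" by simp
  with H_component[of \<one> "\<one>\<^bsub>G\<^esub>"] show ?thesis by simp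
qed

lemma graded_ring_op: "graded_ring (op_group G) (op_ring R)"
proof -
  have "group (op_group G)"
    by (rule groupI) (auto simp: G.m_assoc intro: G.r_inv_ex)
  moreover have "ring (op_ring R)"
  proof (rule ringI)
    show "abelian_group (op_ring R)"
    proof (rule abelian_groupI)
      fix x assume "x \<in> carrier (op_ring R)"
      then show "\<exists>y\<in>carrier (op_ring R). y \<oplus>\<^bsub>op_ring R\<^esub> x = \<zero>\<^bsub>op_ring R\<^esub>"
        by (intro bexI[of _ "\<ominus> x"]) (auto simp: l_neg)
    qed (auto simp: a_ac)
    show "monoid (op_ring R)" by (rule monoidI) (auto simp: m_assoc)
  qed (auto simp: l_distr r_distr)
  moreover have "graded_ring_axioms (op_group G) (op_ring R)"
    using ring_grading ring_part_mult
    by (unfold_locales) (auto simp: internal_direct_sum_add_cong[of "op_ring R" R])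
  ultimately show ?thesis by (intro graded_ring.intro)
qed

lemma left_regular_simps:
  "carrier (left_regular R) = carrier R" "ring.add (left_regular R) = ring.add R"
  "\<zero>\<^bsub>left_regular R\<^esub> = \<zero>" "smult (left_regular R) r x = r \<otimes> x"
  "mod_part (left_regular R) = ring_part R"
  by (simp_all add: left_regular_def)

lemma gl_iff:
  "gl I \<longleftrightarrow> additive_subgroup I R \<and> (\<forall>r\<in>carrier R. \<forall>x\<in>I. r \<otimes> x \<in> I) \<and>
     (\<forall>x\<in>I. \<forall>g\<in>carrier G. cmp g x \<in> I)"
proof -
  note a = left_regular_simps
  have "(\<forall>c. is_decomp R (carrier G) (ring_part R) c x \<longrightarrow> (\<forall>g\<in>carrier G. c g \<in> I))
      \<longleftrightarrow> (\<forall>g\<in>carrier G. cmp g x \<in> I)" if "x \<in> carrier R" for x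
    using decomp_component[OF that] decomp_unique by metis
  then have *: "(\<forall>x\<in>I. \<forall>c. is_decomp R (carrier G) (ring_part R) c x \<longrightarrow> (\<forall>g\<in>carrier G. c g \<in> I))
      \<longleftrightarrow> (\<forall>x\<in>I. \<forall>g\<in>carrier G. cmp g x \<in> I)" if "additive_subgroup I R"
    using that unfolding additive_subgroup_iff by (meson subsetD)
  show ?thesis unfolding graded_submodule_def
    unfolding a is_decomp_add_cong[OF a(1-3)] additive_subgroup_add_cong[OF a(1-3)]
    using * by (cases "additive_subgroup I R") simp_all
qed

lemma glD:
  assumes "gl I"
  shows "I \<subseteq> carrier R" "x \<in> I \<Longrightarrow> x \<in> carrier R" "\<zero> \<in> I"
    "x \<in> I \<Longrightarrow> y \<in> I \<Longrightarrow> x \<oplus> y \<in> I" "x \<in> I \<Longrightarrow> \<ominus> x \<in> I" "x \<in> I \<Longrightarrow> y \<in> I \<Longrightarrow> x \<ominus> y \<in> I"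
    "r \<in> carrier R \<Longrightarrow> x \<in> I \<Longrightarrow> r \<otimes> x \<in> I" "x \<in> I \<Longrightarrow> g \<in> carrier G \<Longrightarrow> cmp g x \<in> I"
  using assms unfolding gl_iff additive_subgroup_iff a_minus_def by (simp_all add: subset_iff)

lemma glI:
  assumes "I \<subseteq> carrier R" "\<zero> \<in> I" "\<And>x y. x \<in> I \<Longrightarrow> y \<in> I \<Longrightarrow> x \<oplus> y \<in> I"
    "\<And>r x. r \<in> carrier R \<Longrightarrow> x \<in> I \<Longrightarrow> r \<otimes> x \<in> I"
    "\<And>x g. x \<in> I \<Longrightarrow> g \<in> carrier G \<Longrightarrow> cmp g x \<in> I"
  shows "gl I"
proof -
  have "\<ominus> x \<in> I" if "x \<in> I" for x
    using assms(4)[of "\<ominus> \<one>" x] assms(1) that by (auto simp: l_minus)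
  with assms show ?thesis unfolding gl_iff additive_subgroup_iff by (intro conjI ballI) simp_all
qed

lemma gl_mem_if_components:
  "gl I \<Longrightarrow> x \<in> carrier R \<Longrightarrow> (\<And>g. g \<in> carrier G \<Longrightarrow> cmp g x \<in> I) \<Longrightarrow> x \<in> I"
  using mem_subgroup_if_components gl_iff by blast

lemma gl_subsetI:
  assumes "gl I" "gl K" "\<And>g x. x \<in> H g \<Longrightarrow> x \<in> I \<Longrightarrow> x \<in> K"
  shows "I \<subseteq> K"
proof
  fix x assume x: "x \<in> I"
  show "x \<in> K"
  proof (rule gl_mem_if_components[OF assms(2)])
    fix g assume "g \<in> carrier G"
    then show "cmp g x \<in> K"
      using assms(3)[OF H_component[of x g]] x glD(2,8)[OF assms(1)] by blast
  qed (use x glD(2)[OF assms(1)] in auto)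
qed

lemma gl_homogeneous_diff:
  assumes "gl I" "gl K" "\<not> I \<subseteq> K"
  obtains g x where "x \<in> H g" "x \<in> I" "x \<notin> K"
  using gl_subsetI assms by blast

lemma gl_carrier: "gl (carrier R)" by (rule glI) auto
lemma gl_zero: "gl {\<zero>}" by (rule glI) (auto simp: component_zero)

lemma gl_Int:
  assumes "gl I" "gl K" shows "gl (I \<inter> K)"
  by (rule glI) (auto simp: glD[OF assms(1)] glD[OF assms(2)])

lemma gl_Inter:
  assumes "\<And>I. I \<in> A \<Longrightarrow> gl I" shows "gl (carrier R \<inter> \<Inter>A)"
  by (rule glI) (simp_all add: assms[THEN glD(3)] assms[THEN glD(4)] assms[THEN glD(7)] assms[THEN glD(8)])

lemma gl_chain_Union:
  assumes "A \<noteq> {}" "\<And>I. I \<in> A \<Longrightarrow> gl I" "\<And>I K. I \<in> A \<Longrightarrow> K \<in> A \<Longrightarrow> I \<subseteq> K \<or> K \<subseteq> I"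
  shows "gl (\<Union>A)"
proof (rule glI)
  fix x y assume "x \<in> \<Union>A" "y \<in> \<Union>A"
  then obtain I K where "I \<in> A" "K \<in> A" "x \<in> I" "y \<in> K" by auto
  then show "x \<oplus> y \<in> \<Union>A" using assms(2)[THEN glD(4)] assms(3)[of I K] by blast
next
  show "\<Union>A \<subseteq> carrier R" using assms(2)[THEN glD(1)] by blast
  show "\<zero> \<in> \<Union>A" using assms(1) assms(2)[THEN glD(3)] by blast
next
  fix r x assume "r \<in> carrier R" "x \<in> \<Union>A"
  then show "r \<otimes> x \<in> \<Union>A" using assms(2)[THEN glD(7)] by blast
next
  fix g x assume "x \<in> \<Union>A" "g \<in> carrier G"
  then show "cmp g x \<in> \<Union>A" using assms(2)[THEN glD(8)] by blast
qed

text \<open>Used with \<open>I = carrier R\<close>, where it is the left ideal generated by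
  \<open>x\<close> and \<open>Y\<close>, and with \<open>I = jac\<close> in the proof that the
  radical annihilates simple factors.\<close>

definition ext :: "'a set \<Rightarrow> 'a \<Rightarrow> 'a set \<Rightarrow> 'a set" where
  "ext I x Y = {a \<otimes> x \<oplus> y | a y. a \<in> I \<and> y \<in> Y}"

lemma extI: "a \<in> I \<Longrightarrow> y \<in> Y \<Longrightarrow> a \<otimes> x \<oplus> y \<in> ext I x Y" by (auto simp: ext_def)

lemma gl_ext:
  assumes I: "gl I" and x: "x \<in> H g" and Y: "gl Y"
  shows "gl (ext I x Y)"
proof (rule glI)
  note [simp] = glD(2)[OF I] glD(2)[OF Y]
  have xc[simp]: "x \<in> carrier R" and g: "g \<in> carrier G" using H_D[OF x] by auto
  show "ext I x Y \<subseteq> carrier R" by (auto simp: ext_def)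
  show "\<zero> \<in> ext I x Y" using extI[OF glD(3)[OF I] glD(3)[OF Y], of x] by simp
  fix u assume "u \<in> ext I x Y"
  then obtain a y where u: "u = a \<otimes> x \<oplus> y" and a: "a \<in> I" and y: "y \<in> Y" by (auto simp: ext_def)
  {
    fix v assume "v \<in> ext I x Y"
    then obtain b z where v: "v = b \<otimes> x \<oplus> z" "b \<in> I" "z \<in> Y" by (auto simp: ext_def)
    have "u \<oplus> v = (a \<oplus> b) \<otimes> x \<oplus> (y \<oplus> z)"
      using u v a y by (simp add: l_distr a_ac)
    then show "u \<oplus> v \<in> ext I x Y"
      using extI[OF glD(4)[OF I a v(2)] glD(4)[OF Y y v(3)]] by simp
  }
  {
    fix r assume r: "r \<in> carrier R"
    have "r \<otimes> u = (r \<otimes> a) \<otimes> x \<oplus> r \<otimes> y" using u a y r by (simp add: r_distr m_assoc)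
    then show "r \<otimes> u \<in> ext I x Y"
      using extI[OF glD(7)[OF I r a] glD(7)[OF Y r y]] by simp
  }
  {
    fix k assume k: "k \<in> carrier G"
    have "cmp k u = cmp (k \<otimes>\<^bsub>G\<^esub> inv\<^bsub>G\<^esub> g) a \<otimes> x \<oplus> cmp k y"
      using u a y k by (simp add: component_add component_mult_H'[OF x])
    then show "cmp k u \<in> ext I x Y"
      using extI[OF glD(8)[OF I a, of "k \<otimes>\<^bsub>G\<^esub> inv\<^bsub>G\<^esub> g"] glD(8)[OF Y y k]] k g by simp
  }
qed

lemma ext_contains:
  assumes "gl I" "x \<in> carrier R" "gl Y"
  shows "Y \<subseteq> ext I x Y" "a \<in> I \<Longrightarrow> a \<otimes> x \<in> ext I x Y" "\<one> \<in> I \<Longrightarrow> x \<in> ext I x Y"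
proof -
  show "Y \<subseteq> ext I x Y"
    using extI[OF glD(3)[OF assms(1)], of _ Y x] assms glD(2)[OF assms(3)] by fastforce
  show *: "a \<in> I \<Longrightarrow> a \<otimes> x \<in> ext I x Y" for a
    using extI[OF _ glD(3)[OF assms(3)], of a I x] assms glD(2)[OF assms(1)] by fastforce
  show "\<one> \<in> I \<Longrightarrow> x \<in> ext I x Y" using *[of \<one>] assms by simp
qed

lemma ext_subset: "gl Z \<Longrightarrow> I \<subseteq> carrier R \<Longrightarrow> x \<in> Z \<Longrightarrow> Y \<subseteq> Z \<Longrightarrow> ext I x Y \<subseteq> Z"
  unfolding ext_def by (auto intro!: glD(4,7))

lemma ext_zero: "I \<subseteq> carrier R \<Longrightarrow> x \<in> carrier R \<Longrightarrow> ext I x {\<zero>} = (\<lambda>a. a \<otimes> x) ` I"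
  unfolding ext_def by force

lemma gl_image: "gl I \<Longrightarrow> x \<in> H g \<Longrightarrow> gl ((\<lambda>a. a \<otimes> x) ` I)"
  using gl_ext[OF _ _ gl_zero] ext_zero glD(1) H_D(2) by metis

text \<open>Comparing degrees in \<open>z = ax + y\<close> allows the coefficient \<open>a\<close>
  to be replaced by a homogeneous one.\<close>

lemma component_ext:
  assumes "x \<in> H g" "gl Y" "z \<in> ext I x Y" "I \<subseteq> carrier R" "k \<in> carrier G"
  obtains a y where "a \<in> I" "y \<in> Y" "z = a \<otimes> x \<oplus> y"
    "cmp k z = cmp (k \<otimes>\<^bsub>G\<^esub> inv\<^bsub>G\<^esub> g) a \<otimes> x \<oplus> cmp k y"
proof -
  obtain a y where *: "z = a \<otimes> x \<oplus> y" "a \<in> I" "y \<in> Y" using assms(3) by (auto simp: ext_def)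
  moreover have "a \<in> carrier R" "x \<in> carrier R" "y \<in> carrier R"
    using * assms(1,2,4) glD(2)[OF assms(2)] H_D by auto
  ultimately show thesis
    using assms that[of a y] by (simp add: component_add component_mult_H'[OF assms(1)])
qed

lemma ex_maximal_gl_avoiding:
  assumes Y: "gl Y" and YW: "Y \<subseteq> W" and x: "x \<notin> Y"
  shows "\<exists>M. gl M \<and> Y \<subseteq> M \<and> M \<subseteq> W \<and> x \<notin> M \<and>
    (\<forall>Z. gl Z \<and> M \<subseteq> Z \<and> Z \<subseteq> W \<and> x \<notin> Z \<longrightarrow> Z = M)"
proof -
  let ?A = "{M. gl M \<and> Y \<subseteq> M \<and> M \<subseteq> W \<and> x \<notin> M}"
  have "\<exists>M\<in>?A. \<forall>Z\<in>?A. M \<subseteq> Z \<longrightarrow> Z = M"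
  proof (rule subset_Zorn_nonempty)
    show "?A \<noteq> {}" using assms by blast
    fix C assume C: "C \<noteq> {}" "subset.chain ?A C"
    have "gl (\<Union>C)" by (rule gl_chain_Union) (use C in \<open>auto simp: subset_chain_def\<close>)
    then show "\<Union>C \<in> ?A" using C by (auto simp: subset_chain_def)
  qed
  then obtain M where M: "M \<in> ?A" "\<forall>Z\<in>?A. M \<subseteq> Z \<longrightarrow> Z = M" by (rule bexE)
  have "gl M" "Y \<subseteq> M" "M \<subseteq> W" "x \<notin> M" using M(1) by auto
  moreover have "Z = M" if "gl Z \<and> M \<subseteq> Z \<and> Z \<subseteq> W \<and> x \<notin> Z" for Z
    by (rule M(2)[rule_format]) (use that \<open>Y \<subseteq> M\<close> in auto)
  ultimately show ?thesis by (intro exI[of _ M] conjI allI impI)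
qed

end

section \<open>Idempotents and the graded Jacobson radical\<close>

locale graded_artinian_ring = graded_ring G R
  for G :: "('g, 'k) monoid_scheme" and R :: "('a, 'g) gring" (structure) +
  assumes artinian: "graded_artinian G R"
begin

abbreviation jac :: "'a set" where "jac \<equiv> graded_jacobson G R"
abbreviation prim :: "'a \<Rightarrow> bool" where "prim \<equiv> primitive_idempotent_in_unit_part G R"

lemma op: "graded_artinian_ring (op_group G) (op_ring R)"
  by (intro graded_artinian_ring.intro graded_ring_op graded_artinian_ring_axioms.intro)
    (simp add: graded_artinian_op artinian)

lemma dcc_gl: "dcc gl"
  using artinian by (simp add: graded_artinian_def)

lemma gl_descending_stable:
  assumes "\<And>n. gl (F n)" "\<And>n. F (Suc n) \<subseteq> F n"
  obtains n :: nat where "\<And>m. m \<ge> n \<Longrightarrow> F m = F n"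
  using dcc_gl assms unfolding dcc_def by blast

lemma minimal_gl:
  assumes "gl I" "Q I"
  obtains K where "gl K" "Q K" "\<forall>L. gl L \<and> Q L \<and> L \<subseteq> K \<longrightarrow> L = K"
  using dcc_minimal[OF dcc_gl, where I = I and Q = Q, OF assms] by (elim exE conjE)

section \<open>Fitting's lemma and local corner rings\<close>

definition nilp :: "'a \<Rightarrow> bool" where "nilp z \<longleftrightarrow> (\<exists>n::nat. z [^] n = \<zero>)"

lemma pow_H: "z \<in> H \<one>\<^bsub>G\<^esub> \<Longrightarrow> z [^] (n::nat) \<in> H \<one>\<^bsub>G\<^esub>"
proof (induction n)
  case (Suc n) then show ?case using H_mult[of "z [^] n" "\<one>\<^bsub>G\<^esub>" z "\<one>\<^bsub>G\<^esub>"] by simp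
qed (simp add: one_H)

lemma pow_op:
  assumes "z \<in> carrier R" shows "z [^]\<^bsub>op_ring R\<^esub> (n::nat) = z [^] n"
proof -
  interpret O: graded_artinian_ring "op_group G" "op_ring R" by (rule op)
  show ?thesis using assms
  proof (induction n)
    case (Suc n) then show ?case
      using nat_pow_Suc2[of z n] O.nat_pow_Suc[of z n] by (simp del: nat_pow_Suc O.nat_pow_Suc)
  qed simp
qed

lemma nilp_op: "z \<in> carrier R \<Longrightarrow> graded_artinian_ring.nilp (op_ring R) z \<longleftrightarrow> nilp z"
  unfolding nilp_def graded_artinian_ring.nilp_def[OF op] by (simp add: pow_op)

text \<open>Because \<open>(yx)^(n+1) = y (xy)^n x\<close>. This exchange makes nilpotency tests
  symmetric between left and right.\<close>

lemma nilp_cyclic: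
  assumes "x \<in> carrier R" "y \<in> carrier R" "nilp (x \<otimes> y)"
  shows "nilp (y \<otimes> x)"
proof -
  have *: "(y \<otimes> x) [^] Suc n = y \<otimes> (x \<otimes> y) [^] n \<otimes> x" for n
  proof (induction n)
    case (Suc n)
    have "(y \<otimes> x) [^] Suc (Suc n) = (y \<otimes> (x \<otimes> y) [^] n \<otimes> x) \<otimes> (y \<otimes> x)"
      using Suc nat_pow_Suc[of "y \<otimes> x" "Suc n"] by argo
    also have "\<dots> = y \<otimes> ((x \<otimes> y) [^] n \<otimes> (x \<otimes> y)) \<otimes> x" using assms by (simp add: m_assoc)
    finally show ?case by simp
  qed (use assms in simp)
  from assms(3) obtain n where "(x \<otimes> y) [^] (n::nat) = \<zero>" by (auto simp: nilp_def)
  with *[of n] assms show ?thesis unfolding nilp_def by (intro exI[of _ "Suc n"]) simp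
qed

text \<open>Modulo \<open>Y\<close>, \<open>x = zx\<close> gives \<open>x = z^n x\<close> for all
  \<open>n\<close>, and some power of \<open>z\<close> is zero. This takes the place of inverting
  \<open>1 - z\<close>.\<close>

lemma nilp_fix_zero:
  assumes z: "z \<in> carrier R" "nilp z" and Y: "gl Y" and x: "x \<in> carrier R"
    and zx: "x \<ominus> z \<otimes> x \<in> Y"
  shows "x \<in> Y"
proof -
  have *: "x \<ominus> z [^] n \<otimes> x \<in> Y" for n :: nat
  proof (induction n)
    case 0 then show ?case using x glD(3)[OF Y] by (simp add: r_neg a_minus_def)
  next
    case (Suc n)
    have "x \<ominus> z [^] Suc n \<otimes> x = (x \<ominus> z [^] n \<otimes> x) \<oplus> z [^] n \<otimes> (x \<ominus> z \<otimes> x)"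
      using x z by (simp add: a_minus_def r_distr r_minus m_assoc a_assoc r_neg1)
    also have "\<dots> \<in> Y" using Suc zx z by (intro glD(4,7)[OF Y]) auto
    finally show ?case .
  qed
  from z obtain n where "z [^] (n::nat) = \<zero>" by (auto simp: nilp_def)
  with *[of n] x show ?thesis by (simp add: a_minus_def)
qed

text \<open>The chain of left ideals \<open>R z^n\<close> becomes stationary, so \<open>z^m\<close>
  lies in \<open>R z^(2m)\<close> for large \<open>m\<close>; comparing degrees, the coefficient may
  be taken in the unit component.\<close>

lemma pow_left:
  assumes z: "z \<in> H \<one>\<^bsub>G\<^esub>"
  shows "\<exists>n::nat. \<forall>m\<ge>n. \<exists>r\<in>H \<one>\<^bsub>G\<^esub>. z [^] m = r \<otimes> (z [^] m \<otimes> z [^] m)"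
proof -
  have zc [simp]: "z \<in> carrier R" using H_D[OF z] by simp
  let ?I = "\<lambda>n::nat. (\<lambda>a. a \<otimes> z [^] n) ` carrier R"
  have "gl (?I n)" for n using gl_image[OF gl_carrier pow_H[OF z]] .
  moreover have "?I (Suc n) \<subseteq> ?I n" for n
  proof
    fix x assume "x \<in> ?I (Suc n)"
    then obtain a where a: "a \<in> carrier R" "x = a \<otimes> z [^] Suc n" by blast
    then have "x = (a \<otimes> z) \<otimes> z [^] n" unfolding nat_pow_Suc2[OF zc] by (simp add: m_assoc)
    moreover have "a \<otimes> z \<in> carrier R" using a by simp
    ultimately show "x \<in> ?I n" by blast
  qed
  ultimately obtain n where n: "\<And>m. m \<ge> n \<Longrightarrow> ?I m = ?I n"
    using gl_descending_stable[of ?I] by blast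
  have "\<exists>r\<in>H \<one>\<^bsub>G\<^esub>. z [^] m = r \<otimes> (z [^] m \<otimes> z [^] m)" if m: "m \<ge> n" for m
  proof -
    have "\<one> \<otimes> z [^] m \<in> ?I m" by (rule imageI) simp
    also have "?I m = ?I (m + m)" using n[of m] n[of "m + m"] m by simp
    finally obtain a where a: "a \<in> carrier R" "z [^] m = a \<otimes> z [^] (m + m)" by auto
    have "z [^] m = cmp \<one>\<^bsub>G\<^esub> (z [^] m)" using pow_H[OF z, of m] by simp
    also have "\<dots> = cmp \<one>\<^bsub>G\<^esub> a \<otimes> z [^] (m + m)"
      unfolding a(2) using component_mult_H[OF pow_H[OF z, of "m + m"] a(1), of "\<one>\<^bsub>G\<^esub>"] by simp
    finally have "z [^] m = cmp \<one>\<^bsub>G\<^esub> a \<otimes> (z [^] m \<otimes> z [^] m)"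
      unfolding nat_pow_mult[OF zc] .
    then show ?thesis using H_component[OF a(1), of "\<one>\<^bsub>G\<^esub>"] by blast
  qed
  then show ?thesis by blast
qed

text \<open>Fitting's lemma in element form. For a large power \<open>y = z^n\<close> the two chain
  conditions give \<open>y = r y^2 = y^2 s\<close>. Then \<open>ry = r y^2 s = ys\<close>, and this
  element is the idempotent \<open>f\<close>, which generates the same left and the same right ideal
  as \<open>y\<close>.\<close>

lemma fitting:
  assumes z: "z \<in> H \<one>\<^bsub>G\<^esub>"
  obtains n :: nat and f r s where "n > 0" "f \<in> H \<one>\<^bsub>G\<^esub>" "r \<in> H \<one>\<^bsub>G\<^esub>" "s \<in> H \<one>\<^bsub>G\<^esub>"
    "f \<otimes> f = f" "f = r \<otimes> z [^] n" "f = z [^] n \<otimes> s" "z [^] n \<otimes> f = z [^] n"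
proof -
  interpret O: graded_artinian_ring "op_group G" "op_ring R" by (rule op)
  have zc [simp]: "z \<in> carrier R" using H_D[OF z] by simp
  obtain a :: nat where a: "\<forall>m\<ge>a. \<exists>r\<in>H \<one>\<^bsub>G\<^esub>. z [^] m = r \<otimes> (z [^] m \<otimes> z [^] m)"
    using pow_left[OF z] by (rule exE)
  have "\<exists>b::nat. \<forall>m\<ge>b. \<exists>s\<in>H \<one>\<^bsub>G\<^esub>. z [^] m = (z [^] m \<otimes> z [^] m) \<otimes> s"
    using O.pow_left[of z] z by (simp add: pow_op)
  then obtain b :: nat where b: "\<forall>m\<ge>b. \<exists>s\<in>H \<one>\<^bsub>G\<^esub>. z [^] m = (z [^] m \<otimes> z [^] m) \<otimes> s"
    by (rule exE)
  \<comment> \<open>The successor makes \<open>n\<close> positive, so that a factor \<open>z\<close>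
    can be split off \<open>z^n\<close> later.\<close>
  define n where "n = Suc (max a b)"
  have n_ge: "n \<ge> a" "n \<ge> b" by (auto simp: n_def)
  let ?y = "z [^] n"
  obtain r where r: "r \<in> H \<one>\<^bsub>G\<^esub>" and ry: "?y = r \<otimes> (?y \<otimes> ?y)" using a n_ge by blast
  obtain s where s: "s \<in> H \<one>\<^bsub>G\<^esub>" and ys: "?y = (?y \<otimes> ?y) \<otimes> s" using b n_ge by blast
  have c [simp]: "r \<in> carrier R" "s \<in> carrier R" "?y \<in> carrier R" using r s H_D by auto
  have e1: "r \<otimes> ?y = ?y \<otimes> s"
  proof -
    have "r \<otimes> ?y = r \<otimes> ((?y \<otimes> ?y) \<otimes> s)" using ys by simp
    also have "\<dots> = (r \<otimes> (?y \<otimes> ?y)) \<otimes> s" by (simp add: m_assoc)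
    finally show ?thesis using ry by simp
  qed
  have e2: "?y \<otimes> (r \<otimes> ?y) = ?y" using ys by (simp add: e1 m_assoc)
  have "(r \<otimes> ?y) \<otimes> (r \<otimes> ?y) = r \<otimes> (?y \<otimes> (r \<otimes> ?y))" by (simp add: m_assoc)
  then have e3: "(r \<otimes> ?y) \<otimes> (r \<otimes> ?y) = r \<otimes> ?y" using e2 by simp
  show thesis
    by (rule that[of n "r \<otimes> ?y" r s])
      (use e1 e2 e3 r s H_mult[OF r pow_H[OF z, of n]] in \<open>simp_all add: n_def\<close>)
qed

lemma primD:
  assumes "prim e"
  shows "e \<in> H \<one>\<^bsub>G\<^esub>" "e \<in> carrier R" "e \<noteq> \<zero>" "e \<otimes> e = e"
  using assms H_D[of e "\<one>\<^bsub>G\<^esub>"] by (auto simp: primitive_idempotent_in_unit_part_def hpart_def)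

lemma prim_op: "primitive_idempotent_in_unit_part (op_group G) (op_ring R) e \<longleftrightarrow> prim e"
  unfolding primitive_idempotent_in_unit_part_def by simp blast

lemma prim_dichotomy:
  assumes e: "prim e" and f: "f \<in> H \<one>\<^bsub>G\<^esub>" "f \<otimes> f = f" "e \<otimes> f = f" "f \<otimes> e = f"
  shows "f = \<zero> \<or> f = e"
proof -
  have c: "e \<in> carrier R" "f \<in> carrier R" using primD[OF e] H_D[OF f(1)] by auto
  let ?f = "e \<ominus> f"
  have "?f \<in> H \<one>\<^bsub>G\<^esub>" using primD[OF e] f by (simp add: H_diff)
  moreover have "?f \<otimes> ?f = ?f" "f \<otimes> ?f = \<zero>" "?f \<otimes> f = \<zero>" "e = f \<oplus> ?f"
    using c f primD[OF e] by (simp_all add: a_minus_def l_distr r_distr l_minus r_minus r_neg l_neg a_ac r_neg2)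
  ultimately have "f = \<zero> \<or> ?f = \<zero>"
    using e f unfolding primitive_idempotent_in_unit_part_def by (auto simp: hpart_def)
  then show ?thesis using c by (auto simp: r_right_minus_eq)
qed

text \<open>The Fitting idempotent \<open>f\<close> of \<open>z\<close> lies in the corner of
  \<open>e\<close>, so it is \<open>0\<close> or \<open>e\<close> by primitivity. In the first case
  \<open>z^n = z^n f = 0\<close>; in the second \<open>e = r z^n\<close> provides a left inverse of
  \<open>z\<close>.\<close>

lemma prim_local:
  assumes e: "prim e" and z: "z \<in> H \<one>\<^bsub>G\<^esub>" "e \<otimes> z = z" "z \<otimes> e = z"
  shows "nilp z \<or> (\<exists>w\<in>H \<one>\<^bsub>G\<^esub>. w \<otimes> z = e \<and> e \<otimes> w = w \<and> w \<otimes> e = w)"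
proof -
  obtain n :: nat and f r s where n: "n > 0" and f: "f \<in> H \<one>\<^bsub>G\<^esub>" "f \<otimes> f = f"
    and rs: "r \<in> H \<one>\<^bsub>G\<^esub>" "s \<in> H \<one>\<^bsub>G\<^esub>" "f = r \<otimes> z [^] n" "f = z [^] n \<otimes> s" "z [^] n \<otimes> f = z [^] n"
    by (rule fitting[OF z(1)])
  obtain k where k: "n = Suc k" using n by (cases n) auto
  have c [simp]: "e \<in> carrier R" "z \<in> carrier R" "r \<in> carrier R" "s \<in> carrier R" "f \<in> carrier R"
    using primD[OF e] z rs f H_D by auto
  have "f \<otimes> e = r \<otimes> (z [^] k \<otimes> (z \<otimes> e))" unfolding rs(3) k by (simp add: m_assoc)
  then have fe: "f \<otimes> e = f" using rs(3) k z by simp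
  have "e \<otimes> f = ((e \<otimes> z) \<otimes> z [^] k) \<otimes> s"
    unfolding rs(4) k nat_pow_Suc2[OF c(2)] by (simp add: m_assoc)
  also have "\<dots> = f" unfolding rs(4) k nat_pow_Suc2[OF c(2)] z(2) ..
  finally have ef: "e \<otimes> f = f" .
  from prim_dichotomy[OF e f ef fe] show ?thesis
  proof
    assume "f = \<zero>" then show ?thesis using rs(5) unfolding nilp_def by auto
  next
    assume fe': "f = e"
    \<comment> \<open>With \<open>n = k + 1\<close>, \<open>r z^k\<close> is a left inverse of
      \<open>z\<close> up to \<open>e\<close>; multiplying by \<open>e\<close> on both sides moves
      it into the corner.\<close>
    let ?w = "e \<otimes> (r \<otimes> z [^] k) \<otimes> e"
    have "?w \<otimes> z = e \<otimes> (r \<otimes> (z [^] k \<otimes> (e \<otimes> z)))" by (simp add: m_assoc)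
    also have "\<dots> = e" using rs(3) k z fe' primD[OF e] by simp
    finally have "?w \<otimes> z = e" .
    moreover have "e \<otimes> ?w = ?w" "?w \<otimes> e = ?w" using primD[OF e] by (simp_all add: m_assoc[symmetric]) (simp add: m_assoc)
    moreover have "?w \<in> H \<one>\<^bsub>G\<^esub>"
      using H_mult[OF H_mult[OF primD(1)[OF e] H_mult[OF rs(1) pow_H[OF z(1), of k]]] primD(1)[OF e]] by simp
    ultimately show ?thesis by blast
  qed
qed

section \<open>The graded Jacobson radical\<close>

lemma ex_maximal_gl:
  assumes "gl Y" "\<one> \<notin> Y"
  obtains M where "maximal_graded_left_ideal G R M" "Y \<subseteq> M" "\<one> \<notin> M"
proof -
  obtain M where M: "gl M" "Y \<subseteq> M" "\<one> \<notin> M"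
    "\<And>Z. gl Z \<Longrightarrow> M \<subseteq> Z \<Longrightarrow> Z \<subseteq> carrier R \<Longrightarrow> \<one> \<notin> Z \<Longrightarrow> Z = M"
    using ex_maximal_gl_avoiding[OF assms(1) glD(1)[OF assms(1)] assms(2)] by blast
  have "Z = M \<or> Z = carrier R" if Z: "gl Z" "M \<subseteq> Z" for Z
  proof (cases "\<one> \<in> Z")
    case True
    then have "r \<in> Z" if "r \<in> carrier R" for r using glD(7)[OF Z(1) that True] that by simp
    then show ?thesis using glD(1)[OF Z(1)] by blast
  next
    case False then show ?thesis using M(4)[OF Z glD(1)[OF Z(1)]] by simp
  qed
  then have "maximal_graded_left_ideal G R M" using M(1,3) unfolding maximal_graded_left_ideal_def by blast
  then show thesis using M that by blast
qed

lemma gl_jac: "gl jac"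
proof -
  have "jac = carrier R \<inter> \<Inter>{I. maximal_graded_left_ideal G R I}"
    by (auto simp: graded_jacobson_def)
  then show ?thesis using gl_Inter[of "{I. maximal_graded_left_ideal G R I}"]
    by (simp add: maximal_graded_left_ideal_def)
qed

text \<open>With \<open>z\<close>, its Fitting idempotent \<open>f\<close> lies in the radical. No
  maximal graded left ideal can then contain \<open>1 - f\<close>, so \<open>1 = a (1 - f)\<close>
  for some \<open>a\<close>; multiplying by \<open>f\<close> gives \<open>f = 0\<close>, and
  \<open>z^n = z^n f = 0\<close>.\<close>

lemma jac_unit_part_nilp:
  assumes z: "z \<in> H \<one>\<^bsub>G\<^esub>" "z \<in> jac"
  shows "nilp z"
proof -
  obtain n :: nat and f r s where n: "n > 0" and f: "f \<in> H \<one>\<^bsub>G\<^esub>" "f \<otimes> f = f"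
    and rs: "r \<in> H \<one>\<^bsub>G\<^esub>" "f = r \<otimes> z [^] n" "z [^] n \<otimes> f = z [^] n"
    by (rule fitting[OF z(1)])
  obtain k where k: "n = Suc k" using n by (cases n) auto
  have c [simp]: "z \<in> carrier R" "r \<in> carrier R" "f \<in> carrier R"
    using z rs f H_D by auto
  have "f = (r \<otimes> z [^] k) \<otimes> z" unfolding rs(2) k by (simp add: m_assoc)
  then have fj: "f \<in> jac" using glD(7)[OF gl_jac _ z(2), of "r \<otimes> z [^] k"] by simp
  let ?Y = "(\<lambda>a. a \<otimes> (\<one> \<ominus> f)) ` carrier R"
  have Y: "gl ?Y" by (rule gl_image[OF gl_carrier H_diff[OF one_H f(1)]])
  have "\<one> \<in> ?Y"
  proof (rule ccontr)
    assume "\<one> \<notin> ?Y"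
    then obtain M where M: "maximal_graded_left_ideal G R M" "?Y \<subseteq> M" "\<one> \<notin> M"
      using ex_maximal_gl[OF Y] by blast
    then have glM: "gl M" and "f \<in> M" using fj by (auto simp: maximal_graded_left_ideal_def graded_jacobson_def)
    moreover have "\<one> \<otimes> (\<one> \<ominus> f) \<in> ?Y" by (rule imageI) simp
    ultimately have "(\<one> \<ominus> f) \<oplus> f \<in> M" using M(2) by (intro glD(4)[OF glM]) auto
    then show False using M(3) by (simp add: a_minus_def a_assoc l_neg)
  qed
  then obtain a where a: "a \<in> carrier R" "\<one> = a \<otimes> (\<one> \<ominus> f)" by auto
  have "f = a \<otimes> (\<one> \<ominus> f) \<otimes> f" unfolding a(2)[symmetric] by simp
  also have "\<dots> = \<zero>" using a(1) f by (simp add: m_assoc a_minus_def l_distr l_minus r_neg)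
  finally show ?thesis using rs(3) by (auto simp: nilp_def)
qed

text \<open>This description of the homogeneous elements of the radical is left-right symmetric by
  \<open>nilp_cyclic\<close>.\<close>

lemma homogeneous_jac_iff:
  assumes x: "x \<in> H g"
  shows "x \<in> jac \<longleftrightarrow> (\<forall>y\<in>H (inv\<^bsub>G\<^esub> g). nilp (y \<otimes> x))"
proof (intro iffI ballI)
  have xc [simp]: "x \<in> carrier R" and g [simp]: "g \<in> carrier G" using H_D[OF x] by auto
  {
    fix y assume "x \<in> jac" and y: "y \<in> H (inv\<^bsub>G\<^esub> g)"
    then have "y \<otimes> x \<in> jac" using glD(7)[OF gl_jac] H_D by blast
    moreover have "y \<otimes> x \<in> H \<one>\<^bsub>G\<^esub>" using H_mult[OF y x] by simp
    ultimately show "nilp (y \<otimes> x)" by (rule jac_unit_part_nilp[rotated])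
  }
  assume nil: "\<forall>y\<in>H (inv\<^bsub>G\<^esub> g). nilp (y \<otimes> x)"
  have "x \<in> M" if M: "maximal_graded_left_ideal G R M" for M
  proof (rule ccontr)
    assume xM: "x \<notin> M"
    have glM: "gl M" and Mne: "M \<noteq> carrier R" using M by (auto simp: maximal_graded_left_ideal_def)
    let ?E = "ext (carrier R) x M"
    have E: "gl ?E" by (rule gl_ext[OF gl_carrier x glM])
    have "?E = carrier R"
      using M E ext_contains[OF gl_carrier xc glM] xM by (auto simp: maximal_graded_left_ideal_def)
    then have "\<one> \<in> ?E" by simp
    then obtain a m where am: "a \<in> carrier R" "m \<in> M" "\<one> = a \<otimes> x \<oplus> m"
      "cmp \<one>\<^bsub>G\<^esub> \<one> = cmp (\<one>\<^bsub>G\<^esub> \<otimes>\<^bsub>G\<^esub> inv\<^bsub>G\<^esub> g) a \<otimes> x \<oplus> cmp \<one>\<^bsub>G\<^esub> m"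
      by (rule component_ext[OF x glM, of \<one> "carrier R" "\<one>\<^bsub>G\<^esub>"]) auto
    \<comment> \<open>Only the part of \<open>a\<close> of degree \<open>inv g\<close> contributes
      to the unit component of \<open>ax\<close>. Passing from \<open>1 = ax + m\<close> to its unit
      component makes the nilpotency hypothesis applicable.\<close>
    define y where "y = cmp (inv\<^bsub>G\<^esub> g) a"
    have y: "y \<in> H (inv\<^bsub>G\<^esub> g)" unfolding y_def using am by (intro H_component) auto
    define m' where "m' = cmp \<one>\<^bsub>G\<^esub> m"
    have yc [simp]: "y \<in> carrier R" using H_D[OF y] by simp
    have m': "m' \<in> M" using glD(8)[OF glM am(2)] by (simp add: m'_def)
    have [simp]: "m' \<in> carrier R" using glD(2)[OF glM m'] .
    have "\<one> = y \<otimes> x \<oplus> m'" using am(4) one_H by (simp add: y_def m'_def)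
    moreover have "y \<otimes> x \<oplus> m' \<ominus> y \<otimes> x = m'" by (simp add: a_minus_def a_ac r_neg r_neg2)
    ultimately have "\<one> \<ominus> y \<otimes> x = m'" by argo
    then have "\<one> \<ominus> y \<otimes> x \<otimes> \<one> = m'" by simp
    then have "\<one> \<in> M" using nilp_fix_zero[OF _ _ glM, of "y \<otimes> x" \<one>] nil y m' by simp
    then have "r \<in> M" if "r \<in> carrier R" for r using glD(7)[OF glM that] that by fastforce
    then show False using Mne glD(1)[OF glM] by blast
  qed
  then show "x \<in> jac" by (simp add: graded_jacobson_def)
qed

lemma jac_op: "graded_jacobson (op_group G) (op_ring R) = jac"
proof -
  interpret O: graded_artinian_ring "op_group G" "op_ring R" by (rule op)
  have hom: "x \<in> O.jac \<longleftrightarrow> x \<in> jac" if x: "x \<in> H g" for x g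
  proof -
    have "x \<in> carrier R" using H_D[OF x] by simp
    then show ?thesis
      using homogeneous_jac_iff[OF x] O.homogeneous_jac_iff[of x g] x H_D(2)[of _ "inv\<^bsub>G\<^esub> g"]
      by (auto simp: nilp_op intro: nilp_cyclic)
  qed
  show ?thesis
  proof (intro equalityI subsetI)
    fix x assume x: "x \<in> O.jac"
    show "x \<in> jac"
    proof (rule gl_mem_if_components[OF gl_jac])
      show xc: "x \<in> carrier R" using O.glD(2)[OF O.gl_jac x] by simp
      fix g assume g: "g \<in> carrier G"
      then show "cmp g x \<in> jac" using hom[OF H_component[OF xc g]] O.glD(8)[OF O.gl_jac x, of g] by simp
    qed
  next
    fix x assume x: "x \<in> jac"
    show "x \<in> O.jac"
    proof (rule O.gl_mem_if_components[OF O.gl_jac])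
      have xc: "x \<in> carrier R" using glD(2)[OF gl_jac x] by simp
      then show "x \<in> carrier (op_ring R)" by simp
      fix g assume g: "g \<in> carrier (op_group G)"
      then show "O.cmp g x \<in> O.jac"
        using hom[OF H_component[OF xc, of g]] glD(8)[OF gl_jac x, of g] by simp
    qed
  qed
qed

lemma jac_right: "x \<in> jac \<Longrightarrow> r \<in> carrier R \<Longrightarrow> x \<otimes> r \<in> jac"
proof -
  interpret O: graded_artinian_ring "op_group G" "op_ring R" by (rule op)
  show "x \<in> jac \<Longrightarrow> r \<in> carrier R \<Longrightarrow> x \<otimes> r \<in> jac"
    using O.glD(7)[OF O.gl_jac, of r x] by (simp add: jac_op)
qed

text \<open>It expresses that \<open>Rf/Jf\<close> is graded simple. Some \<open>yx\<close> in the
  unit component is not nilpotent, hence neither is \<open>fyx\<close>, which lies in the local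
  corner of \<open>f\<close> and is therefore invertible there.\<close>

lemma prim_left_inverse:
  assumes f: "prim f" and x: "x \<in> H g" "x \<otimes> f = x" "x \<notin> jac"
  obtains y where "y \<in> H (inv\<^bsub>G\<^esub> g)" "y \<otimes> x = f" "f \<otimes> y = y"
proof -
  have c [simp]: "f \<in> carrier R" "x \<in> carrier R" "g \<in> carrier G"
    using primD[OF f] H_D[OF x(1)] by auto
  obtain y where y: "y \<in> H (inv\<^bsub>G\<^esub> g)" "\<not> nilp (y \<otimes> x)"
    using homogeneous_jac_iff[OF x(1)] x(3) by blast
  have yc [simp]: "y \<in> carrier R" using H_D[OF y(1)] by simp
  let ?z = "f \<otimes> (y \<otimes> x)"
  have "\<not> nilp ?z"
  proof
    assume "nilp ?z"
    then have "nilp ((y \<otimes> x) \<otimes> f)" using nilp_cyclic[of f "y \<otimes> x"] by simp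
    then show False using y(2) x(2) by (simp add: m_assoc)
  qed
  moreover have "?z \<in> H \<one>\<^bsub>G\<^esub>" using H_mult[OF primD(1)[OF f] H_mult[OF y(1) x(1)]] by simp
  moreover have "f \<otimes> ?z = ?z" using primD[OF f] by (simp add: m_assoc[symmetric])
  moreover have "?z \<otimes> f = ?z" using x(2) by (simp add: m_assoc)
  ultimately obtain w where w: "w \<in> H \<one>\<^bsub>G\<^esub>" "w \<otimes> ?z = f" "f \<otimes> w = w" "w \<otimes> f = w"
    using prim_local[OF f, of ?z] by blast
  have [simp]: "w \<in> carrier R" using H_D[OF w(1)] by simp
  have "(w \<otimes> y) \<otimes> x = (w \<otimes> f) \<otimes> (y \<otimes> x)" using w(4) by (simp add: m_assoc)
  then have "(w \<otimes> y) \<otimes> x = f" using w(2) by (simp add: m_assoc)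
  moreover have "f \<otimes> (w \<otimes> y) = w \<otimes> y" using w(3) by (simp add: m_assoc[symmetric])
  ultimately show thesis using that[of "w \<otimes> y"] H_mult[OF w(1) y(1)] by simp
qed

text \<open>A counterexample \<open>e\<close> with \<open>Re\<close> minimal is not primitive and
  splits as \<open>f + f'\<close>. Both \<open>Rf\<close> and \<open>Rf'\<close> are strictly
  smaller, so \<open>f\<close> and \<open>f'\<close> decompose, and the union of the two families
  decomposes \<open>e\<close>.\<close>

lemma idempotent_decomposition:
  assumes "e \<in> H \<one>\<^bsub>G\<^esub>" "e \<otimes> e = e"
  shows "\<exists>S. finite S \<and> (\<forall>f\<in>S. prim f \<and> e \<otimes> f = f \<and> f \<otimes> e = f) \<and>
    (\<forall>f\<in>S. \<forall>h\<in>S. f \<noteq> h \<longrightarrow> f \<otimes> h = \<zero>) \<and> e = finsum R (\<lambda>f. f) S"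
  (is "?dec e")
proof (rule ccontr)
  assume n: "\<not> ?dec e"
  let ?R = "\<lambda>e. (\<lambda>a. a \<otimes> e) ` carrier R"
  let ?Q = "\<lambda>K. \<exists>e. e \<in> H \<one>\<^bsub>G\<^esub> \<and> e \<otimes> e = e \<and> \<not> ?dec e \<and> K = ?R e"
  have "gl (?R e)" "?Q (?R e)" using n assms gl_image[OF gl_carrier assms(1)] by blast+
  then obtain K where "gl K" "?Q K" and min: "\<forall>L. gl L \<and> ?Q L \<and> L \<subseteq> K \<longrightarrow> L = K"
    by (rule minimal_gl)
  then obtain e where e: "e \<in> H \<one>\<^bsub>G\<^esub>" "e \<otimes> e = e" "\<not> ?dec e" and K: "K = ?R e" by blast
  have ec [simp]: "e \<in> carrier R" using H_D[OF e(1)] by simp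
  \<comment> \<open>If \<open>Rf = Re\<close>, then \<open>e = af\<close> for some \<open>a\<close>,
    so \<open>f' = ef' = aff' = 0\<close>.\<close>
  have smaller: "?dec f" if f: "f \<in> H \<one>\<^bsub>G\<^esub>" "f \<otimes> f = f" "f \<otimes> e = f" "f' \<noteq> \<zero>" "f' \<in> carrier R"
    "e \<otimes> f' = f'" "f \<otimes> f' = \<zero>" for f f'
  proof (rule ccontr)
    assume "\<not> ?dec f"
    have fc [simp]: "f \<in> carrier R" using H_D[OF f(1)] by simp
    have "?R f \<subseteq> ?R e"
    proof
      fix x assume "x \<in> ?R f"
      then obtain a where a: "a \<in> carrier R" "x = a \<otimes> f" by auto
      then have "x = (a \<otimes> f) \<otimes> e" using f(3) by (simp add: m_assoc)
      then show "x \<in> ?R e" using a(1) by simp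
    qed
    moreover have "gl (?R f)" by (rule gl_image[OF gl_carrier f(1)])
    moreover have "?Q (?R f)" using f \<open>\<not> ?dec f\<close> by blast
    ultimately have "?R f = ?R e" by (intro min[rule_format, unfolded K] conjI)
    moreover have "e \<otimes> e \<in> ?R e" by (rule imageI) simp
    ultimately obtain a where a: "a \<in> carrier R" "e = a \<otimes> f" using e(2) by auto
    have "f' = a \<otimes> f \<otimes> f'" using f(6) unfolding a(2) by (rule sym)
    also have "\<dots> = \<zero>" using f a(1) by (simp add: m_assoc)
    finally show False using f(4) by contradiction
  qed
  have "?dec \<zero>" by (rule exI[of _ "{}"]) simp
  then have "e \<noteq> \<zero>" using e(3) by blast
  moreover have "\<not> prim e"
  proof
    assume "prim e"
    then have "?dec e" using e by (intro exI[of _ "{e}"]) (auto simp: finsum_insert)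
    then show False using e(3) by contradiction
  qed
  moreover have "H \<one>\<^bsub>G\<^esub> = ring_part R \<one>\<^bsub>G\<^esub>" by (simp add: hpart_def)
  ultimately obtain f f' where f: "f \<in> H \<one>\<^bsub>G\<^esub>" "f' \<in> H \<one>\<^bsub>G\<^esub>" "f \<otimes> f = f" "f' \<otimes> f' = f'"
    "f \<otimes> f' = \<zero>" "f' \<otimes> f = \<zero>" "e = f \<oplus> f'" "f \<noteq> \<zero>" "f' \<noteq> \<zero>"
    using e unfolding primitive_idempotent_in_unit_part_def by auto
  have [simp]: "f \<in> carrier R" "f' \<in> carrier R" using f H_D by auto
  have ef: "e \<otimes> f = f" "f \<otimes> e = f" "e \<otimes> f' = f'" "f' \<otimes> e = f'"
    using f by (simp_all add: l_distr r_distr)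
  obtain S where S: "finite S" "\<forall>h\<in>S. prim h \<and> f \<otimes> h = h \<and> h \<otimes> f = h"
    "\<forall>h\<in>S. \<forall>k\<in>S. h \<noteq> k \<longrightarrow> h \<otimes> k = \<zero>" "f = finsum R (\<lambda>f. f) S"
    using smaller[of f f'] f ef by auto
  obtain S' where S': "finite S'" "\<forall>h\<in>S'. prim h \<and> f' \<otimes> h = h \<and> h \<otimes> f' = h"
    "\<forall>h\<in>S'. \<forall>k\<in>S'. h \<noteq> k \<longrightarrow> h \<otimes> k = \<zero>" "f' = finsum R (\<lambda>f. f) S'"
    using smaller[of f' f] f ef by auto
  have Sc: "h \<in> carrier R" if "h \<in> S \<union> S'" for h using S(2) S'(2) primD that by blast
  have orth: "h \<otimes> h' = \<zero>" "h' \<otimes> h = \<zero>" if "h \<in> S" "h' \<in> S'" for h h'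
  proof -
    have c: "h \<in> carrier R" "h' \<in> carrier R" using Sc that by auto
    have "h \<otimes> h' = (h \<otimes> f) \<otimes> (f' \<otimes> h')" using S S' that by simp
    also have "\<dots> = h \<otimes> (f \<otimes> f') \<otimes> h'" using c by (simp only: m_assoc m_closed \<open>f \<in> carrier R\<close> \<open>f' \<in> carrier R\<close>)
    finally show "h \<otimes> h' = \<zero>" using f(5) c by simp
    have "h' \<otimes> h = (h' \<otimes> f') \<otimes> (f \<otimes> h)" using S S' that by simp
    also have "\<dots> = h' \<otimes> (f' \<otimes> f) \<otimes> h" using c by (simp only: m_assoc m_closed \<open>f \<in> carrier R\<close> \<open>f' \<in> carrier R\<close>)
    finally show "h' \<otimes> h = \<zero>" using f(6) c by simp
  qed
  have disj: "S \<inter> S' = {}"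
  proof (rule ccontr)
    assume "S \<inter> S' \<noteq> {}"
    then obtain h where h: "h \<in> S" "h \<in> S'" by blast
    then show False using orth[OF h] S(2) primD[of h] by auto
  qed
  have "e = finsum R (\<lambda>f. f) (S \<union> S')"
    using f(7) S(1,4) S'(1,4) disj Sc by (subst finsum_Un_disjoint) auto
  moreover have "e \<otimes> h = h \<and> h \<otimes> e = h" if "h \<in> S" for h
  proof -
    have c: "h \<in> carrier R" and h: "f \<otimes> h = h" "h \<otimes> f = h" using Sc that S by auto
    have "e \<otimes> (f \<otimes> h) = f \<otimes> h" "(h \<otimes> f) \<otimes> e = h \<otimes> f" using c ef
      by (simp_all only: m_assoc[symmetric] ec \<open>f \<in> carrier R\<close>) (simp_all only: m_assoc ec \<open>f \<in> carrier R\<close> ef)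
    then show ?thesis using h by simp
  qed
  moreover have "e \<otimes> h = h \<and> h \<otimes> e = h" if "h \<in> S'" for h
  proof -
    have c: "h \<in> carrier R" and h: "f' \<otimes> h = h" "h \<otimes> f' = h" using Sc that S' by auto
    have "e \<otimes> (f' \<otimes> h) = f' \<otimes> h" "(h \<otimes> f') \<otimes> e = h \<otimes> f'" using c ef
      by (simp_all only: m_assoc[symmetric] ec \<open>f' \<in> carrier R\<close>) (simp_all only: m_assoc ec \<open>f' \<in> carrier R\<close> ef)
    then show ?thesis using h by simp
  qed
  ultimately have "?dec e"
    using S S' orth by (intro exI[of _ "S \<union> S'"]) auto
  then show False using e(3) by contradiction
qed

section \<open>Covers and composition series of graded left ideals\<close>

text \<open>Says that \<open>W/Y\<close> is a graded simple module.\<close>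

definition cover :: "'a set \<Rightarrow> 'a set \<Rightarrow> bool" where
  "cover Y W \<longleftrightarrow> gl Y \<and> gl W \<and> Y \<subset> W \<and> (\<forall>Z. gl Z \<and> Y \<subseteq> Z \<and> Z \<subseteq> W \<longrightarrow> Z = Y \<or> Z = W)"

lemma coverD:
  assumes "cover Y W"
  shows "gl Y" "gl W" "Y \<subseteq> W" "Y \<noteq> W" "gl Z \<Longrightarrow> Y \<subseteq> Z \<Longrightarrow> Z \<subseteq> W \<Longrightarrow> Z = Y \<or> Z = W"
  using assms unfolding cover_def by auto

lemma ex_prim_not_mem:
  assumes "gl Y" "x \<in> carrier R" "x \<notin> Y"
  obtains f where "prim f" "f \<otimes> x \<notin> Y"
proof -
  obtain S where S: "finite S" "\<forall>f\<in>S. prim f" "\<one> = finsum R (\<lambda>f. f) S"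
    using idempotent_decomposition[OF one_H] by auto
  have c: "f \<in> carrier R" if "f \<in> S" for f using S(2) primD(2) that by blast
  have "\<exists>f\<in>S. f \<otimes> x \<notin> Y"
  proof (rule ccontr)
    assume n: "\<not> (\<exists>f\<in>S. f \<otimes> x \<notin> Y)"
    have "x = finsum R (\<lambda>f. f) S \<otimes> x" unfolding S(3)[symmetric] using assms(2) by simp
    also have "\<dots> = finsum R (\<lambda>f. f \<otimes> x) S" using S(1) c assms(2) by (intro finsum_ldistr) auto
    also have "\<dots> \<in> Y"
      by (rule additive_subgroup_finsum_closed) (use assms(1) S(1) n in \<open>auto simp: gl_iff\<close>)
    finally show False using assms(3) by contradiction
  qed
  then show thesis using that S(2) by blast
qed

text \<open>Since \<open>1\<close> is a sum of primitive idempotents, any gap between graded left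
  ideals is witnessed by a homogeneous element that a primitive idempotent fixes from the left. By
  \<open>cover_ext\<close>, such an element generates a simple factor over \<open>Y\<close> as soon
  as the radical sends it into \<open>Y\<close>.\<close>

lemma ex_homogeneous_prim_not_mem:
  assumes "gl Y" "gl W" "\<not> W \<subseteq> Y"
  obtains f g x where "prim f" "x \<in> H g" "x \<in> W" "x \<notin> Y" "f \<otimes> x = x"
proof -
  obtain g x where x: "x \<in> H g" "x \<in> W" "x \<notin> Y" using gl_homogeneous_diff[OF assms(2,1,3)] by blast
  obtain f where f: "prim f" "f \<otimes> x \<notin> Y" using ex_prim_not_mem[OF assms(1) _ x(3)] H_D[OF x(1)] by blast
  have c: "f \<in> carrier R" "x \<in> carrier R" "g \<in> carrier G" using primD[OF f(1)] H_D[OF x(1)] by auto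
  have "f \<otimes> x \<in> H g" using H_mult[OF primD(1)[OF f(1)] x(1)] c by simp
  moreover have "f \<otimes> (f \<otimes> x) = f \<otimes> x" using primD[OF f(1)] c by (simp add: m_assoc[symmetric])
  ultimately show thesis using that f glD(7)[OF assms(2) c(1) x(2)] by blast
qed

text \<open>The map \<open>rf |-> rx\<close> presents \<open>(Rx + Y)/Y\<close> as a quotient of
  \<open>Rf/Jf\<close>, which is simple. In elements: a homogeneous \<open>rx + y\<close> outside
  \<open>Y\<close> forces \<open>r\<close> outside the radical, and then \<open>wr = f\<close>
  recovers \<open>x = wrx\<close>.\<close>

lemma cover_ext:
  assumes f: "prim f" and x: "x \<in> H g" "f \<otimes> x = x" "x \<notin> Y" and Y: "gl Y"
    and j: "\<And>j. j \<in> jac \<Longrightarrow> j \<otimes> x \<in> Y"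
  shows "cover Y (ext (carrier R) x Y)"
proof -
  have c [simp]: "f \<in> carrier R" "x \<in> carrier R" "g \<in> carrier G" using primD[OF f] H_D[OF x(1)] by auto
  let ?E = "ext (carrier R) x Y"
  have E: "gl ?E" "Y \<subseteq> ?E" "x \<in> ?E"
    using gl_ext[OF gl_carrier x(1) Y] ext_contains[OF gl_carrier c(2) Y] by auto
  have "Z = ?E" if Z: "gl Z" "Y \<subseteq> Z" "Z \<subseteq> ?E" "Z \<noteq> Y" for Z
  proof -
    have "\<not> Z \<subseteq> Y" using Z by blast
    then obtain h z where z: "z \<in> H h" "z \<in> Z" "z \<notin> Y" using gl_homogeneous_diff[OF Z(1) Y] by blast
    have h: "h \<in> carrier G" using H_D[OF z(1)] by simp
    have "z \<in> ?E" using z Z by blast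
    then obtain a y where ay: "a \<in> carrier R" "y \<in> Y" "z = a \<otimes> x \<oplus> y"
      "cmp h z = cmp (h \<otimes>\<^bsub>G\<^esub> inv\<^bsub>G\<^esub> g) a \<otimes> x \<oplus> cmp h y"
      by (rule component_ext[OF x(1) Y, of z "carrier R" h]) (use h in auto)
    \<comment> \<open>The factor \<open>f\<close> does not change \<open>rx\<close>, as
      \<open>fx = x\<close>, and provides \<open>rf = r\<close>, as \<open>prim_left_inverse\<close>
      demands.\<close>
    define r where "r = cmp (h \<otimes>\<^bsub>G\<^esub> inv\<^bsub>G\<^esub> g) a \<otimes> f"
    define y' where "y' = cmp h y"
    have "cmp (h \<otimes>\<^bsub>G\<^esub> inv\<^bsub>G\<^esub> g) a \<in> H (h \<otimes>\<^bsub>G\<^esub> inv\<^bsub>G\<^esub> g)" using ay(1) h by (intro H_component) auto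
    from H_mult[OF this primD(1)[OF f]] have r: "r \<in> H (h \<otimes>\<^bsub>G\<^esub> inv\<^bsub>G\<^esub> g)" using h by (simp add: r_def)
    have rc [simp]: "r \<in> carrier R" using H_D[OF r] by simp
    have y': "y' \<in> Y" using glD(8)[OF Y ay(2) h] by (simp add: y'_def)
    have y'c [simp]: "y' \<in> carrier R" using glD(2)[OF Y y'] .
    have zr: "z = r \<otimes> x \<oplus> y'" using ay(1,4) x(2) z(1) by (simp add: r_def y'_def m_assoc)
    have rf: "r \<otimes> f = r" using ay(1) primD[OF f] by (simp add: r_def m_assoc)
    have "r \<notin> jac" using j[of r] y' z(3) zr glD(4)[OF Y] by blast
    then obtain w where w: "w \<in> H (inv\<^bsub>G\<^esub> (h \<otimes>\<^bsub>G\<^esub> inv\<^bsub>G\<^esub> g))" "w \<otimes> r = f"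
      using prim_left_inverse[OF f r rf] by blast
    have [simp]: "w \<in> carrier R" using H_D[OF w(1)] by simp
    have "r \<otimes> x = z \<ominus> y'" unfolding zr by (simp add: a_minus_def a_assoc r_neg)
    then have "r \<otimes> x \<in> Z" using glD(6)[OF Z(1)] z(2) y' Z(2) by auto
    then have "w \<otimes> (r \<otimes> x) \<in> Z" using glD(7)[OF Z(1)] by simp
    moreover have "w \<otimes> (r \<otimes> x) = x" using w(2) x(2) by (simp add: m_assoc[symmetric])
    ultimately have "x \<in> Z" by simp
    then show "Z = ?E" using ext_subset[OF Z(1) _ _ Z(2), of "carrier R" x] Z(3) by auto
  qed
  moreover have "Y \<noteq> ?E" using E(3) x(3) by blast
  ultimately show ?thesis using E Y unfolding cover_def by blast
qed

lemma cover_principal: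
  assumes "prim f" "x \<in> H g" "f \<otimes> x = x" "x \<noteq> \<zero>" "\<And>j. j \<in> jac \<Longrightarrow> j \<otimes> x = \<zero>"
  shows "cover {\<zero>} ((\<lambda>a. a \<otimes> x) ` carrier R)"
  using cover_ext[OF assms(1-3) _ gl_zero] assms(4,5) ext_zero[of "carrier R" x] H_D[OF assms(2)] by simp

text \<open>Simplicity leaves \<open>Jx + Y = Y\<close> or \<open>Jx + Y = W\<close> for homogeneous
  \<open>x\<close>. In the second case \<open>x - zx\<close> lies in \<open>Y\<close> for some
  \<open>z\<close> of neutral degree in the radical; \<open>z\<close> is nilpotent, so
  \<open>x\<close> lies in \<open>Y\<close> after all.\<close>

lemma jac_cover:
  assumes C: "cover Y W" and j: "j \<in> jac" and x: "x \<in> W"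
  shows "j \<otimes> x \<in> Y"
proof -
  note Y = coverD(1)[OF C] and W = coverD(2)[OF C]
  have jc [simp]: "j \<in> carrier R" using glD(2)[OF gl_jac j] .
  have hom: "j \<otimes> x \<in> Y" if x: "x \<in> H g" "x \<in> W" for x g
  proof -
    have xc [simp]: "x \<in> carrier R" "g \<in> carrier G" using H_D[OF x(1)] by auto
    let ?E = "ext jac x Y"
    have E: "gl ?E" "Y \<subseteq> ?E" "j \<otimes> x \<in> ?E"
      using gl_ext[OF gl_jac x(1) Y] ext_contains[OF gl_jac xc(1) Y] j by auto
    have "?E \<subseteq> W" by (rule ext_subset[OF W glD(1)[OF gl_jac] x(2) coverD(3)[OF C]])
    then consider "?E = Y" | "?E = W" using coverD(5)[OF C E(1,2)] by blast
    then show ?thesis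
    proof cases
      case 1 then show ?thesis using E(3) by simp
    next
      case 2
      then have "x \<in> ?E" using x(2) by simp
      then obtain a y where ay: "a \<in> jac" "y \<in> Y" "x = a \<otimes> x \<oplus> y"
        "cmp g x = cmp (g \<otimes>\<^bsub>G\<^esub> inv\<^bsub>G\<^esub> g) a \<otimes> x \<oplus> cmp g y"
        by (rule component_ext[OF x(1) Y, of x jac g]) (use glD(1)[OF gl_jac] in auto)
      define z where "z = cmp \<one>\<^bsub>G\<^esub> a"
      define y' where "y' = cmp g y"
      have ac: "a \<in> carrier R" using glD(2)[OF gl_jac ay(1)] .
      have z: "z \<in> H \<one>\<^bsub>G\<^esub>" "z \<in> jac"
        unfolding z_def using H_component[OF ac] glD(8)[OF gl_jac ay(1)] by auto
      have zc [simp]: "z \<in> carrier R" using H_D[OF z(1)] by simp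
      have y': "y' \<in> Y" unfolding y'_def by (rule glD(8)[OF Y ay(2)]) simp
      have [simp]: "y' \<in> carrier R" using glD(2)[OF Y y'] .
      have "x = z \<otimes> x \<oplus> y'" using ay(4) x(1) by (simp add: z_def y'_def)
      moreover have "z \<otimes> x \<oplus> y' \<ominus> z \<otimes> x = y'" by (simp add: a_minus_def a_ac r_neg r_neg2)
      ultimately have "x \<ominus> z \<otimes> x = y'" by argo
      then have "x \<in> Y" using nilp_fix_zero[OF zc jac_unit_part_nilp[OF z] Y xc(1)] y' by simp
      then show ?thesis using glD(7)[OF Y jc] by simp
    qed
  qed
  have "x \<in> carrier R" using glD(2)[OF W x] .
  then show ?thesis
  proof (induction rule: homogeneous_induct)
    case zero then show ?case using glD(3)[OF Y] by simp
  next
    case (homogeneous g y)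
    then show ?case using hom[of y g] glD(8)[OF W x] by (simp add: hpart_def)
  next
    case (add y z) then show ?case using glD(4)[OF Y] by (simp add: r_distr)
  qed
qed

section \<open>Nakayama's lemma and maximal graded subideals\<close>

lemma gl_ideal_prod:
  assumes I: "gl I" and K: "gl K"
  shows "gl (ideal_prod R I K)"
proof (rule glI)
  let ?P = "ideal_prod R I K"
  show sub: "?P \<subseteq> carrier R"
  proof
    fix x assume "x \<in> ?P" then show "x \<in> carrier R"
      by (induction rule: ideal_prod.induct) (auto simp: glD(2)[OF I] glD(2)[OF K])
  qed
  show "\<zero> \<in> ?P" using ideal_prod.prod[OF glD(3)[OF I] glD(3)[OF K], of R] by simp
  show "x \<oplus> y \<in> ?P" if "x \<in> ?P" "y \<in> ?P" for x y using that by (rule ideal_prod.sum)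
  show "r \<otimes> x \<in> ?P" if "r \<in> carrier R" "x \<in> ?P" for r x
    using that(2)
  proof (induction rule: ideal_prod.induct)
    case (prod i k)
    then have "r \<otimes> (i \<otimes> k) = (r \<otimes> i) \<otimes> k" using that(1) glD(2)[OF I] glD(2)[OF K] by (simp add: m_assoc)
    then show ?case using ideal_prod.prod[OF glD(7)[OF I that(1)], of i k] prod by simp
  next
    case (sum x y)
    then have "x \<in> carrier R" "y \<in> carrier R" using sub by auto
    then show ?case using sum that(1) by (simp add: r_distr ideal_prod.sum)
  qed
  show "cmp g x \<in> ?P" if "x \<in> ?P" "g \<in> carrier G" for x g
    using that(1)
  proof (induction rule: ideal_prod.induct)
    case (prod i k)
    have kc [simp]: "k \<in> carrier R" using glD(2)[OF K] prod by simp
    have ic: "i \<in> carrier R" using glD(2)[OF I] prod by simp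
    then show ?case
    proof (induction rule: homogeneous_induct)
      case zero
      then show ?case using \<open>\<zero> \<in> ?P\<close> by (simp add: component_zero)
    next
      case (homogeneous h y)
      then have y: "y \<in> H h" "y \<in> I" using glD(8)[OF I prod(1)] by (auto simp: hpart_def)
      have "cmp (inv\<^bsub>G\<^esub> h \<otimes>\<^bsub>G\<^esub> g) k \<in> K" using that(2) homogeneous(1) by (intro glD(8)[OF K prod(2)]) auto
      then show ?case using component_H_mult'[OF y(1) kc that(2)] ideal_prod.prod[OF y(2)] by simp
    next
      case (add y z)
      then show ?case by (simp add: l_distr component_add ideal_prod.sum)
    qed
  next
    case (sum x y)
    then have "x \<in> carrier R" "y \<in> carrier R" using sub by auto
    then show ?case using sum by (simp add: component_add ideal_prod.sum)
  qed
qed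

lemma ideal_prod_subset:
  assumes "gl K" "\<And>i k. i \<in> I \<Longrightarrow> k \<in> W \<Longrightarrow> i \<otimes> k \<in> K"
  shows "ideal_prod R I W \<subseteq> K"
proof
  fix x assume "x \<in> ideal_prod R I W" then show "x \<in> K"
    by (induction rule: ideal_prod.induct) (auto simp: assms(2) glD(4)[OF assms(1)])
qed

text \<open>Nakayama's lemma for a possibly not finitely generated \<open>W\<close>: a minimal \<open>T\<close> with
  \<open>T W = W\<close> is idempotent, and a minimal \<open>K\<close> with \<open>T K \<noteq> 0\<close> is of the form \<open>T k\<close>.\<close>

lemma nakayama:
  assumes W: "gl W" and sub: "W \<subseteq> ideal_prod R jac W"
  shows "W = {\<zero>}"
proof (rule ccontr)
  assume Wne: "W \<noteq> {\<zero>}"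
  obtain T where T: "gl T" "T \<subseteq> jac" "W \<subseteq> ideal_prod R T W"
    and Tmin: "\<forall>L. gl L \<and> (L \<subseteq> jac \<and> W \<subseteq> ideal_prod R L W) \<and> L \<subseteq> T \<longrightarrow> L = T"
    by (rule minimal_gl[OF gl_jac, of "\<lambda>L. L \<subseteq> jac \<and> W \<subseteq> ideal_prod R L W"]) (use sub in auto)
  note Tc = glD(2)[OF T(1)] and Wc = glD(2)[OF W]
  let ?TT = "ideal_prod R T T"
  have TT: "gl ?TT" by (rule gl_ideal_prod[OF T(1) T(1)])
  have TTT: "?TT \<subseteq> T" by (rule ideal_prod_subset[OF T(1)]) (use glD(7)[OF T(1)] Tc in auto)
  have TTW: "gl (ideal_prod R ?TT W)" by (rule gl_ideal_prod[OF TT W])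
  have "t \<otimes> u \<in> ideal_prod R ?TT W" if t: "t \<in> T" and "u \<in> ideal_prod R T W" for t u
    using that(2)
  proof (induction rule: ideal_prod.induct)
    case (prod i k)
    then have "t \<otimes> (i \<otimes> k) = (t \<otimes> i) \<otimes> k" using t Tc Wc by (simp add: m_assoc)
    then show ?case using prod t by (simp add: ideal_prod.prod)
  next
    case (sum x y)
    then have "x \<in> carrier R" "y \<in> carrier R" using glD(2)[OF gl_ideal_prod[OF T(1) W]] by auto
    then show ?case using sum t Tc by (simp add: r_distr ideal_prod.sum)
  qed
  \<comment> \<open>As \<open>W\<close> is contained in \<open>TW\<close>, this puts
    \<open>W\<close> into \<open>(TT)W\<close>, and minimality of \<open>T\<close> applies to
    \<open>TT\<close>.\<close>
  then have "ideal_prod R T W \<subseteq> ideal_prod R ?TT W" using T(3) by (intro ideal_prod_subset[OF TTW]) blast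
  then have "?TT = T" using T TTT TT by (intro Tmin[rule_format]) auto
  have "\<not> ?TT \<subseteq> {\<zero>}"
  proof
    assume "?TT \<subseteq> {\<zero>}"
    then have "T \<subseteq> {\<zero>}" using \<open>?TT = T\<close> by simp
    then have "ideal_prod R T W \<subseteq> {\<zero>}" using Wc by (intro ideal_prod_subset[OF gl_zero]) auto
    then show False using T(3) Wne glD(3)[OF W] by auto
  qed
  then have "\<exists>t\<in>T. \<exists>k\<in>T. t \<otimes> k \<noteq> \<zero>" using ideal_prod_subset[OF gl_zero, of T T] by blast
  then obtain K where K: "gl K" "\<exists>t\<in>T. \<exists>k\<in>K. t \<otimes> k \<noteq> \<zero>"
    and Kmin: "\<forall>L. gl L \<and> (\<exists>t\<in>T. \<exists>k\<in>L. t \<otimes> k \<noteq> \<zero>) \<and> L \<subseteq> K \<longrightarrow> L = K"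
    by (rule minimal_gl[OF T(1), of "\<lambda>L. \<exists>t\<in>T. \<exists>k\<in>L. t \<otimes> k \<noteq> \<zero>"])
  obtain t k where tk: "t \<in> T" "k \<in> K" "t \<otimes> k \<noteq> \<zero>" using K(2) by blast
  have "\<exists>g k. k \<in> H g \<and> k \<in> K \<and> t \<otimes> k \<noteq> \<zero>"
  proof (rule ccontr)
    assume n: "\<not> ?thesis"
    have "k \<in> carrier R" using glD(2)[OF K(1) tk(2)] .
    then have "t \<otimes> k = \<zero>"
    proof (induction rule: homogeneous_induct)
      case (homogeneous g y)
      then have "y \<in> H g" "y \<in> K" using glD(8)[OF K(1) tk(2), of g] by (simp_all add: hpart_def)
      then show ?case using n by blast
    qed (use Tc[OF tk(1)] in \<open>auto simp: r_distr\<close>)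
    then show False using tk(3) by contradiction
  qed
  then obtain g k where k: "k \<in> H g" "k \<in> K" "t \<otimes> k \<noteq> \<zero>" by blast
  have kc [simp]: "k \<in> carrier R" "g \<in> carrier G" using H_D[OF k(1)] by auto
  \<comment> \<open>\<open>T(Tk) = (TT)k = Tk\<close> is not zero, so minimality of \<open>K\<close>
    gives \<open>Tk = K\<close>, and \<open>k = sk\<close> with \<open>s\<close> in the radical. As
    \<open>k\<close> is homogeneous, \<open>s\<close> may be replaced by its neutral component, a
    nilpotent element, which forces \<open>k = 0\<close>.\<close>
  let ?L = "(\<lambda>a. a \<otimes> k) ` T"
  have "\<exists>s\<in>T. \<exists>l\<in>?L. s \<otimes> l \<noteq> \<zero>"
  proof (rule ccontr)
    assume n: "\<not> ?thesis"
    have "u \<otimes> k = \<zero>" if "u \<in> ?TT" for u using that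
    proof (induction rule: ideal_prod.induct)
      case (prod i j)
      then have "(i \<otimes> j) \<otimes> k = i \<otimes> (j \<otimes> k)" using Tc by (simp add: m_assoc)
      then show ?case using n prod by auto
    next
      case (sum x y)
      then have "x \<in> carrier R" "y \<in> carrier R" using glD(2)[OF TT] by auto
      then show ?case using sum by (simp add: l_distr)
    qed
    then show False using \<open>?TT = T\<close> tk(1) k(3) by blast
  qed
  moreover have "?L \<subseteq> K" using glD(7)[OF K(1) Tc k(2)] by auto
  ultimately have "?L = K" by (intro Kmin[rule_format] conjI gl_image[OF T(1) k(1)])
  then obtain s where s: "s \<in> T" "k = s \<otimes> k" using k(2) by auto
  let ?z = "cmp \<one>\<^bsub>G\<^esub> s"
  have "cmp g k = cmp (g \<otimes>\<^bsub>G\<^esub> inv\<^bsub>G\<^esub> g) s \<otimes> k"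
    by (subst s(2), rule component_mult_H'[OF k(1) Tc[OF s(1)]]) simp
  then have "k = ?z \<otimes> k" using k(1) by simp
  then have "k \<ominus> ?z \<otimes> k = \<zero>" using Tc[OF s(1)] by (simp add: r_right_minus_eq)
  moreover have "nilp ?z"
    using glD(8)[OF gl_jac, of s "\<one>\<^bsub>G\<^esub>"] H_component[OF Tc[OF s(1)], of "\<one>\<^bsub>G\<^esub>"] T(2) s(1)
    by (intro jac_unit_part_nilp) auto
  ultimately have "k = \<zero>" using nilp_fix_zero[OF _ _ gl_zero kc(1), of ?z] Tc[OF s(1)] by simp
  then show False using k(3) Tc[OF tk(1)] by simp
qed

text \<open>By Nakayama's lemma some homogeneous \<open>x\<close> of \<open>W\<close> lies outside
  \<open>JW\<close>; let \<open>Y\<close> be maximal between \<open>JW\<close> and \<open>W\<close>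
  without \<open>x\<close>. A homogeneous \<open>w\<close> of \<open>W\<close> outside
  \<open>Y\<close> that is fixed by a primitive idempotent yields a cover \<open>Rw + Y\<close> of
  \<open>Y\<close>, which contains \<open>x\<close> by maximality and so equals
  \<open>Rx + Y\<close>. Hence \<open>W = Rx + Y\<close>.\<close>

lemma ex_cover_below:
  assumes W: "gl W" "W \<noteq> {\<zero>}"
  shows "\<exists>Y. cover Y W"
proof -
  let ?P = "ideal_prod R jac W"
  have P: "gl ?P" by (rule gl_ideal_prod[OF gl_jac W(1)])
  have PW: "?P \<subseteq> W" using glD(7)[OF W(1) glD(2)[OF gl_jac]] by (intro ideal_prod_subset[OF W(1)])
  have "\<not> W \<subseteq> ?P" using nakayama[OF W(1)] W(2) by blast
  then obtain f g x where x: "prim f" "x \<in> H g" "x \<in> W" "x \<notin> ?P" "f \<otimes> x = x"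
    using ex_homogeneous_prim_not_mem[OF P W(1)] by blast
  obtain Y where Y: "gl Y" "?P \<subseteq> Y" "Y \<subseteq> W" "x \<notin> Y"
    and Ymax: "\<forall>Z. gl Z \<and> Y \<subseteq> Z \<and> Z \<subseteq> W \<and> x \<notin> Z \<longrightarrow> Z = Y"
    using ex_maximal_gl_avoiding[OF P PW x(4)] by (elim exE conjE) (rule that)
  have jY: "j \<otimes> w \<in> Y" if "j \<in> jac" "w \<in> W" for j w
    using ideal_prod.prod[OF that, of R] Y(2) by blast
  let ?E = "ext (carrier R) x Y"
  have E: "cover Y ?E" by (rule cover_ext[OF x(1,2,5) Y(4,1) jY[OF _ x(3)]])
  have "W \<subseteq> ?E"
  proof (rule ccontr)
    assume "\<not> W \<subseteq> ?E"
    then obtain f' g' w where w: "prim f'" "w \<in> H g'" "w \<in> W" "w \<notin> ?E" "f' \<otimes> w = w"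
      using ex_homogeneous_prim_not_mem[OF coverD(2)[OF E] W(1)] by blast
    have wY: "w \<notin> Y" using w(4) coverD(3)[OF E] by blast
    let ?F = "ext (carrier R) w Y"
    have F: "cover Y ?F" by (rule cover_ext[OF w(1,2,5) wY Y(1) jY[OF _ w(3)]])
    have "?F \<subseteq> W" by (rule ext_subset[OF W(1) subset_refl w(3) Y(3)])
    then have "x \<in> ?F" using Ymax coverD[OF F] by blast
    then have "?E \<subseteq> ?F" by (rule ext_subset[OF coverD(2)[OF F] subset_refl _ coverD(3)[OF F]])
    then have "?E = ?F" using coverD(5)[OF F coverD(2,3)[OF E]] coverD(4)[OF E] by blast
    then show False using w(4) ext_contains(3)[OF gl_carrier _ Y(1), of w] H_D[OF w(2)] by simp
  qed
  moreover have "?E \<subseteq> W" by (rule ext_subset[OF W(1) subset_refl x(3) Y(3)])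
  ultimately have "?E = W" by blast
  then show ?thesis using E by blast
qed

section \<open>Composition series and length\<close>

definition composition_series :: "nat \<Rightarrow> (nat \<Rightarrow> 'a set) \<Rightarrow> bool" where
  "composition_series n C \<longleftrightarrow>
     C 0 = {\<zero>} \<and> C n = carrier R \<and> (\<forall>k<n. cover (C k) (C (Suc k)))"

text \<open>Below a minimal graded left ideal without a finite series there is a maximal graded
  subideal that has one, and it extends by a step. This is the graded counterpart of the
  Hopkins-Levitzki theorem.\<close>

lemma ex_composition_series: "\<exists>n C. composition_series n C"
proof -
  define P where
    "P W \<longleftrightarrow> (\<exists>n C. C (0::nat) = {\<zero>} \<and> C n = W \<and> (\<forall>k<n. cover (C k) (C (Suc k))))" for W
  have "P (carrier R)"
  proof (rule ccontr)
    assume "\<not> P (carrier R)"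
    then obtain W where W: "gl W" "\<not> P W" and min: "\<forall>L. gl L \<and> \<not> P L \<and> L \<subseteq> W \<longrightarrow> L = W"
      by (rule minimal_gl[OF gl_carrier, of "\<lambda>L. \<not> P L"])
    have "P {\<zero>}" unfolding P_def by (intro exI[of _ 0] exI[of _ "\<lambda>_. {\<zero>}"]) simp
    then obtain Y where Y: "cover Y W" using ex_cover_below[OF W(1)] W(2) by metis
    then have "P Y" using min[rule_format, of Y] coverD(1,3,4)[OF Y] by argo
    then obtain n C where C: "C (0::nat) = {\<zero>}" "C n = Y" "\<forall>k<n. cover (C k) (C (Suc k))"
      unfolding P_def by (elim exE conjE)
    then have "P W" unfolding P_def using Y
      by (intro exI[of _ "Suc n"] exI[of _ "C(Suc n := W)"]) (auto simp: less_Suc_eq)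
    then show False using W(2) by contradiction
  qed
  then show ?thesis unfolding composition_series_def P_def .
qed

text \<open>Steps of \<open>E\<close> may be trivial; \<open>gl_rank\<close> counts the factors of \<open>E\<close> that are hit by \<open>W\<close>.\<close>

definition weak_series :: "nat \<Rightarrow> (nat \<Rightarrow> 'a set) \<Rightarrow> bool" where
  "weak_series n E \<longleftrightarrow>
     E 0 = {\<zero>} \<and> E n = carrier R \<and> (\<forall>k<n. E k = E (Suc k) \<or> cover (E k) (E (Suc k)))"

definition gl_rank :: "nat \<Rightarrow> (nat \<Rightarrow> 'a set) \<Rightarrow> 'a set \<Rightarrow> nat" where
  "gl_rank n E W = card {k. k < n \<and> \<not> W \<inter> E (Suc k) \<subseteq> E k}"

text \<open>Suppose the ranks agree. Then every factor of \<open>E\<close> hit by \<open>W\<close>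
  is also hit by \<open>V\<close>, hence filled by \<open>V\<close> because it is simple. Induction
  along \<open>E\<close> then puts all of \<open>W\<close> into \<open>V\<close>: modulo
  \<open>V\<close>, an element of \<open>W\<close> can be pushed one step down in
  \<open>E\<close>.\<close>

lemma gl_rank_strict:
  assumes E: "weak_series n E" and VW: "gl V" "gl W" "V \<subset> W"
  shows "gl_rank n E V < gl_rank n E W"
proof (rule ccontr)
  assume n: "\<not> ?thesis"
  let ?A = "\<lambda>W. {k. k < n \<and> \<not> W \<inter> E (Suc k) \<subseteq> E k}"
  have sub: "?A V \<subseteq> ?A W" using VW(3) by auto
  have eq: "?A V = ?A W"
    by (rule card_seteq) (use n sub in \<open>auto simp: gl_rank_def\<close>)
  have "W \<inter> E k \<subseteq> V" if "k \<le> n" for k using that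
  proof (induction k)
    case 0 then show ?case using E glD(3)[OF VW(1)] by (auto simp: weak_series_def)
  next
    case (Suc k)
    show ?case
    proof (cases "k \<in> ?A W")
      case False then show ?thesis using Suc by auto
    next
      case True
      then have k: "k < n" "\<not> V \<inter> E (Suc k) \<subseteq> E k" using eq by auto
      then have C: "cover (E k) (E (Suc k))" using E unfolding weak_series_def by blast
      have gVE: "gl (V \<inter> E (Suc k))" by (rule gl_Int[OF VW(1) coverD(2)[OF C]])
      obtain g x where x: "x \<in> H g" "x \<in> V" "x \<in> E (Suc k)" "x \<notin> E k"
        using gl_homogeneous_diff[OF gVE coverD(1)[OF C] k(2)] by blast
      have xc: "x \<in> carrier R" using H_D[OF x(1)] by simp
      let ?F = "ext (carrier R) x (E k)"
      have F: "gl ?F" "E k \<subseteq> ?F" "x \<in> ?F"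
        using gl_ext[OF gl_carrier x(1) coverD(1)[OF C]] ext_contains[OF gl_carrier xc coverD(1)[OF C]] by auto
      have "?F \<subseteq> E (Suc k)" by (rule ext_subset[OF coverD(2)[OF C] subset_refl x(3) coverD(3)[OF C]])
      then have FE: "?F = E (Suc k)" using coverD(5)[OF C F(1,2)] F(3) x(4) by blast
      show ?thesis
      proof
        fix w assume w: "w \<in> W \<inter> E (Suc k)"
        then have "w \<in> ?F" using FE by simp
        then obtain a y where ay: "a \<in> carrier R" "y \<in> E k" "w = a \<otimes> x \<oplus> y" by (auto simp: ext_def)
        have yc: "y \<in> carrier R" using glD(2)[OF coverD(1)[OF C] ay(2)] .
        have ax: "a \<otimes> x \<in> V" using glD(7)[OF VW(1) ay(1) x(2)] .
        have "y = w \<ominus> a \<otimes> x" using ay(1) xc yc unfolding ay(3) by (simp add: a_minus_def a_ac r_neg r_neg2)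
        also have "\<dots> \<in> W" using w ax VW(3) by (intro glD(6)[OF VW(2)]) auto
        finally have "y \<in> V" using Suc ay(2) by auto
        then show "w \<in> V" unfolding ay(3) using ax glD(4)[OF VW(1)] by simp
      qed
    qed
  qed
  from this[of n] have "W \<subseteq> V" using E glD(1)[OF VW(2)] by (auto simp: weak_series_def)
  then show False using VW(3) by blast
qed

lemma composition_series_weak: "composition_series n C \<Longrightarrow> weak_series n C"
  by (auto simp: composition_series_def weak_series_def)

text \<open>Along \<open>C\<close> the rank with respect to \<open>E\<close> grows at every step,
  and it counts proper steps of \<open>E\<close> only. This inequality is the part of the
  Jordan-Hoelder theorem that the argument uses.\<close>

lemma composition_series_length_le:
  assumes C: "composition_series m C" and E: "weak_series n E"
  shows "m \<le> card {k. k < n \<and> E k \<noteq> E (Suc k)}"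
proof -
  have "k \<le> gl_rank n E (C k)" if "k \<le> m" for k using that
  proof (induction k)
    case (Suc k)
    then have "cover (C k) (C (Suc k))" using C by (auto simp: composition_series_def)
    then have "gl_rank n E (C k) < gl_rank n E (C (Suc k))"
      by (intro gl_rank_strict[OF E]) (auto simp: cover_def)
    then show ?case using Suc by simp
  qed simp
  from this[of m] have "m \<le> gl_rank n E (C m)" by simp
  also have "\<dots> \<le> card {k. k < n \<and> E k \<noteq> E (Suc k)}"
    unfolding gl_rank_def by (rule card_mono) auto
  finally show ?thesis .
qed

text \<open>The rank along a fixed composition series is bounded and strictly monotone, so ascending
  chains stop. This supplies the chain condition in \<open>graded_quasi_frobenius\<close>.\<close>

lemma acc_gl: "acc gl"
  unfolding acc_def
proof (intro allI impI)
  fix F :: "nat \<Rightarrow> 'a set" assume F: "(\<forall>n. gl (F n)) \<and> (\<forall>n. F n \<subseteq> F (Suc n))"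
  obtain m C where C: "composition_series m C" using ex_composition_series by blast
  let ?r = "\<lambda>n. gl_rank m C (F n)"
  have gF: "gl (F n)" and up: "F n \<subseteq> F (Suc n)" for n using F by auto
  have mono: "F i \<subseteq> F j" if "i \<le> j" for i j using lift_Suc_mono_le[of F, OF up that] .
  have "?r n \<le> m" for n
  proof -
    have "?r n \<le> card {k. k < m}" unfolding gl_rank_def by (rule card_mono) auto
    then show ?thesis by simp
  qed
  then have "range ?r \<subseteq> {..m}" by (intro image_subsetI) simp
  then have fin: "finite (range ?r)" by (rule finite_subset) simp
  then have "Max (range ?r) \<in> range ?r" by (rule Max_in) simp
  then obtain n where n: "?r n = Max (range ?r)" by auto
  have "F k = F n" if "k \<ge> n" for k
  proof (rule ccontr)
    assume "F k \<noteq> F n"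
    then have "F n \<subset> F k" using mono[OF that] by blast
    then have "?r n < ?r k" by (intro gl_rank_strict[OF composition_series_weak[OF C] gF gF])
    also have "\<dots> \<le> ?r n" unfolding n using fin by simp
    finally show False by simp
  qed
  then show "\<exists>n. \<forall>k\<ge>n. F k = F n" by (intro exI[of _ n] allI impI)
qed

section \<open>Annihilators of the radical and Baer's criterion\<close>

text \<open>\<open>rann jac\<close> is the graded socle of \<open>R\<close> as a left module, by
  \<open>graded_soc_sub\<close>, and \<open>lann jac\<close> is that of \<open>R\<close> as a right
  module.\<close>

definition rann :: "'a set \<Rightarrow> 'a set" where
  "rann I = {z \<in> carrier R. \<forall>a\<in>I. a \<otimes> z = \<zero>}"

definition lann :: "'a set \<Rightarrow> 'a set" where
  "lann I = {z \<in> carrier R. \<forall>a\<in>I. z \<otimes> a = \<zero>}"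

lemma rann_op: "graded_artinian_ring.rann (op_ring R) I = lann I"
  unfolding graded_artinian_ring.rann_def[OF op] lann_def by simp

lemma lann_op: "graded_artinian_ring.lann (op_ring R) I = rann I"
  unfolding graded_artinian_ring.lann_def[OF op] rann_def by simp

lemma component_rann:
  assumes I: "gl I" and z: "z \<in> rann I" and g: "g \<in> carrier G"
  shows "cmp g z \<in> rann I"
proof -
  have zc: "z \<in> carrier R" using z by (simp add: rann_def)
  have "a \<otimes> cmp g z = \<zero>" if a: "a \<in> I" for a
  proof -
    have "a \<in> carrier R" using glD(2)[OF I a] .
    then show ?thesis
    proof (induction rule: homogeneous_induct)
      case (homogeneous h y)
      then have y: "y \<in> H h" "y \<in> I" using glD(8)[OF I a] by (auto simp: hpart_def)
      have "y \<otimes> cmp g z = cmp (h \<otimes>\<^bsub>G\<^esub> g) (y \<otimes> z)" by (rule component_H_mult[OF y(1) zc g, symmetric])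
      then show ?case using z y(2) by (simp add: rann_def component_zero)
    qed (use zc in \<open>auto simp: l_distr\<close>)
  qed
  then show ?thesis using zc by (simp add: rann_def)
qed

lemma gr_rann: "gl I \<Longrightarrow> graded_left_ideal (op_group G) (op_ring R) (rann I)"
proof -
  interpret O: graded_artinian_ring "op_group G" "op_ring R" by (rule op)
  assume I: "gl I"
  show ?thesis
  proof (rule O.glI)
    show "O.cmp g z \<in> rann I" if "z \<in> rann I" "g \<in> carrier (op_group G)" for z g
      using component_rann[OF I] that by simp
  qed (use glD(2)[OF I] in \<open>auto simp: rann_def r_distr m_assoc[symmetric]\<close>)
qed

lemma gl_rann_jac: "gl (rann jac)"
proof (rule glI)
  show "r \<otimes> z \<in> rann jac" if "r \<in> carrier R" "z \<in> rann jac" for r z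
    using that jac_right glD(2)[OF gl_jac] by (auto simp: rann_def m_assoc[symmetric])
qed (use component_rann[OF gl_jac] glD(2)[OF gl_jac] in \<open>auto simp: rann_def r_distr\<close>)

text \<open>Right multiplication by an element of degree \<open>g\<close> sends degree
  \<open>a\<close> to \<open>a g\<close>. Letting \<open>g\<close> vary takes care of all shifts at
  once, and as only \<open>R\<close> and its left ideals occur, no test type for modules
  enters.\<close>

definition baer :: bool where
  "baer \<longleftrightarrow> (\<forall>I g \<phi>. gl I \<longrightarrow> g \<in> carrier G \<longrightarrow> (\<forall>x\<in>I. \<phi> x \<in> carrier R) \<longrightarrow>
     (\<forall>x\<in>I. \<forall>y\<in>I. \<phi> (x \<oplus> y) = \<phi> x \<oplus> \<phi> y) \<longrightarrow> (\<forall>r\<in>carrier R. \<forall>x\<in>I. \<phi> (r \<otimes> x) = r \<otimes> \<phi> x) \<longrightarrow>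
     (\<forall>a. \<forall>x\<in>I. x \<in> H a \<longrightarrow> \<phi> x \<in> H (a \<otimes>\<^bsub>G\<^esub> g)) \<longrightarrow> (\<exists>y\<in>H g. \<forall>x\<in>I. \<phi> x = x \<otimes> y))"

lemma baerD:
  assumes baer "gl I" "g \<in> carrier G" "\<And>x. x \<in> I \<Longrightarrow> \<phi> x \<in> carrier R"
    "\<And>x y. x \<in> I \<Longrightarrow> y \<in> I \<Longrightarrow> \<phi> (x \<oplus> y) = \<phi> x \<oplus> \<phi> y"
    "\<And>r x. r \<in> carrier R \<Longrightarrow> x \<in> I \<Longrightarrow> \<phi> (r \<otimes> x) = r \<otimes> \<phi> x"
    "\<And>a x. x \<in> I \<Longrightarrow> x \<in> H a \<Longrightarrow> \<phi> x \<in> H (a \<otimes>\<^bsub>G\<^esub> g)"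
  obtains y where "y \<in> H g" "\<And>x. x \<in> I \<Longrightarrow> \<phi> x = x \<otimes> y"
proof -
  have "\<exists>y\<in>H g. \<forall>x\<in>I. \<phi> x = x \<otimes> y"
    using assms(1) unfolding baer_def by (elim allE[of _ I] allE[of _ g] allE[of _ \<phi>]) (simp add: assms)
  then show thesis using that by blast
qed

text \<open>The graded right ideals \<open>f (rann jac)\<close>, for \<open>f\<close> primitive, are simple or zero.\<close>

definition right_socle_simple :: bool where
  "right_socle_simple \<longleftrightarrow> (\<forall>f z w s. prim f \<longrightarrow> z \<in> H s \<longrightarrow> z \<noteq> \<zero> \<longrightarrow> f \<otimes> z = z \<longrightarrow> z \<in> rann jac \<longrightarrow>
     f \<otimes> w = w \<longrightarrow> w \<in> rann jac \<longrightarrow> (\<exists>c\<in>carrier R. w = z \<otimes> c))"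

section \<open>Annihilators along a composition series\<close>

lemma cover_generator:
  assumes C: "cover Y W" and a: "a \<in> H g" "a \<in> W" "a \<notin> Y"
  shows "W = ext (carrier R) a Y"
proof -
  let ?E = "ext (carrier R) a Y"
  have ac: "a \<in> carrier R" using H_D[OF a(1)] by simp
  have E: "gl ?E" "Y \<subseteq> ?E" "a \<in> ?E"
    using gl_ext[OF gl_carrier a(1) coverD(1)[OF C]] ext_contains[OF gl_carrier ac coverD(1)[OF C]] by auto
  have "?E \<subseteq> W" by (rule ext_subset[OF coverD(2)[OF C] subset_refl a(2) coverD(3)[OF C]])
  then show ?thesis using coverD(5)[OF C E(1,2)] E(3) a(3) by blast
qed

text \<open>An element \<open>z\<close> killing \<open>Y\<close> but not \<open>W\<close> has
  \<open>az \<noteq> 0\<close>, because \<open>W = Ra + Y\<close>. Since \<open>Ja\<close> lies in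
  \<open>Y\<close>, the element \<open>az\<close> lies in \<open>f (rann jac)\<close> and is a
  generator of it.\<close>

lemma right_socle_simple_factor:
  assumes rs: right_socle_simple and C: "cover Y W"
    and f: "prim f" and a: "a \<in> H g" "f \<otimes> a = a" "a \<in> W" "a \<notin> Y"
    and z: "z \<in> H h" "z \<in> rann Y" "z \<notin> rann W"
    and w: "w \<in> carrier R" "f \<otimes> w = w" "w \<in> rann jac"
  obtains c where "c \<in> carrier R" "w = a \<otimes> (z \<otimes> c)"
proof -
  have c [simp]: "a \<in> carrier R" "z \<in> carrier R" "f \<in> carrier R" using H_D[OF a(1)] H_D[OF z(1)] primD[OF f] by auto
  have "a \<otimes> z \<noteq> \<zero>"
  proof
    assume az: "a \<otimes> z = \<zero>"
    have "x \<otimes> z = \<zero>" if "x \<in> W" for x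
    proof -
      have "x \<in> ext (carrier R) a Y" using that cover_generator[OF C a(1,3,4)] by simp
      then obtain r y where ry: "r \<in> carrier R" "y \<in> Y" "x = r \<otimes> a \<oplus> y" by (auto simp: ext_def)
      have "y \<in> carrier R" using glD(2)[OF coverD(1)[OF C] ry(2)] .
      then show ?thesis using ry az z(2) by (simp add: l_distr m_assoc rann_def)
    qed
    then show False using z(3) by (simp add: rann_def)
  qed
  moreover have "a \<otimes> z \<in> rann jac"
    using jac_cover[OF C _ a(3)] z(2) glD(2)[OF gl_jac] by (auto simp: rann_def m_assoc[symmetric])
  moreover have "f \<otimes> (a \<otimes> z) = a \<otimes> z" using a(2) by (simp add: m_assoc[symmetric])
  ultimately obtain d where "d \<in> carrier R" "w = (a \<otimes> z) \<otimes> d"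
    using rs f H_mult[OF a(1) z(1)] w unfolding right_socle_simple_def by blast
  then show thesis using that by (simp add: m_assoc)
qed

lemma jac_mult_rann:
  assumes C: "cover Y W" and a: "a \<in> W" and z: "z \<in> rann Y"
  shows "a \<otimes> z \<in> rann jac"
proof -
  have "a \<in> carrier R" using glD(2)[OF coverD(2)[OF C] a] .
  then show ?thesis using jac_cover[OF C _ a] z glD(2)[OF gl_jac] by (auto simp: rann_def m_assoc[symmetric])
qed

text \<open>For \<open>a\<close> generating \<open>W\<close> modulo \<open>Y\<close>, the map
  \<open>w |-> aw\<close> embeds \<open>rann Y / rann W\<close> into \<open>f (rann jac)\<close>,
  which is simple or zero as a graded right ideal.\<close>

lemma rann_cover:
  assumes rs: right_socle_simple and C: "cover Y W"
  shows "rann W = rann Y \<or> graded_artinian_ring.cover (op_group G) (op_ring R) (rann W) (rann Y)"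
proof -
  interpret O: graded_artinian_ring "op_group G" "op_ring R" by (rule op)
  note Y = coverD(1)[OF C] and W = coverD(2)[OF C]
  have gY: "O.gl (rann Y)" and gW: "O.gl (rann W)" using gr_rann Y W by auto
  have sub: "rann W \<subseteq> rann Y" using coverD(3)[OF C] by (auto simp: rann_def)
  have "\<not> W \<subseteq> Y" using coverD(3,4)[OF C] by blast
  then obtain f g a where a: "prim f" "a \<in> H g" "a \<in> W" "a \<notin> Y" "f \<otimes> a = a"
    using ex_homogeneous_prim_not_mem[OF Y W] by blast
  have c [simp]: "a \<in> carrier R" "f \<in> carrier R" using H_D[OF a(2)] primD[OF a(1)] by auto
  have max: "Z = rann Y" if Z: "O.gl Z" "rann W \<subseteq> Z" "Z \<subseteq> rann Y" "Z \<noteq> rann W" for Z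
  proof -
    have "\<not> Z \<subseteq> rann W" using Z by blast
    then obtain h z where "z \<in> O.H h" "z \<in> Z" "z \<notin> rann W" using O.gl_homogeneous_diff[OF Z(1) gW] by blast
    then have z: "z \<in> H h" "z \<in> Z" "z \<notin> rann W" by simp_all
    have zc [simp]: "z \<in> carrier R" using H_D[OF z(1)] by simp
    have zY: "z \<in> rann Y" using z Z by blast
    have "w \<in> Z" if w: "w \<in> rann Y" for w
    proof -
      have wc [simp]: "w \<in> carrier R" using w by (simp add: rann_def)
      have "f \<otimes> (a \<otimes> w) = a \<otimes> w" using a(5) by (simp add: m_assoc[symmetric])
      then obtain d where d: "d \<in> carrier R" "a \<otimes> w = a \<otimes> (z \<otimes> d)"
        using right_socle_simple_factor[OF rs C a(1,2,5,3,4) z(1) zY z(3), of "a \<otimes> w"]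
          jac_mult_rann[OF C a(3) w] by auto
      have zd: "z \<otimes> d \<in> rann Y" using O.glD(7)[OF gY, of d z] d zY by simp
      \<comment> \<open>The difference is annihilated by \<open>a\<close> and by \<open>Y\<close>,
        hence by \<open>W = Ra + Y\<close>.\<close>
      have "w \<ominus> z \<otimes> d \<in> rann W"
        unfolding rann_def
      proof (intro CollectI conjI ballI)
        show "w \<ominus> z \<otimes> d \<in> carrier R" using d by simp
        fix x assume "x \<in> W"
        then have "x \<in> ext (carrier R) a Y" using cover_generator[OF C a(2,3,4)] by simp
        then obtain r y where ry: "r \<in> carrier R" "y \<in> Y" "x = r \<otimes> a \<oplus> y" by (auto simp: ext_def)
        have yc: "y \<in> carrier R" using glD(2)[OF Y ry(2)] .
        have "y \<otimes> w = \<zero>" "y \<otimes> (z \<otimes> d) = \<zero>" using w zd ry(2) by (auto simp: rann_def)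
        then have "x \<otimes> w = r \<otimes> (a \<otimes> w)" "x \<otimes> (z \<otimes> d) = r \<otimes> (a \<otimes> w)"
          using ry yc d by (simp_all add: l_distr m_assoc)
        then show "x \<otimes> (w \<ominus> z \<otimes> d) = \<zero>"
          using ry yc d by (simp add: a_minus_def r_distr r_minus r_neg)
      qed
      then have "(w \<ominus> z \<otimes> d) \<oplus> z \<otimes> d \<in> Z"
        using O.glD(4)[OF Z(1), of "w \<ominus> z \<otimes> d" "z \<otimes> d"] O.glD(7)[OF Z(1), of d z] Z(2) z(2) d by auto
      then show ?thesis using d by (simp add: a_minus_def a_assoc l_neg)
    qed
    then show ?thesis using Z by blast
  qed
  show ?thesis
  proof (cases "rann W = rann Y")
    case False
    have "O.cover (rann W) (rann Y)"
      unfolding O.cover_def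
    proof (intro conjI allI impI)
      show "rann W \<subset> rann Y" using sub False by blast
      show "Z = rann W \<or> Z = rann Y" if "O.gl Z \<and> rann W \<subseteq> Z \<and> Z \<subseteq> rann Y" for Z
        using max[of Z] that by argo
    qed (rule gW gY)+
    then show ?thesis ..
  qed simp
qed

text \<open>Annihilators reverse inclusions, hence the index \<open>n - k\<close>. Steps may
  collapse, so only a weak series of the opposite ring results.\<close>

lemma rann_weak_series:
  assumes rs: right_socle_simple and C: "composition_series n C"
  shows "graded_artinian_ring.weak_series (op_group G) (op_ring R) n (\<lambda>k. rann (C (n - k)))"
proof -
  interpret O: graded_artinian_ring "op_group G" "op_ring R" by (rule op)
  have "rann (carrier R) = {\<zero>}"
  proof -
    have "z = \<zero>" if "z \<in> rann (carrier R)" for z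
    proof -
      have "z \<in> carrier R" "\<one> \<otimes> z = \<zero>" using that by (simp_all add: rann_def)
      then show ?thesis by simp
    qed
    then show ?thesis by (auto simp: rann_def)
  qed
  moreover have "rann {\<zero>} = carrier R" by (auto simp: rann_def)
  moreover have "rann (C (n - k)) = rann (C (n - Suc k)) \<or>
      O.cover (rann (C (n - k))) (rann (C (n - Suc k)))" if "k < n" for k
  proof -
    have "cover (C (n - Suc k)) (C (Suc (n - Suc k)))" using C that by (simp add: composition_series_def)
    then have "cover (C (n - Suc k)) (C (n - k))" using that by (simp add: Suc_diff_Suc)
    then show ?thesis by (rule rann_cover[OF rs])
  qed
  ultimately show ?thesis using C by (simp add: O.weak_series_def composition_series_def)
qed

lemma op_composition_series_length_le:
  assumes rs: right_socle_simple and C: "composition_series n C"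
    and D: "graded_artinian_ring.composition_series (op_group G) (op_ring R) m D"
  shows "m \<le> card {k. k < n \<and> rann (C (n - k)) \<noteq> rann (C (n - Suc k))}"
  by (rule graded_artinian_ring.composition_series_length_le[OF op D rann_weak_series[OF rs C]])

text \<open>If both socles are componentwise simple, then passing to annihilators shows that neither of
  the composition lengths of \<open>R\<close> exceeds the other, so no step of the annihilator series is trivial.\<close>

lemma rann_series_strict:
  assumes rs: right_socle_simple
    and ls: "graded_artinian_ring.right_socle_simple (op_group G) (op_ring R)"
    and C: "composition_series n C" and k: "k < n"
  shows "rann (C k) \<noteq> rann (C (Suc k))"
proof -
  interpret O: graded_artinian_ring "op_group G" "op_ring R" by (rule op)
  obtain m D where D: "O.composition_series m D" using O.ex_composition_series by blast
  let ?A = "{k. k < n \<and> rann (C (n - k)) \<noteq> rann (C (n - Suc k))}"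
  let ?B = "{k. k < m \<and> O.rann (D (m - k)) \<noteq> O.rann (D (m - Suc k))}"
  \<comment> \<open>\<open>C\<close> is read as a composition series of the double opposite, so that
    the length estimate of the opposite ring applies to it.\<close>
  have C': "graded_artinian_ring.composition_series (op_group (op_group G)) (op_ring (op_ring R)) n C"
    using C by simp
  have "n \<le> card ?B" by (rule O.op_composition_series_length_le[OF ls D C'])
  also have "\<dots> \<le> card {..<m}" by (rule card_mono) auto
  finally have "n \<le> m" by simp
  also have "m \<le> card ?A" by (rule op_composition_series_length_le[OF rs C D])
  finally have "card {..<n} \<le> card ?A" by simp
  then have "?A = {..<n}" by (intro card_seteq) auto
  moreover have "n - Suc k \<in> {..<n}" using k by simp
  ultimately have "n - Suc k \<in> ?A" by blast
  then show ?thesis using k by (auto simp: Suc_diff_Suc)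
qed

text \<open>\<open>\<phi>\<close> is realised as right multiplication by some \<open>y\<close> on
  \<open>I \<inter> C k\<close>, for growing \<open>k\<close>. If the next factor is hit by
  \<open>a\<close>, the error \<open>b = \<phi> a - ay\<close> is killed by the radical, because
  \<open>Ja\<close> already lies in \<open>I \<inter> C k\<close>. So \<open>b = azd\<close> for
  some \<open>z\<close> annihilating \<open>C k\<close>, and \<open>y + zd\<close> works one step
  further.\<close>

lemma baerI:
  assumes rs: right_socle_simple
    and ls: "graded_artinian_ring.right_socle_simple (op_group G) (op_ring R)"
  shows baer
  unfolding baer_def
proof (intro allI impI)
  interpret O: graded_artinian_ring "op_group G" "op_ring R" by (rule op)
  fix I g \<phi>
  assume I: "gl I" and g: "g \<in> carrier G" and \<phi>c: "\<forall>x\<in>I. \<phi> x \<in> carrier R"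
    and \<phi>a: "\<forall>x\<in>I. \<forall>y\<in>I. \<phi> (x \<oplus> y) = \<phi> x \<oplus> \<phi> y"
    and \<phi>m: "\<forall>r\<in>carrier R. \<forall>x\<in>I. \<phi> (r \<otimes> x) = r \<otimes> \<phi> x"
    and \<phi>h: "\<forall>a. \<forall>x\<in>I. x \<in> H a \<longrightarrow> \<phi> x \<in> H (a \<otimes>\<^bsub>G\<^esub> g)"
  note Ic = glD(2)[OF I]
  have \<phi>0: "\<phi> \<zero> = \<zero>" using \<phi>m[rule_format, of \<zero> \<zero>] \<phi>c glD(3)[OF I] by simp
  obtain n C where C: "composition_series n C" using ex_composition_series by blast
  have "\<exists>y\<in>carrier R. \<forall>r\<in>I \<inter> C k. \<phi> r = r \<otimes> y" if "k \<le> n" for k using that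
  proof (induction k)
    case 0
    then show ?case using C \<phi>0 by (intro bexI[of _ \<zero>]) (auto simp: composition_series_def)
  next
    case (Suc k)
    then obtain y where y [simp]: "y \<in> carrier R" and \<phi>y: "\<forall>r\<in>I \<inter> C k. \<phi> r = r \<otimes> y" by auto
    have cov: "cover (C k) (C (Suc k))" using C Suc.prems by (simp add: composition_series_def)
    note gk = coverD(1)[OF cov] and gS = coverD(2)[OF cov]
    show ?case
    proof (cases "I \<inter> C (Suc k) \<subseteq> C k")
      case True then show ?thesis using y \<phi>y by (intro bexI[of _ y]) auto
    next
      case False
      obtain f h a where a: "prim f" "a \<in> H h" "a \<in> I \<inter> C (Suc k)" "a \<notin> C k" "f \<otimes> a = a"
        using ex_homogeneous_prim_not_mem[OF gk gl_Int[OF I gS] False] by blast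
      have c [simp]: "a \<in> carrier R" "f \<in> carrier R" "\<phi> a \<in> carrier R"
        using H_D[OF a(2)] primD[OF a(1)] a(3) \<phi>c by auto
      \<comment> \<open>Strictness of the annihilator series provides a \<open>z\<close> that kills
        \<open>C k\<close> but not \<open>C (Suc k)\<close>.\<close>
      have "rann (C k) \<noteq> rann (C (Suc k))" using rann_series_strict[OF rs ls C] Suc.prems by simp
      moreover have "rann (C (Suc k)) \<subseteq> rann (C k)" using coverD(3)[OF cov] by (auto simp: rann_def)
      ultimately have "\<not> rann (C k) \<subseteq> rann (C (Suc k))" by blast
      then obtain h' z where "z \<in> O.H h'" and z: "z \<in> rann (C k)" "z \<notin> rann (C (Suc k))"
        using O.gl_homogeneous_diff[OF gr_rann[OF gk] gr_rann[OF gS]] by blast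
      then have zh: "z \<in> H h'" by simp
      have zc [simp]: "z \<in> carrier R" using H_D[OF zh] by simp
      let ?b = "\<phi> a \<ominus> a \<otimes> y"
      have "f \<otimes> \<phi> a = \<phi> a" using \<phi>m[rule_format, of f a] a by auto
      then have fb: "f \<otimes> ?b = ?b" using a(5) by (simp add: a_minus_def r_distr r_minus m_assoc[symmetric])
      have "j \<otimes> ?b = \<zero>" if j: "j \<in> jac" for j
      proof -
        have jc: "j \<in> carrier R" using glD(2)[OF gl_jac j] .
        have "j \<otimes> a \<in> I \<inter> C k" using jac_cover[OF cov j] a(3) glD(7)[OF I jc] by auto
        then have "\<phi> (j \<otimes> a) = (j \<otimes> a) \<otimes> y" using \<phi>y by blast
        then have "j \<otimes> \<phi> a = j \<otimes> (a \<otimes> y)" using \<phi>m jc a(3) by (simp add: m_assoc)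
        then show ?thesis using jc by (simp add: a_minus_def r_distr r_minus r_neg)
      qed
      then have "?b \<in> rann jac" by (simp add: rann_def)
      then obtain d where d: "d \<in> carrier R" "?b = a \<otimes> (z \<otimes> d)"
        using right_socle_simple_factor[OF rs cov a(1,2,5) _ a(4) zh z _ fb] a(3) by auto
      have \<phi>a': "\<phi> a = a \<otimes> (z \<otimes> d) \<oplus> a \<otimes> y"
        unfolding d(2)[symmetric] by (simp add: a_minus_def a_assoc l_neg)
      let ?y = "y \<oplus> z \<otimes> d"
      have "\<phi> r = r \<otimes> ?y" if r: "r \<in> I \<inter> C (Suc k)" for r
      proof -
        have "r \<in> ext (carrier R) a (C k)" using r cover_generator[OF cov a(2) _ a(4)] a(3) by simp
        then obtain s x where sx: "s \<in> carrier R" "x \<in> C k" "r = s \<otimes> a \<oplus> x" by (auto simp: ext_def)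
        have xc [simp]: "x \<in> carrier R" using glD(2)[OF gk sx(2)] .
        have sa: "s \<otimes> a \<in> I" using glD(7)[OF I sx(1)] a(3) by simp
        have "x = r \<ominus> s \<otimes> a" using sx(1) unfolding sx(3) by (simp add: a_minus_def a_ac r_neg r_neg2)
        also have "\<dots> \<in> I" using glD(6)[OF I] r sa by simp
        finally have xI: "x \<in> I" .
        have "\<phi> r = s \<otimes> \<phi> a \<oplus> \<phi> x" unfolding sx(3) using \<phi>a \<phi>m sa xI sx(1) a(3) by auto
        also have "\<phi> x = x \<otimes> y" using \<phi>y xI sx(2) by blast
        also have "s \<otimes> \<phi> a \<oplus> x \<otimes> y = r \<otimes> y \<oplus> s \<otimes> a \<otimes> (z \<otimes> d)"
          unfolding \<phi>a' sx(3) using sx(1) d(1) by (simp add: r_distr l_distr m_assoc a_ac)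
        also have "s \<otimes> a \<otimes> (z \<otimes> d) = r \<otimes> (z \<otimes> d)"
        proof -
          have "x \<otimes> (z \<otimes> d) = \<zero>" using z(1) sx(2) d(1) by (simp add: rann_def m_assoc[symmetric])
          then show ?thesis unfolding sx(3) using sx(1) d(1) by (simp add: l_distr)
        qed
        finally show ?thesis using Ic r d(1) by (simp add: r_distr)
      qed
      then show ?thesis using d(1) by (intro bexI[of _ ?y]) auto
    qed
  qed
  from this[of n] obtain y where y: "y \<in> carrier R" "\<forall>r\<in>I. \<phi> r = r \<otimes> y"
    using C Ic by (auto simp: composition_series_def)
  \<comment> \<open>So far \<open>y\<close> has no degree; as \<open>\<phi>\<close> has degree
    \<open>g\<close>, only the component of \<open>y\<close> of degree \<open>g\<close>
    matters.\<close>
  have "x \<in> I \<and> \<phi> x = x \<otimes> cmp g y" if x: "x \<in> I" for x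
    using Ic[OF x]
  proof (induction rule: homogeneous_induct)
    case zero then show ?case using \<phi>0 y(1) glD(3)[OF I] by simp
  next
    case (homogeneous a u)
    then have u: "u \<in> H a" "u \<in> I" using glD(8)[OF I x] by (auto simp: hpart_def)
    then have "\<phi> u \<in> H (a \<otimes>\<^bsub>G\<^esub> g)" using \<phi>h by blast
    then have "\<phi> u = cmp (a \<otimes>\<^bsub>G\<^esub> g) (\<phi> u)" by simp
    also have "\<dots> = u \<otimes> cmp g y" using y u component_H_mult[OF u(1) y(1) g] by simp
    finally show ?case using u by simp
  next
    case (add u v)
    then show ?case using \<phi>a glD(4)[OF I] y(1) by (simp add: l_distr)
  qed
  then show "\<exists>y\<in>H g. \<forall>x\<in>I. \<phi> x = x \<otimes> y" using H_component[OF y(1) g] by blast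
qed

section \<open>Linked pairs of primitive idempotents\<close>

text \<open>Element form of an isomorphism of \<open>soc(Re)\<close> with the shift of
  \<open>Re'/Je'\<close> by \<open>inv s\<close>, see \<open>left_socle_iso_iff\<close>:
  \<open>x\<close> corresponds to the class of \<open>e'\<close>. The left side of the last equation
  is \<open>soc(Re)\<close>.\<close>

definition left_link :: "'a \<Rightarrow> 'a \<Rightarrow> 'g \<Rightarrow> 'a \<Rightarrow> bool" where
  "left_link e' e s x \<longleftrightarrow> x \<in> H s \<and> x \<noteq> \<zero> \<and> e' \<otimes> x = x \<and> x \<otimes> e = x \<and>
     {z \<in> rann jac. z \<otimes> e = z} = (\<lambda>r. r \<otimes> x) ` carrier R"

definition right_link :: "'a \<Rightarrow> 'a \<Rightarrow> 'g \<Rightarrow> 'a \<Rightarrow> bool" where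
  "right_link e' e s x \<longleftrightarrow> x \<in> H s \<and> x \<noteq> \<zero> \<and> e' \<otimes> x = x \<and> x \<otimes> e = x \<and>
     {z \<in> lann jac. e' \<otimes> z = z} = (\<lambda>r. x \<otimes> r) ` carrier R"

text \<open>In the opposite ring the two sides of \<open>x\<close> are exchanged, so
  \<open>e\<close> and \<open>e'\<close> change places.\<close>

lemma right_link_op:
  "graded_artinian_ring.right_link (op_group G) (op_ring R) e e' s x \<longleftrightarrow> left_link e' e s x"
  unfolding graded_artinian_ring.right_link_def[OF op] left_link_def lann_op by (auto simp: jac_op)

lemma left_link_op:
  "graded_artinian_ring.left_link (op_group G) (op_ring R) e e' s x \<longleftrightarrow> right_link e' e s x"
  unfolding graded_artinian_ring.left_link_def[OF op] right_link_def rann_op by (auto simp: jac_op)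

lemma left_linkD:
  assumes "left_link e' e s x"
  shows "x \<in> H s" "x \<noteq> \<zero>" "e' \<otimes> x = x" "x \<otimes> e = x" "x \<in> carrier R" "s \<in> carrier G"
    "z \<in> rann jac \<Longrightarrow> z \<otimes> e = z \<Longrightarrow> \<exists>r\<in>carrier R. z = r \<otimes> x"
    "r \<in> carrier R \<Longrightarrow> r \<otimes> x \<in> rann jac" "x \<in> rann jac"
proof -
  show *: "x \<in> H s" "x \<noteq> \<zero>" "e' \<otimes> x = x" "x \<otimes> e = x" using assms by (auto simp: left_link_def)
  show c: "x \<in> carrier R" "s \<in> carrier G" using H_D[OF *(1)] by auto
  have eq: "{z \<in> rann jac. z \<otimes> e = z} = (\<lambda>r. r \<otimes> x) ` carrier R"
    using assms by (simp add: left_link_def)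
  show "z \<in> rann jac \<Longrightarrow> z \<otimes> e = z \<Longrightarrow> \<exists>r\<in>carrier R. z = r \<otimes> x" using eq by blast
  show **: "r \<otimes> x \<in> rann jac" if "r \<in> carrier R" for r using eq that by blast
  show "x \<in> rann jac" using **[of \<one>] c by simp
qed

text \<open>Right multiplication by \<open>u\<close> and \<open>v\<close> identifies
  \<open>Rf\<close> with a shift of \<open>Re\<close>, see \<open>iso_imp_iso_idem\<close> and
  \<open>iso_idem_imp_iso\<close>. In this form the relation is symmetric and the same for left and
  right modules.\<close>

definition iso_idem :: "'a \<Rightarrow> 'a \<Rightarrow> bool" where
  "iso_idem f e \<longleftrightarrow> (\<exists>g. \<exists>u\<in>H g. \<exists>v\<in>H (inv\<^bsub>G\<^esub> g).
     u \<otimes> v = f \<and> v \<otimes> u = e \<and> f \<otimes> u = u \<and> u \<otimes> e = u \<and> e \<otimes> v = v \<and> v \<otimes> f = v)"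

lemma iso_idemE:
  assumes "iso_idem f e"
  obtains g u v where "u \<in> H g" "v \<in> H (inv\<^bsub>G\<^esub> g)" "u \<in> carrier R" "v \<in> carrier R" "g \<in> carrier G"
    "u \<otimes> v = f" "v \<otimes> u = e" "f \<otimes> u = u" "u \<otimes> e = u" "e \<otimes> v = v" "v \<otimes> f = v"
  using assms H_D unfolding iso_idem_def by blast

lemma iso_idem_sym:
  assumes "iso_idem f e" shows "iso_idem e f"
proof -
  obtain g u v where uv: "u \<in> H g" "v \<in> H (inv\<^bsub>G\<^esub> g)" "u \<in> carrier R" "v \<in> carrier R" "g \<in> carrier G"
    "u \<otimes> v = f" "v \<otimes> u = e" "f \<otimes> u = u" "u \<otimes> e = u" "e \<otimes> v = v" "v \<otimes> f = v"
    by (rule iso_idemE[OF assms])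
  then show ?thesis unfolding iso_idem_def
    by (intro exI[of _ "inv\<^bsub>G\<^esub> g"] bexI[of _ v] bexI[of _ u]) auto
qed

lemma iso_idem_op: "graded_artinian_ring.iso_idem (op_group G) (op_ring R) f e \<longleftrightarrow> iso_idem f e"
proof -
  have "graded_artinian_ring.iso_idem (op_group G) (op_ring R) f e \<longleftrightarrow> iso_idem e f"
    unfolding iso_idem_def graded_artinian_ring.iso_idem_def[OF op] by auto
  then show ?thesis using iso_idem_sym by blast
qed

lemma cover_eq_principal:
  assumes C: "cover {\<zero>} S" and x: "x \<in> H g" "x \<in> S" "x \<noteq> \<zero>"
  shows "S = (\<lambda>r. r \<otimes> x) ` carrier R"
  using cover_generator[OF C x(1,2)] x(3) ext_zero[of "carrier R" x] H_D[OF x(1)] by simp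

lemma cover_zero_rann:
  assumes "cover {\<zero>} S" "x \<in> S" shows "x \<in> rann jac"
  using jac_cover[OF assms(1) _ assms(2)] glD(2)[OF coverD(2)[OF assms(1)] assms(2)] by (auto simp: rann_def)

lemma minimal_subideal:
  assumes I: "gl I" "I \<noteq> {\<zero>}"
  obtains S g x where "cover {\<zero>} S" "S \<subseteq> I" "x \<in> H g" "x \<in> S" "x \<noteq> \<zero>"
proof -
  obtain S where S: "gl S" "S \<noteq> {\<zero>} \<and> S \<subseteq> I"
    and min: "\<forall>L. gl L \<and> (L \<noteq> {\<zero>} \<and> L \<subseteq> I) \<and> L \<subseteq> S \<longrightarrow> L = S"
    by (rule minimal_gl[OF I(1), of "\<lambda>L. L \<noteq> {\<zero>} \<and> L \<subseteq> I"]) (use I in auto)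
  have C: "cover {\<zero>} S"
    unfolding cover_def
  proof (intro conjI allI impI)
    show "{\<zero>} \<subset> S" using glD(3)[OF S(1)] S(2) by auto
    fix Z assume "gl Z \<and> {\<zero>} \<subseteq> Z \<and> Z \<subseteq> S"
    then show "Z = {\<zero>} \<or> Z = S" using min[rule_format, of Z] S(2) by auto
  qed (rule gl_zero S)+
  have "\<not> S \<subseteq> {\<zero>}" using S(2) glD(3)[OF S(1)] by auto
  then obtain g x where "x \<in> H g" "x \<in> S" "x \<notin> {\<zero>}" using gl_homogeneous_diff[OF S(1) gl_zero] by blast
  then show thesis using that[OF C, of x g] S(2) by simp
qed

lemma left_link_cover:
  assumes "left_link e' e s x" "prim e'"
  shows "cover {\<zero>} ((\<lambda>r. r \<otimes> x) ` carrier R)"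
  using cover_principal[OF assms(2) left_linkD(1,3,2)[OF assms(1)]] left_linkD(9)[OF assms(1)]
  by (simp add: rann_def)

text \<open>The socle is given for \<open>e\<close>, so elements are carried from \<open>f\<close>
  to \<open>e\<close> by \<open>u\<close> and back by \<open>v\<close>. For the first claim,
  \<open>Ry\<close> contains a minimal left ideal; it is fixed by \<open>e\<close> on the right, so
  it lies in the simple \<open>soc(Re) = Rx\<close> and equals it. Thus \<open>x\<close> is in
  \<open>Ry\<close>, and \<open>yJ = 0\<close> gives \<open>xJ = 0\<close>. The second claim is the
  simplicity of \<open>Rx\<close>.\<close>

lemma linked_socle:
  assumes link: "\<And>f. prim f \<Longrightarrow> \<exists>e e' s s' x y. iso_idem f e \<and> prim e \<and> prim e' \<and>
      left_link e' e s x \<and> right_link e' e s' y"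
  shows "rann jac \<subseteq> lann jac"
    and "\<And>f z w s. prim f \<Longrightarrow> z \<in> H s \<Longrightarrow> z \<noteq> \<zero> \<Longrightarrow> z \<otimes> f = z \<Longrightarrow> z \<in> rann jac \<Longrightarrow> w \<otimes> f = w \<Longrightarrow>
      w \<in> rann jac \<Longrightarrow> \<exists>c\<in>carrier R. w = c \<otimes> z"
proof -
  interpret O: graded_artinian_ring "op_group G" "op_ring R" by (rule op)
  have rannR: "z \<otimes> r \<in> rann jac" if "z \<in> rann jac" "r \<in> carrier R" for z r
    using that glD(2)[OF gl_jac] by (auto simp: rann_def m_assoc[symmetric])
  have prim_case: "z \<in> lann jac" if f: "prim f" "z \<in> rann jac" "z \<otimes> f = z" for f z
  proof -
    obtain e e' s s' x y where *: "iso_idem f e" "prim e" "prim e'" and x: "left_link e' e s x"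
      and y: "right_link e' e s' y" using link[OF f(1)] by blast
    obtain g u v where uv: "u \<in> H g" "v \<in> H (inv\<^bsub>G\<^esub> g)" "u \<in> carrier R" "v \<in> carrier R" "g \<in> carrier G"
    "u \<otimes> v = f" "v \<otimes> u = e" "f \<otimes> u = u" "u \<otimes> e = u" "e \<otimes> v = v" "v \<otimes> f = v"
      by (rule iso_idemE[OF *(1)])
    have yO: "O.left_link e e' s' y" using y by (simp add: left_link_op)
    have yc [simp]: "y \<in> carrier R" and yH: "y \<in> H s'" and yl: "y \<in> lann jac"
      using O.left_linkD(5,1,9)[OF yO] by (simp_all add: jac_op rann_op)
    have ye: "y \<otimes> e = y" "y \<noteq> \<zero>" using O.left_linkD(3,2)[OF yO] by simp_all
    have zc [simp]: "z \<in> carrier R" using f(2) by (simp add: rann_def)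
    have ec: "e \<in> carrier R" using primD[OF *(2)] by simp
    let ?I = "(\<lambda>r. r \<otimes> y) ` carrier R"
    have "gl ?I" by (rule gl_image[OF gl_carrier yH])
    moreover have "\<one> \<otimes> y \<in> ?I" by (rule imageI) simp
    then have "?I \<noteq> {\<zero>}" using ye(2) by auto
    ultimately obtain S h q where S: "cover {\<zero>} S" "S \<subseteq> ?I" "q \<in> H h" "q \<in> S" "q \<noteq> \<zero>"
      by (rule minimal_subideal)
    have xl: "x \<in> lann jac"
    proof -
      let ?X = "(\<lambda>r. r \<otimes> x) ` carrier R"
      have cX: "cover {\<zero>} ?X" by (rule left_link_cover[OF x *(3)])
      have "S \<subseteq> ?X"
      proof
        fix p assume p: "p \<in> S"
        have "p \<otimes> e = p" using p S(2) ye(1) ec by (auto simp: m_assoc)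
        then show "p \<in> ?X" using left_linkD(7)[OF x cover_zero_rann[OF S(1) p]] by blast
      qed
      then have "S = ?X" using coverD(5)[OF cX coverD(2,3)[OF S(1)]] coverD(4)[OF S(1)] by blast
      moreover have "\<one> \<otimes> x \<in> ?X" by (rule imageI) simp
      ultimately have "x \<in> ?I" using S(2) left_linkD(5)[OF x] by auto
      then show ?thesis using yl glD(2)[OF gl_jac] by (auto simp: lann_def m_assoc)
    qed
    have "(z \<otimes> u) \<otimes> e = z \<otimes> u" using uv ec by (simp add: m_assoc)
    then obtain r where r: "r \<in> carrier R" "z \<otimes> u = r \<otimes> x"
      using left_linkD(7)[OF x rannR[OF f(2) uv(3)]] by blast
    have "z \<otimes> a = \<zero>" if a: "a \<in> jac" for a
    proof -
      have ac: "a \<in> carrier R" "v \<otimes> a \<in> carrier R" "v \<otimes> a \<in> jac"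
        using a uv glD(2,7)[OF gl_jac] by auto
      have "z \<otimes> a = (z \<otimes> u) \<otimes> (v \<otimes> a)" using f(3) uv ac(1) by (simp add: m_assoc[symmetric]) (simp add: m_assoc)
      also have "\<dots> = r \<otimes> (x \<otimes> (v \<otimes> a))" using r left_linkD(5)[OF x] ac by (simp add: m_assoc)
      also have "x \<otimes> (v \<otimes> a) = \<zero>" using xl ac by (simp add: lann_def)
      finally show ?thesis using r by simp
    qed
    then show ?thesis by (simp add: lann_def)
  qed
  show "rann jac \<subseteq> lann jac"
  proof
    fix z assume z: "z \<in> rann jac"
    then have zc: "z \<in> carrier R" by (simp add: rann_def)
    have lg: "O.gl (lann jac)" using O.gl_rann_jac by (simp add: rann_op jac_op)
    show "z \<in> lann jac"
    proof (rule ccontr)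
      assume "z \<notin> lann jac"
      then obtain f where "primitive_idempotent_in_unit_part (op_group G) (op_ring R) f" "f \<otimes>\<^bsub>op_ring R\<^esub> z \<notin> lann jac"
        using O.ex_prim_not_mem[OF lg, of z] zc by auto
      then have f: "prim f" "z \<otimes> f \<notin> lann jac" by (simp_all add: prim_op)
      have "z \<otimes> f \<otimes> f = z \<otimes> f" using primD[OF f(1)] zc by (simp add: m_assoc)
      then show False using prim_case[OF f(1) rannR[OF z]] primD[OF f(1)] f(2) by blast
    qed
  qed
  fix f z w s
  assume f: "prim f" and z: "z \<in> H s" "z \<noteq> \<zero>" "z \<otimes> f = z" "z \<in> rann jac" and w: "w \<otimes> f = w" "w \<in> rann jac"
  obtain e e' s s' x y where *: "iso_idem f e" "prim e" "prim e'" and x: "left_link e' e s x"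
    using link[OF f(1)] by blast
  obtain g u v where uv: "u \<in> H g" "v \<in> H (inv\<^bsub>G\<^esub> g)" "u \<in> carrier R" "v \<in> carrier R" "g \<in> carrier G"
    "u \<otimes> v = f" "v \<otimes> u = e" "f \<otimes> u = u" "u \<otimes> e = u" "e \<otimes> v = v" "v \<otimes> f = v"
    by (rule iso_idemE[OF *(1)])
  have c [simp]: "z \<in> carrier R" "w \<in> carrier R" "u \<in> carrier R" "v \<in> carrier R" "e \<in> carrier R"
    using z w uv primD[OF *(2)] by (auto simp: rann_def)
  let ?X = "(\<lambda>r. r \<otimes> x) ` carrier R"
  have cX: "cover {\<zero>} ?X" by (rule left_link_cover[OF x *(3)])
  have inX: "p \<otimes> u \<in> ?X" if "p \<in> rann jac" for p
  proof -
    have "p \<in> carrier R" using that by (simp add: rann_def)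
    then have "(p \<otimes> u) \<otimes> e = p \<otimes> u" using uv by (simp add: m_assoc)
    then show ?thesis using left_linkD(7)[OF x rannR[OF that uv(3)]] by blast
  qed
  have uvK: "p \<otimes> u \<otimes> v = p" if "p \<in> carrier R" "p \<otimes> f = p" for p
    using that uv by (simp add: m_assoc)
  have "z \<otimes> u \<noteq> \<zero>" using uvK[of z] z by auto
  then have "?X = (\<lambda>r. r \<otimes> (z \<otimes> u)) ` carrier R"
    using cover_eq_principal[OF cX H_mult[OF z(1) uv(1)] inX[OF z(4)]] by simp
  then obtain c where c': "c \<in> carrier R" "w \<otimes> u = c \<otimes> (z \<otimes> u)" using inX[OF w(2)] by auto
  have "w = c \<otimes> (z \<otimes> u) \<otimes> v" using uvK[of w] w c'(2) by simp
  also have "\<dots> = c \<otimes> z" using c'(1) uvK[of z] z(3) by (simp add: m_assoc)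
  finally show "\<exists>c\<in>carrier R. w = c \<otimes> z" using c'(1) by blast
qed

text \<open>The second hypothesis is the first one for the opposite ring. There,
  \<open>linked_socle\<close> shows that \<open>f (lann jac)\<close> is simple or zero, while the
  length argument wants this for \<open>f (rann jac)\<close>; the equality of the two annihilators,
  one inclusion from each side, reconciles them.\<close>

lemma links_imp_baer:
  assumes ll: "\<And>f. prim f \<Longrightarrow> \<exists>e e' s s' x y. iso_idem f e \<and> prim e \<and> prim e' \<and>
      left_link e' e s x \<and> right_link e' e s' y"
    and rl: "\<And>f. prim f \<Longrightarrow> \<exists>e e' s s' x y. iso_idem f e' \<and> prim e \<and> prim e' \<and>
      left_link e' e s x \<and> right_link e' e s' y"
  shows baer
proof -
  interpret O: graded_artinian_ring "op_group G" "op_ring R" by (rule op)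
  have ol: "\<exists>e e' s s' x y. O.iso_idem f e \<and> O.prim e \<and> O.prim e' \<and> O.left_link e' e s x \<and> O.right_link e' e s' y"
    if "O.prim f" for f
  proof -
    have "prim f" using that by (simp add: prim_op)
    then obtain e e' s s' x y where "iso_idem f e'" "prim e" "prim e'" "left_link e' e s x" "right_link e' e s' y"
      using rl by blast
    then have "O.iso_idem f e' \<and> O.prim e' \<and> O.prim e \<and> O.left_link e e' s' y \<and> O.right_link e e' s x"
      by (simp add: prim_op iso_idem_op left_link_op right_link_op)
    then show ?thesis by blast
  qed
  note A = linked_socle[OF ll] and B = O.linked_socle[OF ol, unfolded rann_op lann_op jac_op, simplified]
  have eq: "rann jac = lann jac" using A(1) B(1) by simp
  show ?thesis
  proof (rule baerI)
    show right_socle_simple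
      unfolding right_socle_simple_def eq
    proof (intro allI impI)
      fix f z w s assume "prim f" "z \<in> H s" "z \<noteq> \<zero>" "f \<otimes> z = z" "z \<in> lann jac" "f \<otimes> w = w" "w \<in> lann jac"
      then show "\<exists>c\<in>carrier R. w = z \<otimes> c" using B(2)[of f z s w] by (simp add: prim_op)
    qed
    show O.right_socle_simple
      unfolding O.right_socle_simple_def jac_op rann_op eq[symmetric]
    proof (intro allI impI)
      fix f z w s assume "O.prim f" "z \<in> O.H s" "z \<noteq> \<zero>\<^bsub>op_ring R\<^esub>" "f \<otimes>\<^bsub>op_ring R\<^esub> z = z" "z \<in> rann jac"
        "f \<otimes>\<^bsub>op_ring R\<^esub> w = w" "w \<in> rann jac"
      then show "\<exists>c\<in>carrier (op_ring R). w = z \<otimes>\<^bsub>op_ring R\<^esub> c"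
        using A(2)[of f z s w] by (simp add: prim_op)
    qed
  qed
qed

section \<open>Consequences of Baer's criterion for socles\<close>

lemma prim_annihilator:
  assumes e: "prim e" and x: "x \<in> H s" "x \<noteq> \<zero>" "e \<otimes> x = x"
    and a: "a \<in> carrier R" "a \<otimes> x = \<zero>"
  shows "a \<otimes> e \<in> jac"
proof (rule gl_mem_if_components[OF gl_jac])
  have c [simp]: "x \<in> carrier R" "e \<in> carrier R" "s \<in> carrier G"
    using H_D[OF x(1)] primD[OF e] by auto
  show "a \<otimes> e \<in> carrier R" using a by simp
  fix h assume h: "h \<in> carrier G"
  define b where "b = cmp h a"
  have b: "b \<in> H h" unfolding b_def by (rule H_component[OF a(1) h])
  have bc [simp]: "b \<in> carrier R" using H_D[OF b] by simp
  have "b \<otimes> x = cmp (h \<otimes>\<^bsub>G\<^esub> s) (a \<otimes> x)" unfolding b_def by (rule component_mult_H[OF x(1) a(1) h, symmetric])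
  then have bx: "b \<otimes> x = \<zero>" using a(2) by (simp add: component_zero)
  \<comment> \<open>Otherwise \<open>be\<close> has a left inverse \<open>w\<close> up to
    \<open>e\<close>, and \<open>x = wbex = wbx = 0\<close>.\<close>
  have "b \<otimes> e \<in> jac"
  proof (rule ccontr)
    assume n: "b \<otimes> e \<notin> jac"
    have "b \<otimes> e \<in> H h" using H_mult[OF b primD(1)[OF e]] h by simp
    moreover have "b \<otimes> e \<otimes> e = b \<otimes> e" using primD[OF e] by (simp add: m_assoc)
    ultimately obtain w where w: "w \<in> H (inv\<^bsub>G\<^esub> h)" "w \<otimes> (b \<otimes> e) = e" using prim_left_inverse[OF e _ _ n] by blast
    have wc: "w \<in> carrier R" using H_D[OF w(1)] by simp
    have "x = w \<otimes> (b \<otimes> e) \<otimes> x" using w(2) x(3) by simp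
    also have "\<dots> = \<zero>" using wc bx x(3) by (simp add: m_assoc)
    finally show False using x(2) by contradiction
  qed
  then show "cmp h (a \<otimes> e) \<in> jac"
    using component_mult_H[OF primD(1)[OF e] a(1) h] h by (simp add: b_def)
qed

lemma prim_annihilator_transfer:
  assumes "prim e" "x \<in> H s" "x \<noteq> \<zero>" "e \<otimes> x = x" "e \<otimes> x' = x'" "x' \<in> rann jac"
    and "a \<in> carrier R" "a \<otimes> x = \<zero>"
  shows "a \<otimes> x' = \<zero>"
proof -
  have "a \<otimes> e \<otimes> x' = \<zero>" using prim_annihilator[OF assms(1-4,7,8)] assms(6) by (simp add: rann_def)
  then show ?thesis using assms primD[OF assms(1)] by (simp add: m_assoc rann_def)
qed

text \<open>The map \<open>rx |-> rx'\<close> is well defined because the annihilator of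
  \<open>x\<close> in \<open>Re\<close> lies in \<open>Je\<close>, which kills \<open>x'\<close>. It
  is homogeneous, and Baer's criterion makes it a right multiplication.\<close>

lemma baer_transfer:
  assumes B: baer and e: "prim e" and x: "x \<in> H s" "x \<noteq> \<zero>" "e \<otimes> x = x"
    and x': "x' \<in> H s'" "e \<otimes> x' = x'" "x' \<in> rann jac"
  obtains y where "y \<in> H (inv\<^bsub>G\<^esub> s \<otimes>\<^bsub>G\<^esub> s')" "x \<otimes> y = x'"
proof -
  have c [simp]: "x \<in> carrier R" "x' \<in> carrier R" "e \<in> carrier R" "s' \<in> carrier G" "s \<in> carrier G"
    using H_D[OF x(1)] H_D[OF x'(1)] primD[OF e] by auto
  let ?I = "(\<lambda>r. r \<otimes> x) ` carrier R"
  define \<phi> where "\<phi> z = (SOME a. a \<in> carrier R \<and> z = a \<otimes> x) \<otimes> x'" for z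
  have \<phi>: "\<phi> (a \<otimes> x) = a \<otimes> x'" if a: "a \<in> carrier R" for a
  proof -
    define b where "b = (SOME b. b \<in> carrier R \<and> a \<otimes> x = b \<otimes> x)"
    have b: "b \<in> carrier R \<and> a \<otimes> x = b \<otimes> x" unfolding b_def by (rule someI[of _ a]) (simp add: a)
    then have "(a \<ominus> b) \<otimes> x = \<zero>" using a by (simp add: a_minus_def l_distr l_minus r_neg)
    then have "(a \<ominus> b) \<otimes> x' = \<zero>" using prim_annihilator_transfer[OF e x x'(2,3), of "a \<ominus> b"] a b by simp
    then have "a \<otimes> x' \<ominus> b \<otimes> x' = \<zero>" using a b by (simp add: a_minus_def l_distr l_minus)
    then have "a \<otimes> x' = b \<otimes> x'" using a b by (simp add: r_right_minus_eq)
    then show ?thesis by (simp add: \<phi>_def b_def)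
  qed
  have I: "gl ?I" by (rule gl_image[OF gl_carrier x(1)])
  obtain y where y: "y \<in> H (inv\<^bsub>G\<^esub> s \<otimes>\<^bsub>G\<^esub> s')" "\<And>z. z \<in> ?I \<Longrightarrow> \<phi> z = z \<otimes> y"
  proof (rule baerD[OF B I, of "inv\<^bsub>G\<^esub> s \<otimes>\<^bsub>G\<^esub> s'" \<phi>])
    show "\<phi> z \<in> carrier R" if "z \<in> ?I" for z using that \<phi> by auto
    show "\<phi> (z \<oplus> w) = \<phi> z \<oplus> \<phi> w" if "z \<in> ?I" "w \<in> ?I" for z w
    proof -
      obtain a b where "a \<in> carrier R" "b \<in> carrier R" "z = a \<otimes> x" "w = b \<otimes> x" using \<open>z \<in> ?I\<close> \<open>w \<in> ?I\<close> by auto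
      then show ?thesis using \<phi>[of "a \<oplus> b"] by (simp add: l_distr \<phi>)
    qed
    show "\<phi> (r \<otimes> z) = r \<otimes> \<phi> z" if r: "r \<in> carrier R" and z: "z \<in> ?I" for r z
    proof -
      obtain a where "a \<in> carrier R" "z = a \<otimes> x" using z by blast
      then show ?thesis using \<phi>[of "r \<otimes> a"] r by (simp add: m_assoc \<phi>)
    qed
    show "\<phi> z \<in> H (k \<otimes>\<^bsub>G\<^esub> (inv\<^bsub>G\<^esub> s \<otimes>\<^bsub>G\<^esub> s'))" if "z \<in> ?I" "z \<in> H k" for k z
    proof -
      obtain a where a: "a \<in> carrier R" "z = a \<otimes> x" using \<open>z \<in> ?I\<close> by auto
      have k: "k \<in> carrier G" using H_D[OF that(2)] by simp
      let ?b = "cmp (k \<otimes>\<^bsub>G\<^esub> inv\<^bsub>G\<^esub> s) a"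
      have b: "?b \<in> H (k \<otimes>\<^bsub>G\<^esub> inv\<^bsub>G\<^esub> s)" using k by (intro H_component[OF a(1)]) simp
      have "z = cmp k z" using that by simp
      also have "\<dots> = ?b \<otimes> x" using component_mult_H'[OF x(1) a(1) k] a(2) by simp
      finally have "\<phi> z = ?b \<otimes> x'" using \<phi>[of ?b] H_D[OF b] by simp
      then show ?thesis using H_mult[OF b x'(1)] k by (simp add: G.m_assoc)
    qed
  qed simp_all
  have "\<one> \<otimes> x \<in> ?I" by (rule imageI) simp
  then have "x \<in> ?I" by simp
  then have "x \<otimes> y = \<phi> (\<one> \<otimes> x)" using y(2)[of x] by simp
  then show thesis using y(1) that \<phi>[of \<one>] by simp
qed

text \<open>As \<open>xz = x\<close> with \<open>x\<close> nonzero, \<open>z\<close> is not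
  nilpotent, and the corner of \<open>f\<close> is local. Reading the corner in the opposite ring
  makes the inverse a right one.\<close>

lemma prim_unit:
  assumes f: "prim f" and z: "z \<in> H \<one>\<^bsub>G\<^esub>" "f \<otimes> z = z" "z \<otimes> f = z"
    and x: "x \<in> carrier R" "x \<noteq> \<zero>" "x \<otimes> z = x"
  obtains w where "w \<in> H \<one>\<^bsub>G\<^esub>" "z \<otimes> w = f" "f \<otimes> w = w" "w \<otimes> f = w"
proof -
  interpret O: graded_artinian_ring "op_group G" "op_ring R" by (rule op)
  have zc: "z \<in> carrier R" using H_D[OF z(1)] by simp
  have "x \<otimes> z [^] n = x" for n :: nat
  proof (induction n)
    case (Suc n)
    have "x \<otimes> z [^] Suc n = (x \<otimes> z [^] n) \<otimes> z" using x(1) zc by (simp add: m_assoc)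
    then show ?case using Suc x(3) by simp
  qed (use x in simp)
  moreover have "x \<otimes> \<zero> \<noteq> x" using x by simp
  ultimately have "\<not> nilp z" unfolding nilp_def by metis
  then have "\<not> O.nilp z" using nilp_op[OF zc] by simp
  then have "\<exists>w\<in>H \<one>\<^bsub>G\<^esub>. z \<otimes> w = f \<and> w \<otimes> f = w \<and> f \<otimes> w = w"
    using O.prim_local[of f z] f z by (simp add: prim_op)
  then show thesis using that by blast
qed

text \<open>If \<open>S\<close> and \<open>T\<close> differ, the projection of their direct sum to
  \<open>S\<close> is right multiplication by some \<open>y\<close>. The corner element
  \<open>fyf\<close> fixes \<open>S\<close>, hence is invertible by \<open>prim_unit\<close>, yet it
  annihilates \<open>T\<close>.\<close>

lemma baer_unique_minimal:
  assumes B: baer and f: "prim f"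
    and S: "cover {\<zero>} S" "\<And>x. x \<in> S \<Longrightarrow> x \<otimes> f = x"
    and T: "cover {\<zero>} T" "\<And>x. x \<in> T \<Longrightarrow> x \<otimes> f = x"
  shows "S = T"
proof (rule ccontr)
  assume ne: "S \<noteq> T"
  note gS = coverD(2)[OF S(1)] and gT = coverD(2)[OF T(1)]
  have int: "S \<inter> T = {\<zero>}"
  proof -
    have g: "gl (S \<inter> T)" by (rule gl_Int[OF gS gT])
    then have z: "{\<zero>} \<subseteq> S \<inter> T" using glD(3) by blast
    from coverD(5)[OF S(1) g z] coverD(5)[OF T(1) g z] ne show ?thesis by blast
  qed
  have Sne: "\<not> S \<subseteq> {\<zero>}" "\<not> T \<subseteq> {\<zero>}" using coverD(3,4)[OF S(1)] coverD(3,4)[OF T(1)] by auto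
  obtain g x where x: "x \<in> H g" "x \<in> S" "x \<notin> {\<zero>}" using gl_homogeneous_diff[OF gS gl_zero Sne(1)] by blast
  have xc: "x \<in> carrier R" using H_D[OF x(1)] by simp
  have SX: "S = (\<lambda>r. r \<otimes> x) ` carrier R" using cover_eq_principal[OF S(1) x(1,2)] x(3) by simp
  let ?I = "ext (carrier R) x T"
  have I: "gl ?I" by (rule gl_ext[OF gl_carrier x(1) gT])
  note Sc = glD(2)[OF gS] and Tc = glD(2)[OF gT]
  have I_eq: "?I = {p \<oplus> q | p q. p \<in> S \<and> q \<in> T}" unfolding ext_def SX by auto
  \<comment> \<open>The component in \<open>S\<close> of an element of the direct sum; it is unique
    because \<open>S\<close> and \<open>T\<close> meet in zero.\<close>
  define \<phi> where "\<phi> z = (THE p. p \<in> S \<and> z \<ominus> p \<in> T)" for z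
  have \<phi>: "\<phi> (p \<oplus> q) = p" if pq: "p \<in> S" "q \<in> T" for p q
    unfolding \<phi>_def
  proof (rule the_equality)
    have [simp]: "p \<in> carrier R" "q \<in> carrier R" using Sc Tc pq by auto
    have "p \<oplus> q \<ominus> p = q \<oplus> (p \<ominus> p)" by (simp add: a_minus_def a_ac)
    then show "p \<in> S \<and> p \<oplus> q \<ominus> p \<in> T" using pq by (simp add: a_minus_def r_neg)
    fix r assume r: "r \<in> S \<and> p \<oplus> q \<ominus> r \<in> T"
    have [simp]: "r \<in> carrier R" using Sc r by auto
    have "(p \<oplus> q \<ominus> r) \<ominus> q = (p \<ominus> r) \<oplus> (q \<ominus> q)" by (simp add: a_minus_def a_ac)
    then have "p \<ominus> r = (p \<oplus> q \<ominus> r) \<ominus> q" by (simp add: a_minus_def r_neg)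
    also have "\<dots> \<in> T" by (rule glD(6)[OF gT]) (use r pq in auto)
    finally have "p \<ominus> r \<in> S \<inter> T" using pq r glD(6)[OF gS] by auto
    then have "p \<ominus> r = \<zero>" using int by auto
    then show "r = p" by (simp add: r_right_minus_eq)
  qed
  obtain y where y: "y \<in> H \<one>\<^bsub>G\<^esub>" "\<And>z. z \<in> ?I \<Longrightarrow> \<phi> z = z \<otimes> y"
  proof (rule baerD[OF B I, of "\<one>\<^bsub>G\<^esub>" \<phi>])
    show "\<phi> z \<in> carrier R" if "z \<in> ?I" for z using that \<phi> Sc unfolding I_eq by auto
    show "\<phi> (z \<oplus> w) = \<phi> z \<oplus> \<phi> w" if "z \<in> ?I" "w \<in> ?I" for z w
    proof -
      obtain p q p' q' where pq: "p \<in> S" "q \<in> T" "p' \<in> S" "q' \<in> T" "z = p \<oplus> q" "w = p' \<oplus> q'"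
        using \<open>z \<in> ?I\<close> \<open>w \<in> ?I\<close> unfolding I_eq by auto
      then have "z \<oplus> w = (p \<oplus> p') \<oplus> (q \<oplus> q')" using Sc Tc by (simp add: a_ac)
      then show ?thesis using pq \<phi>[of "p \<oplus> p'" "q \<oplus> q'"] glD(4)[OF gS] glD(4)[OF gT] by (simp add: \<phi>)
    qed
    show "\<phi> (r \<otimes> z) = r \<otimes> \<phi> z" if r: "r \<in> carrier R" and z: "z \<in> ?I" for r z
    proof -
      obtain p q where pq: "p \<in> S" "q \<in> T" "z = p \<oplus> q" using z unfolding I_eq by auto
      then have "r \<otimes> z = r \<otimes> p \<oplus> r \<otimes> q" using Sc Tc r by (simp add: r_distr)
      then show ?thesis using pq \<phi>[of "r \<otimes> p" "r \<otimes> q"] glD(7)[OF gS r] glD(7)[OF gT r] by (simp add: \<phi>)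
    qed
    show "\<phi> z \<in> H (k \<otimes>\<^bsub>G\<^esub> \<one>\<^bsub>G\<^esub>)" if "z \<in> ?I" "z \<in> H k" for k z
    proof -
      obtain p q where pq: "p \<in> S" "q \<in> T" "z = p \<oplus> q" using \<open>z \<in> ?I\<close> unfolding I_eq by auto
      have k: "k \<in> carrier G" using H_D[OF that(2)] by simp
      have "z = cmp k z" using that by simp
      also have "\<dots> = cmp k p \<oplus> cmp k q" using pq Sc Tc by (simp add: component_add)
      finally have "\<phi> z = cmp k p"
        using \<phi>[of "cmp k p" "cmp k q"] glD(8)[OF gS pq(1) k] glD(8)[OF gT pq(2) k] by simp
      then show ?thesis using H_component[OF Sc[OF pq(1)] k] k by simp
    qed
  qed simp_all
  have yc [simp]: "y \<in> carrier R" using H_D[OF y(1)] by simp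
  have fc [simp]: "f \<in> carrier R" using primD[OF f] by simp
  have sy: "p \<otimes> y = p" if "p \<in> S" for p
  proof -
    have "p \<oplus> \<zero> \<in> ?I" unfolding I_eq using that glD(3)[OF gT] by blast
    then show ?thesis using y(2)[of "p \<oplus> \<zero>"] \<phi>[OF that glD(3)[OF gT]] Sc[OF that] by simp
  qed
  have ty: "q \<otimes> y = \<zero>" if "q \<in> T" for q
  proof -
    have "\<zero> \<oplus> q \<in> ?I" unfolding I_eq using that glD(3)[OF gS] by blast
    then show ?thesis using y(2)[of "\<zero> \<oplus> q"] \<phi>[OF glD(3)[OF gS] that] Tc[OF that] by simp
  qed
  let ?z = "f \<otimes> y \<otimes> f"
  have z: "?z \<in> H \<one>\<^bsub>G\<^esub>" using H_mult[OF H_mult[OF primD(1)[OF f] y(1)] primD(1)[OF f]] by simp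
  have fz: "f \<otimes> ?z = ?z" "?z \<otimes> f = ?z" using primD[OF f] by (simp_all add: m_assoc[symmetric]) (simp add: m_assoc)
  have xz: "x \<otimes> ?z = x" using xc S(2)[OF x(2)] sy[OF x(2)] by (simp add: m_assoc[symmetric])
  have "x \<noteq> \<zero>" using x(3) by simp
  then obtain w where w: "w \<in> H \<one>\<^bsub>G\<^esub>" "?z \<otimes> w = f"
    using prim_unit[OF f z fz xc _ xz] by blast
  have wc: "w \<in> carrier R" using H_D[OF w(1)] by simp
  have "q = \<zero>" if q: "q \<in> T" for q
  proof -
    have "q = q \<otimes> (?z \<otimes> w)" using T(2)[OF q] w(2) by simp
    also have "\<dots> = (q \<otimes> f) \<otimes> y \<otimes> f \<otimes> w" using Tc[OF q] wc by (simp add: m_assoc)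
    also have "\<dots> = \<zero>" using T(2)[OF q] ty[OF q] wc by simp
    finally show ?thesis .
  qed
  then show False using Sne(2) by blast
qed

text \<open>The socle of \<open>Rf\<close> is spanned by elements that generate minimal left ideals,
  and all of these coincide by \<open>baer_unique_minimal\<close>.\<close>

lemma baer_socle:
  assumes B: baer and f: "prim f"
  shows "cover {\<zero>} {z \<in> rann jac. z \<otimes> f = z}"
proof -
  let ?L = "{z \<in> rann jac. z \<otimes> f = z}"
  have fc [simp]: "f \<in> carrier R" using primD[OF f] by simp
  have L: "gl ?L"
  proof (rule glI)
    show "cmp g z \<in> ?L" if "z \<in> ?L" "g \<in> carrier G" for z g
    proof -
      have "z \<in> carrier R" "z \<otimes> f = z" using that by (auto simp: rann_def)
      then have "cmp g z \<otimes> f = cmp g z"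
        using component_mult_H'[OF primD(1)[OF f], of z g] that by simp
      then show ?thesis using component_rann[OF gl_jac, of z g] that by simp
    qed
    show "r \<otimes> z \<in> ?L" if "r \<in> carrier R" "z \<in> ?L" for r z
      using that glD(7)[OF gl_rann_jac, of r z] by (auto simp: rann_def m_assoc)
  qed (use glD(4)[OF gl_rann_jac] in \<open>auto simp: l_distr rann_def glD(2)[OF gl_jac]\<close>)
  let ?F = "(\<lambda>r. r \<otimes> f) ` carrier R"
  have "gl ?F" by (rule gl_image[OF gl_carrier primD(1)[OF f]])
  moreover have "\<one> \<otimes> f \<in> ?F" by (rule imageI) simp
  then have "?F \<noteq> {\<zero>}" using primD(3)[OF f] by auto
  ultimately obtain S g x where S: "cover {\<zero>} S" "S \<subseteq> ?F" "x \<in> H g" "x \<in> S" "x \<noteq> \<zero>"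
    by (rule minimal_subideal)
  have Sf: "z \<otimes> f = z" if "z \<in> S" for z
    using that S(2) primD(4)[OF f] by (auto simp: m_assoc)
  have "S \<subseteq> ?L" using Sf cover_zero_rann[OF S(1)] by blast
  moreover have "?L \<subseteq> S"
  proof (rule ccontr)
    assume "\<not> ?L \<subseteq> S"
    then obtain h k z where z: "prim h" "z \<in> H k" "z \<in> ?L" "z \<notin> S" "h \<otimes> z = z"
      using ex_homogeneous_prim_not_mem[OF coverD(2)[OF S(1)] L] by blast
    have zc: "z \<in> carrier R" using H_D[OF z(2)] by simp
    have z0: "z \<noteq> \<zero>" using z(4) glD(3)[OF coverD(2)[OF S(1)]] by auto
    let ?Z = "(\<lambda>r. r \<otimes> z) ` carrier R"
    have "cover {\<zero>} ?Z" using z by (intro cover_principal[OF z(1,2,5) z0]) (simp add: rann_def)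
    moreover have "p \<otimes> f = p" if "p \<in> ?Z" for p using that z(3) zc by (auto simp: m_assoc)
    ultimately have "?Z = S" using baer_unique_minimal[OF B f _ _ S(1) Sf] by blast
    moreover have "\<one> \<otimes> z \<in> ?Z" by (rule imageI) simp
    ultimately show False using z(4) zc by simp
  qed
  ultimately show ?thesis using S(1) by simp
qed

text \<open>Some homogeneous generator \<open>z\<close> of the socle is fixed from the left by a
  primitive \<open>h\<close>; multiplying by \<open>v\<close> replaces \<open>h\<close> by its
  representative \<open>e i\<close>.\<close>

lemma baer_left_link:
  assumes B: baer and f: "prim f" and rep: "\<And>h. prim h \<Longrightarrow> \<exists>i\<in>A. iso_idem h (e i)"
  shows "\<exists>i\<in>A. \<exists>s x. left_link (e i) f s x"
proof -
  let ?L = "{z \<in> rann jac. z \<otimes> f = z}"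
  have C: "cover {\<zero>} ?L" by (rule baer_socle[OF B f])
  then have "\<not> ?L \<subseteq> {\<zero>}" using coverD(3,4)[OF C] by blast
  then obtain h k z where z: "prim h" "z \<in> H k" "z \<in> ?L" "z \<notin> {\<zero>}" "h \<otimes> z = z"
    using ex_homogeneous_prim_not_mem[OF gl_zero coverD(2)[OF C]] by blast
  obtain i where i: "i \<in> A" "iso_idem h (e i)" using rep[OF z(1)] by blast
  obtain g u v where uv: "u \<in> H g" "v \<in> H (inv\<^bsub>G\<^esub> g)" "u \<in> carrier R" "v \<in> carrier R" "g \<in> carrier G"
    "u \<otimes> v = h" "v \<otimes> u = e i" "h \<otimes> u = u" "u \<otimes> e i = u" "e i \<otimes> v = v" "v \<otimes> h = v"
    by (rule iso_idemE[OF i(2)])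
  have zc [simp]: "z \<in> carrier R" using H_D[OF z(2)] by simp
  have eic: "e i \<in> carrier R" using m_closed[OF uv(4,3)] uv(7) by simp
  let ?x = "v \<otimes> z"
  have x: "?x \<in> H (inv\<^bsub>G\<^esub> g \<otimes>\<^bsub>G\<^esub> k)" by (rule H_mult[OF uv(2) z(2)])
  have xL: "?x \<in> ?L" by (rule glD(7)[OF coverD(2)[OF C] uv(4) z(3)])
  have "u \<otimes> ?x = z" using uv z(5) by (simp add: m_assoc[symmetric])
  then have x0: "?x \<noteq> \<zero>" using z(4) uv(3) by auto
  moreover have "e i \<otimes> ?x = ?x" using uv eic by (simp add: m_assoc[symmetric])
  moreover have "?L = (\<lambda>r. r \<otimes> ?x) ` carrier R" by (rule cover_eq_principal[OF C x xL x0])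
  ultimately have "left_link (e i) f (inv\<^bsub>G\<^esub> g \<otimes>\<^bsub>G\<^esub> k) ?x" unfolding left_link_def using x xL by auto
  then show ?thesis using i by blast
qed

text \<open>\<open>baer_transfer\<close> in both directions carries \<open>x\<close> to
  \<open>x'\<close> and back. Cut down to the idempotents this gives \<open>u\<close> and
  \<open>v\<close> with \<open>xuv = x\<close>, so \<open>uv\<close> is a unit of the corner of
  \<open>f\<close>. Adjusting \<open>v\<close> by its inverse makes \<open>uv = f\<close>, and then
  \<open>vu\<close> is a nonzero idempotent in the corner of \<open>f'\<close>, so it is
  \<open>f'\<close>.\<close>

lemma baer_left_link_unique:
  assumes B: baer and p: "prim e" "prim f" "prim f'"
    and l: "left_link e f s x" "left_link e f' s' x'"
  shows "iso_idem f f'"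
proof -
  note L = left_linkD[OF l(1)] and L' = left_linkD[OF l(2)]
  obtain y where y: "y \<in> H (inv\<^bsub>G\<^esub> s \<otimes>\<^bsub>G\<^esub> s')" "x \<otimes> y = x'"
    by (rule baer_transfer[OF B p(1) L(1-3) L'(1,3,9)])
  obtain y' where y': "y' \<in> H (inv\<^bsub>G\<^esub> s' \<otimes>\<^bsub>G\<^esub> s)" "x' \<otimes> y' = x"
    by (rule baer_transfer[OF B p(1) L'(1-3) L(1,3,9)])
  have c [simp]: "y \<in> carrier R" "y' \<in> carrier R" "f \<in> carrier R" "f' \<in> carrier R" "x \<in> carrier R" "x' \<in> carrier R"
    "s \<in> carrier G" "s' \<in> carrier G"
    using H_D[OF y(1)] H_D[OF y'(1)] primD[OF p(2)] primD[OF p(3)] L L' by auto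
  define u where "u = f \<otimes> y \<otimes> f'"
  define v where "v = f' \<otimes> y' \<otimes> f"
  define g where "g = inv\<^bsub>G\<^esub> s \<otimes>\<^bsub>G\<^esub> s'"
  have g: "g \<in> carrier G" "inv\<^bsub>G\<^esub> g = inv\<^bsub>G\<^esub> s' \<otimes>\<^bsub>G\<^esub> s" by (simp_all add: g_def G.inv_mult_group)
  have u: "u \<in> H g" using H_mult[OF H_mult[OF primD(1)[OF p(2)] y(1)] primD(1)[OF p(3)]] by (simp add: u_def g_def)
  have v: "v \<in> H (inv\<^bsub>G\<^esub> g)" using H_mult[OF H_mult[OF primD(1)[OF p(3)] y'(1)] primD(1)[OF p(2)]] by (simp add: v_def g)
  have uc [simp]: "u \<in> carrier R" "v \<in> carrier R" using H_D[OF u] H_D[OF v] by auto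
  have fu: "f \<otimes> u = u" "u \<otimes> f' = u" "f' \<otimes> v = v" "v \<otimes> f = v"
    using primD[OF p(2)] primD[OF p(3)]
    by (simp_all add: u_def v_def m_assoc) (simp_all add: m_assoc[symmetric])
  have "x \<otimes> u = x \<otimes> f \<otimes> y \<otimes> f'" by (simp add: u_def m_assoc)
  then have xu: "x \<otimes> u = x'" using L(4) L'(4) y(2) by simp
  have "x' \<otimes> v = x' \<otimes> f' \<otimes> y' \<otimes> f" by (simp add: v_def m_assoc)
  then have xv: "x' \<otimes> v = x" using L(4) L'(4) y'(2) by simp
  have uv: "u \<otimes> v \<in> H \<one>\<^bsub>G\<^esub>" using H_mult[OF u v] unfolding G.r_inv[OF g(1)] .
  have "f \<otimes> (u \<otimes> v) = u \<otimes> v" "u \<otimes> v \<otimes> f = u \<otimes> v" "x \<otimes> (u \<otimes> v) = x"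
    using fu xu xv by (simp_all add: m_assoc[symmetric]) (simp add: fu m_assoc)
  then obtain w where w: "w \<in> H \<one>\<^bsub>G\<^esub>" "u \<otimes> v \<otimes> w = f" "f \<otimes> w = w" "w \<otimes> f = w"
    using prim_unit[OF p(2) uv _ _ c(5) L(2)] by blast
  have wc [simp]: "w \<in> carrier R" using H_D[OF w(1)] by simp
  let ?v = "v \<otimes> w"
  have v': "?v \<in> H (inv\<^bsub>G\<^esub> g)" using H_mult[OF v w(1)] g(1) by simp
  have uv': "u \<otimes> ?v = f" using w(2) by (simp add: m_assoc)
  have fv: "f' \<otimes> ?v = ?v" "?v \<otimes> f = ?v"
    using fu(3) w(4) by (simp_all add: m_assoc[symmetric]) (simp add: m_assoc)
  have "?v \<otimes> u = f'"
  proof -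
    have h: "?v \<otimes> u \<in> H \<one>\<^bsub>G\<^esub>" using H_mult[OF v' u] unfolding G.l_inv[OF g(1)] .
    have "(?v \<otimes> u) \<otimes> (?v \<otimes> u) = ?v \<otimes> ((u \<otimes> ?v) \<otimes> u)" by (simp add: m_assoc)
    then have i: "(?v \<otimes> u) \<otimes> (?v \<otimes> u) = ?v \<otimes> u" using uv' fu by simp
    have l: "f' \<otimes> (?v \<otimes> u) = ?v \<otimes> u" using fv by (simp add: m_assoc[symmetric])
    have r: "?v \<otimes> u \<otimes> f' = ?v \<otimes> u" using fu by (simp add: m_assoc)
    have "?v \<otimes> u \<noteq> \<zero>"
    proof
      assume "?v \<otimes> u = \<zero>"
      then have "u \<otimes> (?v \<otimes> u) = \<zero>" by simp
      moreover have "u \<otimes> (?v \<otimes> u) = (u \<otimes> ?v) \<otimes> u" by (simp add: m_assoc)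
      ultimately have "u = \<zero>" using uv' fu by simp
      then show False using xu L'(2) by simp
    qed
    then show ?thesis using prim_dichotomy[OF p(3) h i l r] by simp
  qed
  then show ?thesis unfolding iso_idem_def using u v' uv' fu fv by blast
qed

text \<open>By \<open>baer_transfer\<close>, \<open>x\<close> lies in \<open>wR\<close> for every
  nonzero homogeneous \<open>w\<close> of \<open>eR\<close>, so each minimal graded right ideal
  inside \<open>eR\<close> equals \<open>xR\<close>. The same \<open>x\<close> serves both sides,
  which is why one \<open>\<sigma> i\<close> can occur in both isomorphisms.\<close>

lemma baer_right_link:
  assumes B: baer and p: "prim e" "prim f" and l: "left_link e f s x"
  shows "right_link e f s x"
proof -
  interpret O: graded_artinian_ring "op_group G" "op_ring R" by (rule op)
  note L = left_linkD[OF l]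
  have ec [simp]: "e \<in> carrier R" "x \<in> carrier R" using primD[OF p(1)] L by auto
  have essential: "x \<in> (\<lambda>r. w \<otimes> r) ` carrier R" if w: "w \<in> H h" "w \<noteq> \<zero>" "e \<otimes> w = w" for w h
  proof -
    obtain y where "y \<in> H (inv\<^bsub>G\<^esub> h \<otimes>\<^bsub>G\<^esub> s)" "w \<otimes> y = x"
      by (rule baer_transfer[OF B p(1) w L(1,3,9)])
    then show ?thesis using H_D(2) by blast
  qed
  let ?E = "(\<lambda>r. r \<otimes>\<^bsub>op_ring R\<^esub> e) ` carrier (op_ring R)"
  have eO: "e \<in> O.H \<one>\<^bsub>op_group G\<^esub>" using primD(1)[OF p(1)] by simp
  have "O.gl ?E" by (rule O.gl_image[OF O.gl_carrier eO])
  moreover have "e \<otimes> \<one> \<in> (\<lambda>r. e \<otimes> r) ` carrier R" by (rule imageI) simp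
  then have "?E \<noteq> {\<zero>\<^bsub>op_ring R\<^esub>}" using primD(3)[OF p(1)] by auto
  ultimately obtain W h w where W: "O.cover {\<zero>\<^bsub>op_ring R\<^esub>} W" "W \<subseteq> ?E" and w: "w \<in> O.H h" "w \<in> W" "w \<noteq> \<zero>\<^bsub>op_ring R\<^esub>"
    by (rule O.minimal_subideal)
  have ew: "e \<otimes> w = w" using w(2) W(2) primD(4)[OF p(1)] by (auto simp: m_assoc[symmetric])
  obtain r where "r \<in> carrier R" "x = w \<otimes> r" using essential[of w h] w ew by auto
  then have xW: "x \<in> W" using O.glD(7)[OF O.coverD(2)[OF W(1)], of r w] w(2) by simp
  have WX: "W = (\<lambda>r. x \<otimes> r) ` carrier R"
    using O.cover_eq_principal[OF W(1) _ xW] L(1,2) by simp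
  have Wl: "z \<in> lann jac" if "z \<in> W" for z
    using O.cover_zero_rann[OF W(1) that] by (simp add: rann_op jac_op)
  have "{z \<in> lann jac. e \<otimes> z = z} = W"
  proof
    show "W \<subseteq> {z \<in> lann jac. e \<otimes> z = z}" using Wl L(3) WX by (auto simp: m_assoc[symmetric])
    show "{z \<in> lann jac. e \<otimes> z = z} \<subseteq> W"
    proof (rule ccontr)
      let ?L = "{z \<in> lann jac. e \<otimes> z = z}"
      assume n: "\<not> ?L \<subseteq> W"
      have lg: "O.gl (lann jac)" using O.gl_rann_jac by (simp add: rann_op jac_op)
      have "O.gl (lann jac \<inter> (\<lambda>r. r \<otimes>\<^bsub>op_ring R\<^esub> e) ` carrier (op_ring R))"
        by (rule O.gl_Int[OF lg O.gl_image[OF O.gl_carrier eO]])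
      moreover have "lann jac \<inter> (\<lambda>r. r \<otimes>\<^bsub>op_ring R\<^esub> e) ` carrier (op_ring R) = ?L"
      proof -
        have "e \<otimes> (e \<otimes> r) = e \<otimes> r" if "r \<in> carrier R" for r
          using that primD(4)[OF p(1)] by (simp add: m_assoc[symmetric])
        moreover have "z \<in> (\<lambda>r. e \<otimes> r) ` carrier R" if "z \<in> lann jac" "e \<otimes> z = z" for z
          using that by (intro image_eqI[of _ _ z]) (auto simp: lann_def)
        ultimately show ?thesis by auto
      qed
      ultimately have gL: "O.gl ?L" by simp
      obtain k h z where z: "O.prim k" "z \<in> O.H h" "z \<in> ?L" "z \<notin> W" "k \<otimes>\<^bsub>op_ring R\<^esub> z = z"
        using O.ex_homogeneous_prim_not_mem[OF O.coverD(2)[OF W(1)] gL n] by blast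
      have z0: "z \<noteq> \<zero>\<^bsub>op_ring R\<^esub>" using z(4) O.glD(3)[OF O.coverD(2)[OF W(1)]] by auto
      have C: "O.cover {\<zero>\<^bsub>op_ring R\<^esub>} ((\<lambda>r. r \<otimes>\<^bsub>op_ring R\<^esub> z) ` carrier (op_ring R))"
        using z(3) by (intro O.cover_principal[OF z(1,2,5) z0]) (simp add: lann_def jac_op)
      have "x \<in> (\<lambda>r. r \<otimes>\<^bsub>op_ring R\<^esub> z) ` carrier (op_ring R)" using essential[of z h] z z0 by auto
      from O.cover_eq_principal[OF C _ this] L(1,2)
      have "(\<lambda>r. z \<otimes> r) ` carrier R = W" using WX by simp
      moreover have "z \<otimes> \<one> \<in> (\<lambda>r. z \<otimes> r) ` carrier R" by (rule imageI) simp
      ultimately show False using z(3,4) by (simp add: lann_def)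
    qed
  qed
  then show ?thesis unfolding right_link_def using L WX by simp
qed

theorem baer_iff_links:
  fixes e :: "nat \<Rightarrow> 'a"
  assumes p: "\<And>i. i \<in> {1..t} \<Longrightarrow> prim (e i)"
    and dist: "\<And>i j. i \<in> {1..t} \<Longrightarrow> j \<in> {1..t} \<Longrightarrow> iso_idem (e i) (e j) \<Longrightarrow> i = j"
    and rep: "\<And>f. prim f \<Longrightarrow> \<exists>i\<in>{1..t}. iso_idem f (e i)"
  shows "baer \<longleftrightarrow> (\<exists>\<pi> \<sigma>. \<pi> permutes {1..t} \<and> (\<forall>i\<in>{1..t}. \<sigma> i \<in> carrier G) \<and>
    (\<forall>i\<in>{1..t}. (\<exists>x. left_link (e (\<pi> i)) (e i) (inv\<^bsub>G\<^esub> (\<sigma> i)) x) \<and>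
       (\<exists>y. right_link (e (\<pi> i)) (e i) (inv\<^bsub>G\<^esub> (\<sigma> i)) y)))"
    (is "_ \<longleftrightarrow> ?R")
proof
  assume B: baer
  have "\<forall>i\<in>{1..t}. \<exists>j s x. j \<in> {1..t} \<and> left_link (e j) (e i) s x"
    using baer_left_link[OF B p rep] by blast
  then obtain p0 s x where l: "\<forall>i\<in>{1..t}. p0 i \<in> {1..t} \<and> left_link (e (p0 i)) (e i) (s i) (x i)"
    by metis
  \<comment> \<open>\<open>permutes\<close> requires the identity outside
    \<open>{1..t}\<close>.\<close>
  define \<pi> where "\<pi> i = (if i \<in> {1..t} then p0 i else i)" for i
  have "inj_on \<pi> {1..t}"
  proof (rule inj_onI)
    fix i j assume ij: "i \<in> {1..t}" "j \<in> {1..t}" "\<pi> i = \<pi> j"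
    then have eq: "p0 j = p0 i" by (simp add: \<pi>_def)
    have "left_link (e (p0 i)) (e i) (s i) (x i)" "left_link (e (p0 i)) (e j) (s j) (x j)" "p0 i \<in> {1..t}"
      using l[rule_format, OF ij(1)] l[rule_format, OF ij(2)] unfolding eq by auto
    then have "iso_idem (e i) (e j)" using baer_left_link_unique[OF B p p p] ij by blast
    then show "i = j" using dist ij by blast
  qed
  moreover have "\<pi> ` {1..t} \<subseteq> {1..t}" using l by (auto simp: \<pi>_def)
  ultimately have "bij_betw \<pi> {1..t} {1..t}" by (simp add: bij_betw_def endo_inj_surj)
  then have perm: "\<pi> permutes {1..t}" by (rule bij_imp_permutes) (auto simp: \<pi>_def)
  have ll: "left_link (e (\<pi> i)) (e i) (s i) (x i)" "s i \<in> carrier G" if "i \<in> {1..t}" for i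
    using l[rule_format, OF that] left_linkD(6)[of "e (p0 i)" "e i" "s i" "x i"] that by (auto simp: \<pi>_def)
  have "\<pi> i \<in> {1..t}" if "i \<in> {1..t}" for i using permutes_in_image[OF perm] that by simp
  then have rl: "right_link (e (\<pi> i)) (e i) (s i) (x i)" if "i \<in> {1..t}" for i
    using baer_right_link[OF B p p ll(1)] that by blast
  \<comment> \<open>The degree of the generator is the inverse of the shift, so
    \<open>\<sigma> i\<close> is the inverse of \<open>s i\<close>.\<close>
  show ?R
  proof (intro exI[of _ \<pi>] exI[of _ "\<lambda>i. inv\<^bsub>G\<^esub> (s i)"] conjI ballI)
    fix i assume i: "i \<in> {1..t}"
    then have "inv\<^bsub>G\<^esub> (inv\<^bsub>G\<^esub> (s i)) = s i" using ll(2) by simp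
    then show "\<exists>x. left_link (e (\<pi> i)) (e i) (inv\<^bsub>G\<^esub> (inv\<^bsub>G\<^esub> (s i))) x"
      "\<exists>y. right_link (e (\<pi> i)) (e i) (inv\<^bsub>G\<^esub> (inv\<^bsub>G\<^esub> (s i))) y"
      using ll(1)[OF i] rl[OF i] by metis+
  qed (use perm ll(2) in auto)
next
  assume ?R
  then obtain \<pi> \<sigma> where perm: "\<pi> permutes {1..t}"
    and link: "\<And>i. i \<in> {1..t} \<Longrightarrow> \<exists>x y. left_link (e (\<pi> i)) (e i) (inv\<^bsub>G\<^esub> (\<sigma> i)) x \<and>
       right_link (e (\<pi> i)) (e i) (inv\<^bsub>G\<^esub> (\<sigma> i)) y" by blast
  have \<pi>: "\<pi> i \<in> {1..t} \<longleftrightarrow> i \<in> {1..t}" for i by (rule permutes_in_image[OF perm])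
  show baer
  proof (rule links_imp_baer)
    fix f assume f: "prim f"
    obtain i where i: "i \<in> {1..t}" "iso_idem f (e i)" using rep[OF f] by blast
    then show "\<exists>e e' s s' x y. iso_idem f e \<and> prim e \<and> prim e' \<and> left_link e' e s x \<and> right_link e' e s' y"
      using link[OF i(1)] p[OF i(1)] p[of "\<pi> i"] \<pi>[of i] by blast
    \<comment> \<open>Surjectivity of \<open>\<pi>\<close> provides a linked pair whose left
      idempotent is the given representative.\<close>
    have "i \<in> \<pi> ` {1..t}" using i permutes_image[OF perm] by simp
    then obtain j where j: "j \<in> {1..t}" "i = \<pi> j" by blast
    then show "\<exists>e e' s s' x y. iso_idem f e' \<and> prim e \<and> prim e' \<and> left_link e' e s x \<and> right_link e' e s' y"
      using link[OF j(1)] p[OF j(1)] p[OF i(1)] i(2) by blast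
  qed
qed

end

section \<open>Submodules and quotients of the regular module\<close>

lemma graded_homD:
  assumes "f \<in> graded_hom G R M N"
  shows "x \<in> carrier M \<Longrightarrow> f x \<in> carrier N"
    "x \<in> carrier M \<Longrightarrow> y \<in> carrier M \<Longrightarrow> f (x \<oplus>\<^bsub>M\<^esub> y) = f x \<oplus>\<^bsub>N\<^esub> f y"
    "r \<in> carrier R \<Longrightarrow> x \<in> carrier M \<Longrightarrow> f (r \<odot>\<^bsub>M\<^esub> x) = r \<odot>\<^bsub>N\<^esub> f x"
    "g \<in> carrier G \<Longrightarrow> x \<in> mod_part M g \<Longrightarrow> f x \<in> mod_part N g"
  using assms unfolding graded_hom_def by (auto simp: image_subset_iff)

lemma graded_isoI:
  assumes "f \<in> graded_hom G R M N" "inj_on f (carrier M)" "\<And>y. y \<in> carrier N \<Longrightarrow> y \<in> f ` carrier M"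
  shows "graded_iso G R M N"
proof -
  have "f ` carrier M \<subseteq> carrier N" using assms(1) unfolding graded_hom_def by blast
  then have "bij_betw f (carrier M) (carrier N)" using assms(2,3) unfolding bij_betw_def by blast
  then show ?thesis using assms(1) unfolding graded_iso_def by blast
qed

lemma sub_sub_gmodule:
  "N \<subseteq> K \<Longrightarrow> sub_gmodule (sub_gmodule M K) N = sub_gmodule M N"
  by (simp add: sub_gmodule_def Int_assoc Int_absorb1)

context graded_artinian_ring
begin

text \<open>Besides \<open>left_regular R\<close> this also covers \<open>right_regular\<close> over the opposite ring: the
  two differ only in the meaningless field \<open>mult\<close>.\<close>

definition regular :: "('a, 'a, 'g) gmodule \<Rightarrow> bool" where
  "regular M \<longleftrightarrow> carrier M = carrier R \<and> ring.add M = ring.add R \<and> \<zero>\<^bsub>M\<^esub> = \<zero> \<and>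
     (\<forall>r x. r \<odot>\<^bsub>M\<^esub> x = r \<otimes> x) \<and> mod_part M = ring_part R"

lemma regular_left_regular: "regular (left_regular R)"
  by (simp add: regular_def left_regular_def)

lemma sub_regular_simps:
  assumes "regular M"
  shows "carrier (sub_gmodule M K) = K" "ring.add (sub_gmodule M K) = ring.add R"
    "\<zero>\<^bsub>sub_gmodule M K\<^esub> = \<zero>" "r \<odot>\<^bsub>sub_gmodule M K\<^esub> x = r \<otimes> x"
    "mod_part (sub_gmodule M K) = (\<lambda>g. ring_part R g \<inter> K)"
  using assms by (simp_all add: regular_def sub_gmodule_def)

lemma abelian_group_sub:
  assumes M: "regular M" and K: "gl K" shows "abelian_group (sub_gmodule M K)"
proof (rule abelian_groupI)
  note s = sub_regular_simps[OF M] and Kc = glD(2)[OF K]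
  show "\<exists>y\<in>carrier (sub_gmodule M K). y \<oplus>\<^bsub>sub_gmodule M K\<^esub> x = \<zero>\<^bsub>sub_gmodule M K\<^esub>"
    if "x \<in> carrier (sub_gmodule M K)" for x
    using that glD(5)[OF K] Kc by (intro bexI[of _ "\<ominus> x"]) (simp_all add: s l_neg)
qed (use glD[OF K] in \<open>simp_all add: sub_regular_simps[OF M] a_ac\<close>)

lemma finsum_sub:
  assumes M: "regular M" and K: "gl K" and f: "f \<in> A \<rightarrow> K"
  shows "finsum (sub_gmodule M K) f A = finsum R f A"
proof -
  interpret S: abelian_group "sub_gmodule M K" by (rule abelian_group_sub[OF M K])
  note s = sub_regular_simps[OF M]
  show ?thesis
  proof (cases "finite A")
    case True
    then show ?thesis using f
    proof (induction A rule: finite_induct)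
      case (insert a A)
      then have "f \<in> A \<rightarrow> K" "f a \<in> K" "f \<in> A \<rightarrow> carrier R" "f a \<in> carrier R" using glD(2)[OF K] by auto
      then show ?case using insert by (simp add: S.finsum_insert finsum_insert s)
    qed (simp add: s S.finsum_empty)
  next
    case False then show ?thesis by (simp add: S.finsum_infinite finsum_infinite s)
  qed
qed

lemma additive_subgroup_sub:
  assumes M: "regular M" and K: "gl K"
  shows "additive_subgroup N (sub_gmodule M K) \<longleftrightarrow> additive_subgroup N R \<and> N \<subseteq> K"
proof -
  interpret S: abelian_group "sub_gmodule M K" by (rule abelian_group_sub[OF M K])
  note s = sub_regular_simps[OF M]
  have "\<ominus>\<^bsub>sub_gmodule M K\<^esub> x = \<ominus> x" if "x \<in> K" for x
    using that glD(2,5)[OF K] by (intro S.minus_equality) (simp_all add: s l_neg)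
  then show ?thesis
    unfolding S.additive_subgroup_iff additive_subgroup_iff s using glD(1)[OF K] by (auto simp: subset_iff)
qed

lemma is_decomp_sub:
  assumes M: "regular M" and K: "gl K"
  shows "is_decomp (sub_gmodule M K) (carrier G) (\<lambda>g. ring_part R g \<inter> K) c x \<longleftrightarrow>
     is_decomp R (carrier G) (ring_part R) c x \<and> (\<forall>g. c g \<in> K)"
proof -
  note s = sub_regular_simps[OF M]
  have "c g \<in> K" if "\<forall>g\<in>carrier G. c g \<in> ring_part R g \<inter> K" "\<forall>g. g \<notin> carrier G \<longrightarrow> c g = \<zero>" for g
    using that glD(3)[OF K] by (cases "g \<in> carrier G") auto
  moreover have "finsum (sub_gmodule M K) c A = finsum R c A" if "\<forall>g. c g \<in> K" for A
    using that by (intro finsum_sub[OF M K]) auto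
  ultimately show ?thesis unfolding is_decomp_def s by auto
qed

lemma graded_submodule_sub:
  assumes M: "regular M" and K: "gl K"
  shows "graded_submodule G R N (sub_gmodule M K) \<longleftrightarrow> gl N \<and> N \<subseteq> K"
proof -
  note s = sub_regular_simps[OF M]
  have *: "(\<forall>c. is_decomp (sub_gmodule M K) (carrier G) (\<lambda>g. ring_part R g \<inter> K) c x \<longrightarrow>
       (\<forall>g\<in>carrier G. c g \<in> N)) \<longleftrightarrow> (\<forall>g\<in>carrier G. cmp g x \<in> N)" if x: "x \<in> K" for x
  proof -
    have xc: "x \<in> carrier R" using glD(2)[OF K x] .
    have "cmp g x \<in> K" for g
      using glD(3,8)[OF K] x component_outside[OF xc] by (cases "g \<in> carrier G") auto
    then have "is_decomp (sub_gmodule M K) (carrier G) (\<lambda>g. ring_part R g \<inter> K) (\<lambda>g. cmp g x) x"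
      using decomp_component[OF xc] is_decomp_sub[OF M K] by blast
    moreover have "c = (\<lambda>g. cmp g x)"
      if "is_decomp (sub_gmodule M K) (carrier G) (\<lambda>g. ring_part R g \<inter> K) c x" for c
      using that decomp_unique is_decomp_sub[OF M K] by blast
    ultimately show ?thesis by blast
  qed
  have "(\<forall>x\<in>N. \<forall>c. is_decomp (sub_gmodule M K) (carrier G) (\<lambda>g. ring_part R g \<inter> K) c x \<longrightarrow>
      (\<forall>g\<in>carrier G. c g \<in> N)) \<longleftrightarrow> (\<forall>x\<in>N. \<forall>g\<in>carrier G. cmp g x \<in> N)" if "N \<subseteq> K"
    by (intro ball_cong refl *) (use that in blast)
  then show ?thesis
    unfolding gl_iff unfolding graded_submodule_def additive_subgroup_sub[OF M K] s
    by (cases "N \<subseteq> K") simp_all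
qed

lemma graded_simple_sub:
  assumes M: "regular M" and N: "gl N"
  shows "graded_simple G R (sub_gmodule M N) \<longleftrightarrow> cover {\<zero>} N"
  unfolding graded_simple_def graded_submodule_sub[OF M N] sub_regular_simps[OF M] cover_def
  using gl_zero N glD(3) by (auto simp: psubset_eq)

text \<open>The radical kills every graded simple submodule, so the socle lies in
  \<open>rann jac\<close>. Conversely, a homogeneous \<open>y\<close> in \<open>rann jac\<close> is
  the sum of the \<open>fy\<close> over a decomposition of \<open>1\<close> into primitive
  idempotents, and each nonzero \<open>fy\<close> generates a simple left ideal.\<close>

lemma graded_soc_sub:
  assumes M: "regular M" and K: "gl K"
  shows "graded_soc G R (sub_gmodule M K) = sub_gmodule M (rann jac \<inter> K)"
proof -
  let ?N = "{N. graded_submodule G R N (sub_gmodule M K) \<and> graded_simple G R (sub_gmodule (sub_gmodule M K) N)}"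
  let ?S = "sum_of_submodules (sub_gmodule M K) ?N"
  have N: "N \<in> ?N \<longleftrightarrow> N \<subseteq> K \<and> cover {\<zero>} N" for N
    using graded_submodule_sub[OF M K] graded_simple_sub[OF M] sub_sub_gmodule[of N K M] coverD(2)
    by (auto simp del: Int_iff)
  have gRK: "gl (rann jac \<inter> K)" by (rule gl_Int[OF gl_rann_jac K])
  have S_eq: "?S = {finsum R c F | F c. finite F \<and> F \<subseteq> ?N \<and> (\<forall>N\<in>F. c N \<in> N)}"
  proof -
    have fs: "finsum (sub_gmodule M K) c F = finsum R c F" if "F \<subseteq> ?N" "\<forall>N\<in>F. c N \<in> N" for F c
      using that N by (intro finsum_sub[OF M K]) blast
    show ?thesis unfolding sum_of_submodules_def
    proof (intro Collect_cong iff_exI)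
      fix x F c
      show "(x = finsum (sub_gmodule M K) c F \<and> finite F \<and> F \<subseteq> ?N \<and> (\<forall>N\<in>F. c N \<in> N)) \<longleftrightarrow>
          (x = finsum R c F \<and> finite F \<and> F \<subseteq> ?N \<and> (\<forall>N\<in>F. c N \<in> N))"
        using fs[of F c] by argo
    qed
  qed
  have Nc: "c N \<in> carrier R" if "F \<subseteq> ?N" "\<forall>N\<in>F. c N \<in> N" "N \<in> F" for F c N
    using that N glD(2)[OF K] by blast
  have add: "x \<oplus> y \<in> ?S" if xS: "x \<in> ?S" and yS: "y \<in> ?S" for x y
  proof -
    obtain F c where F: "finite F" "F \<subseteq> ?N" "\<forall>N\<in>F. c N \<in> N" "x = finsum R c F" using xS unfolding S_eq by blast
    obtain F' c' where F': "finite F'" "F' \<subseteq> ?N" "\<forall>N\<in>F'. c' N \<in> N" "y = finsum R c' F'" using yS unfolding S_eq by blast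
    \<comment> \<open>Two sums over different finite families are padded by zeros to sums over the
      union, so that they can be added termwise.\<close>
    let ?d = "\<lambda>N. if N \<in> F then c N else \<zero>" and ?d' = "\<lambda>N. if N \<in> F' then c' N else \<zero>"
    have x: "x = finsum R ?d (F \<union> F')"
      unfolding F(4) by (rule add.finprod_mono_neutral_cong_left) (use F F' Nc[OF F(2,3)] in auto)
    have y: "y = finsum R ?d' (F \<union> F')"
      unfolding F'(4) by (rule add.finprod_mono_neutral_cong_left) (use F F' Nc[OF F'(2,3)] in auto)
    have "x \<oplus> y = finsum R (\<lambda>N. ?d N \<oplus> ?d' N) (F \<union> F')"
      unfolding x y by (rule finsum_addf[symmetric]) (use Nc[OF F(2,3)] Nc[OF F'(2,3)] in auto)
    moreover have "?d N \<oplus> ?d' N \<in> N" if "N \<in> F \<union> F'" for N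
    proof -
      have "N \<in> ?N" using that F(2) F'(2) by blast
      then have "gl N" using N coverD(2) by blast
      then show ?thesis using F(3) F'(3) by (intro glD(4)) (auto simp: glD(3))
    qed
    ultimately show ?thesis unfolding S_eq using F(1,2) F'(1,2)
      by (intro CollectI exI[of _ "F \<union> F'"] exI[of _ "\<lambda>N. ?d N \<oplus> ?d' N"]) simp
  qed
  have zero: "\<zero> \<in> ?S" unfolding S_eq by (intro CollectI exI[of _ "{}"]) simp
  have single: "x \<in> ?S" if "N \<in> ?N" "x \<in> N" for N x
  proof -
    have "x \<in> carrier R" using that N glD(2)[OF K] by blast
    then have "x = finsum R (\<lambda>_. x) {N}" by (simp add: finsum_insert)
    then show ?thesis unfolding S_eq using that by (intro CollectI exI[of _ "{N}"] exI[of _ "\<lambda>_. x"]) auto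
  qed
  have "?S = rann jac \<inter> K"
  proof
    show "?S \<subseteq> rann jac \<inter> K"
    proof
      fix x assume "x \<in> ?S"
      then obtain F c where F: "finite F" "F \<subseteq> ?N" "\<forall>N\<in>F. c N \<in> N" "x = finsum R c F" unfolding S_eq by blast
      have "c N \<in> rann jac \<inter> K" if "N \<in> F" for N
        using that F N cover_zero_rann[of N "c N"] by blast
      then show "x \<in> rann jac \<inter> K"
        unfolding F(4) using gRK F(1) by (intro additive_subgroup_finsum_closed) (auto simp: gl_iff)
    qed
    show "rann jac \<inter> K \<subseteq> ?S"
    proof
      fix z assume z: "z \<in> rann jac \<inter> K"
      then have "z \<in> carrier R" using glD(2)[OF K] by blast
      then show "z \<in> ?S"
      proof (induction rule: homogeneous_induct)
        case (homogeneous g y)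
        then have y: "y \<in> H g" "y \<in> rann jac \<inter> K" using glD(8)[OF gRK z] by (auto simp: hpart_def)
        have yc: "y \<in> carrier R" using H_D[OF y(1)] by simp
        obtain T where T: "finite T" "\<forall>f\<in>T. prim f" "\<one> = finsum R (\<lambda>f. f) T"
          using idempotent_decomposition[OF one_H] by auto
        have Tc: "f \<in> carrier R" if "f \<in> T" for f using T(2) primD(2) that by blast
        have fy: "f \<otimes> y \<in> ?S" if f: "f \<in> T" for f
        proof (cases "f \<otimes> y = \<zero>")
          case False
          have pf: "prim f" using T f by blast
          have fyH: "f \<otimes> y \<in> H g" using H_mult[OF primD(1)[OF pf] y(1)] homogeneous by simp
          have fyR: "f \<otimes> y \<in> rann jac \<inter> K" by (rule glD(7)[OF gRK Tc[OF f] y(2)])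
          have "f \<otimes> (f \<otimes> y) = f \<otimes> y" using primD[OF pf] yc by (simp add: m_assoc[symmetric])
          then have "cover {\<zero>} ((\<lambda>a. a \<otimes> (f \<otimes> y)) ` carrier R)"
            using fyR by (intro cover_principal[OF pf fyH _ False]) (auto simp: rann_def)
          moreover have "(\<lambda>a. a \<otimes> (f \<otimes> y)) ` carrier R \<subseteq> K" using glD(7)[OF K] fyR by blast
          moreover have "\<one> \<otimes> (f \<otimes> y) \<in> (\<lambda>a. a \<otimes> (f \<otimes> y)) ` carrier R" by (rule imageI) simp
          ultimately show ?thesis using single N Tc[OF f] yc by auto
        qed (simp add: zero)
        have "y = finsum R (\<lambda>f. f) T \<otimes> y" unfolding T(3)[symmetric] using yc by simp
        also have "\<dots> = finsum R (\<lambda>f. f \<otimes> y) T" using T(1) Tc yc by (intro finsum_ldistr) auto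
        also have "\<dots> \<in> ?S"
        proof -
          have "A \<subseteq> T \<Longrightarrow> finsum R (\<lambda>f. f \<otimes> y) A \<in> ?S" if "finite A" for A
            using that
          proof (induction A rule: finite_induct)
            case (insert a A)
            then have "finsum R (\<lambda>f. f \<otimes> y) (insert a A) = a \<otimes> y \<oplus> finsum R (\<lambda>f. f \<otimes> y) A"
              using Tc yc by (intro finsum_insert) auto
            then show ?case using insert add[OF fy] by auto
          qed (simp add: zero)
          then show ?thesis using T(1) by blast
        qed
        finally show ?case .
      qed (use zero add in auto)
    qed
  qed
  then show ?thesis unfolding graded_soc_def by (simp add: sub_sub_gmodule)
qed

section \<open>Cosets and quotients of submodules of the regular module\<close>

definition coset :: "'a set \<Rightarrow> 'a \<Rightarrow> 'a set" where "coset L x = (\<lambda>l. l \<oplus> x) ` L"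

lemma mem_coset_iff:
  assumes L: "gl L" and x: "x \<in> carrier R"
  shows "z \<in> coset L x \<longleftrightarrow> z \<in> carrier R \<and> z \<ominus> x \<in> L"
proof
  assume "z \<in> coset L x"
  then obtain l where l: "l \<in> L" "z = l \<oplus> x" by (auto simp: coset_def)
  have "l \<in> carrier R" using glD(2)[OF L l(1)] .
  then show "z \<in> carrier R \<and> z \<ominus> x \<in> L" using l x by (simp add: a_minus_def a_assoc r_neg)
next
  assume "z \<in> carrier R \<and> z \<ominus> x \<in> L"
  moreover from this have "z = (z \<ominus> x) \<oplus> x" using x by (simp add: a_minus_def a_assoc l_neg)
  ultimately show "z \<in> coset L x" unfolding coset_def by blast
qed

lemma coset_eq_iff:
  assumes L: "gl L" and x: "x \<in> carrier R" and y: "y \<in> carrier R"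
  shows "coset L x = coset L y \<longleftrightarrow> x \<ominus> y \<in> L"
proof
  assume "coset L x = coset L y"
  moreover have "x \<in> coset L x" using x glD(3)[OF L] by (simp add: mem_coset_iff[OF L] a_minus_def r_neg)
  ultimately show "x \<ominus> y \<in> L" using mem_coset_iff[OF L y] by blast
next
  assume xy: "x \<ominus> y \<in> L"
  have "z \<ominus> x \<in> L \<longleftrightarrow> z \<ominus> y \<in> L" if z: "z \<in> carrier R" for z
  proof -
    have "(z \<ominus> x) \<oplus> (x \<ominus> y) = z \<oplus> (\<ominus> x \<oplus> (x \<oplus> \<ominus> y))" using x y z by (simp add: a_minus_def a_assoc)
    then have 1: "(z \<ominus> x) \<oplus> (x \<ominus> y) = z \<ominus> y" using x y z by (simp add: a_minus_def r_neg1)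
    have "(z \<ominus> y) \<ominus> (x \<ominus> y) = z \<oplus> (\<ominus> y \<oplus> (y \<oplus> \<ominus> x))"
      using x y z by (simp add: a_minus_def minus_add a_ac)
    then have 2: "(z \<ominus> y) \<ominus> (x \<ominus> y) = z \<ominus> x" using x y z by (simp add: a_minus_def r_neg1)
    show ?thesis using glD(4)[OF L _ xy, of "z \<ominus> x"] glD(6)[OF L _ xy, of "z \<ominus> y"] 1 2 by auto
  qed
  then show "coset L x = coset L y"
    using mem_coset_iff[OF L x] mem_coset_iff[OF L y] by blast
qed

lemma coset_self: "gl L \<Longrightarrow> x \<in> carrier R \<Longrightarrow> x \<in> coset L x"
  using glD(3) by (simp add: mem_coset_iff a_minus_def r_neg)

context
  fixes M K L
  assumes M: "regular M" and K: "gl K" and L: "gl L" "L \<subseteq> K"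
begin

lemma a_r_coset_sub: "L +>\<^bsub>sub_gmodule M K\<^esub> x = coset L x"
  unfolding a_r_coset_def r_coset_def coset_def by (auto simp: sub_regular_simps[OF M])

lemma quot_carrier: "carrier (quot_gmodule (sub_gmodule M K) L) = coset L ` K"
  using a_r_coset_sub unfolding quot_gmodule_def A_RCOSETS_def RCOSETS_def a_r_coset_def
  by (auto simp: sub_regular_simps[OF M])

lemma quot_mod_part:
  "mod_part (quot_gmodule (sub_gmodule M K) L) g = coset L ` (ring_part R g \<inter> K)"
  by (simp add: quot_gmodule_def a_r_coset_sub sub_regular_simps[OF M])

lemma quot_add:
  assumes x: "x \<in> carrier R" and y: "y \<in> carrier R"
  shows "coset L x \<oplus>\<^bsub>quot_gmodule (sub_gmodule M K) L\<^esub> coset L y = coset L (x \<oplus> y)"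
proof -
  have "coset L x \<oplus>\<^bsub>quot_gmodule (sub_gmodule M K) L\<^esub> coset L y = (\<Union>l\<in>L. \<Union>m\<in>L. {(l \<oplus> x) \<oplus> (m \<oplus> y)})"
    by (auto simp: quot_gmodule_def set_add_def set_mult_def sub_regular_simps[OF M] coset_def)
  also have "\<dots> = coset L (x \<oplus> y)"
  proof (intro equalityI subsetI)
    fix z assume "z \<in> (\<Union>l\<in>L. \<Union>m\<in>L. {(l \<oplus> x) \<oplus> (m \<oplus> y)})"
    then obtain l m where lm: "l \<in> L" "m \<in> L" "z = (l \<oplus> x) \<oplus> (m \<oplus> y)" by blast
    then have "z = (l \<oplus> m) \<oplus> (x \<oplus> y)" using x y glD(2)[OF L(1)] by (simp add: a_ac)
    then show "z \<in> coset L (x \<oplus> y)" using glD(4)[OF L(1) lm(1,2)] unfolding coset_def by blast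
  next
    fix z assume "z \<in> coset L (x \<oplus> y)"
    then obtain l where l: "l \<in> L" "z = l \<oplus> (x \<oplus> y)" by (auto simp: coset_def)
    then have "z = (l \<oplus> x) \<oplus> (\<zero> \<oplus> y)" using x y glD(2)[OF L(1)] by (simp add: a_assoc)
    then show "z \<in> (\<Union>l\<in>L. \<Union>m\<in>L. {(l \<oplus> x) \<oplus> (m \<oplus> y)})" using l(1) glD(3)[OF L(1)] by blast
  qed
  finally show ?thesis .
qed

lemma quot_smult:
  assumes r: "r \<in> carrier R" and x: "x \<in> carrier R"
  shows "r \<odot>\<^bsub>quot_gmodule (sub_gmodule M K) L\<^esub> coset L x = coset L (r \<otimes> x)"
proof -
  have "r \<odot>\<^bsub>quot_gmodule (sub_gmodule M K) L\<^esub> coset L x = (\<Union>z\<in>coset L x. coset L (r \<otimes> z))"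
    by (simp add: quot_gmodule_def a_r_coset_sub sub_regular_simps[OF M])
  \<comment> \<open>All members of the union are the same coset, since \<open>L\<close> is a left
    ideal.\<close>
  also have "\<dots> = (\<Union>z\<in>coset L x. coset L (r \<otimes> x))"
  proof (rule SUP_cong[OF refl])
    fix z assume "z \<in> coset L x"
    then have z: "z \<in> carrier R" "z \<ominus> x \<in> L" using mem_coset_iff[OF L(1) x] by auto
    have "r \<otimes> z \<ominus> r \<otimes> x = r \<otimes> (z \<ominus> x)" using r x z by (simp add: a_minus_def r_distr r_minus)
    also have "\<dots> \<in> L" by (rule glD(7)[OF L(1) r z(2)])
    finally show "coset L (r \<otimes> z) = coset L (r \<otimes> x)" using coset_eq_iff[OF L(1)] r x z by simp
  qed
  also have "\<dots> = coset L (r \<otimes> x)" using coset_self[OF L(1) x] by auto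
  finally show ?thesis .
qed

end

section \<open>Isomorphisms of socles and tops in terms of linked pairs\<close>

lemma principal_image:
  assumes "e \<in> carrier R" "e \<otimes> e = e"
  shows "z \<in> (\<lambda>r. r \<otimes> e) ` carrier R \<longleftrightarrow> z \<in> carrier R \<and> z \<otimes> e = z"
proof
  assume "z \<in> (\<lambda>r. r \<otimes> e) ` carrier R"
  then show "z \<in> carrier R \<and> z \<otimes> e = z" using assms by (auto simp: m_assoc)
next
  assume "z \<in> carrier R \<and> z \<otimes> e = z"
  then show "z \<in> (\<lambda>r. r \<otimes> e) ` carrier R" by (intro image_eqI[of _ _ z]) auto
qed

lemma jac_image:
  assumes "prim e"
  shows "z \<in> (\<lambda>j. j \<otimes> e) ` jac \<longleftrightarrow> z \<in> jac \<and> z \<otimes> e = z"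
proof
  assume "z \<in> (\<lambda>j. j \<otimes> e) ` jac"
  then show "z \<in> jac \<and> z \<otimes> e = z"
    using primD[OF assms] jac_right glD(2)[OF gl_jac] by (auto simp: m_assoc)
next
  assume "z \<in> jac \<and> z \<otimes> e = z"
  then show "z \<in> (\<lambda>j. j \<otimes> e) ` jac" by (intro image_eqI[of _ _ z]) auto
qed

lemma prim_not_jac: "prim e \<Longrightarrow> e \<notin> jac"
proof
  assume e: "prim e" and "e \<in> jac"
  then have "nilp e" using jac_unit_part_nilp primD(1) by blast
  then have "e \<in> {\<zero>}" using primD[OF e] nilp_fix_zero[of e "{\<zero>}" e] gl_zero by (simp add: a_minus_def r_neg)
  then show False using primD(3)[OF e] by simp
qed

text \<open>\<open>x\<close> is the preimage of the class of \<open>e'\<close>. Then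
  \<open>e'x = x\<close> and \<open>S = Rx\<close> follow from linearity and bijectivity, and
  \<open>x\<close> is nonzero as \<open>e'\<close> is not in the radical. The degree of
  \<open>x\<close> needs \<open>comp\<close>, because \<open>F\<close>, but not its inverse, is
  known to respect degrees.\<close>

lemma socle_iso_top_imp_link:
  assumes M: "regular M" and e: "prim e" and e': "prim e'" and \<tau>: "\<tau> \<in> carrier G"
    and iso: "graded_iso G R (graded_soc G R (sub_gmodule M ((\<lambda>r. r \<otimes> e) ` carrier R)))
       (left_shift G (quot_gmodule (sub_gmodule M ((\<lambda>r. r \<otimes> e') ` carrier R)) ((\<lambda>j. j \<otimes> e') ` jac)) \<tau>)"
  shows "\<exists>x. left_link e' e (inv\<^bsub>G\<^esub> \<tau>) x"
proof -
  let ?K = "(\<lambda>r. r \<otimes> e) ` carrier R" and ?K' = "(\<lambda>r. r \<otimes> e') ` carrier R" and ?L = "(\<lambda>j. j \<otimes> e') ` jac"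
  have K: "gl ?K" "gl ?K'" "gl ?L"
    using gl_image[OF gl_carrier primD(1)[OF e]] gl_image[OF gl_carrier primD(1)[OF e']]
      gl_image[OF gl_jac primD(1)[OF e']] by simp_all
  have LK: "?L \<subseteq> ?K'" using glD(1)[OF gl_jac] by blast
  note LD = jac_image[OF e'] and Lc = glD(2)[OF K(3)]
  define S where "S = rann jac \<inter> ?K"
  have S: "gl S" unfolding S_def by (rule gl_Int[OF gl_rann_jac K(1)])
  note Sc = glD(2)[OF S]
  have [simp]: "e' \<in> carrier R" using primD[OF e'] by simp
  obtain F where F: "F \<in> graded_hom G R (sub_gmodule M S)
      (left_shift G (quot_gmodule (sub_gmodule M ?K') ?L) \<tau>)"
    and bij: "bij_betw F S (coset ?L ` ?K')"
    using iso unfolding graded_iso_def graded_soc_sub[OF M K(1), folded S_def]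
    by (auto simp: left_shift_def quot_carrier[OF M K(2,3) LK] sub_regular_simps[OF M])
  have inj: "z = w" if "z \<in> S" "w \<in> S" "F z = F w" for z w
    using bij that by (auto simp: bij_betw_def inj_on_def)
  have Fadd: "F (x \<oplus> y) = coset ?L (v \<oplus> w)"
    if "x \<in> S" "y \<in> S" "v \<in> carrier R" "w \<in> carrier R" "F x = coset ?L v" "F y = coset ?L w" for x y v w
    using F that quot_add[OF M K(2,3) LK] by (simp add: graded_hom_def sub_regular_simps[OF M] left_shift_def)
  have Fsmult: "F (r \<otimes> x) = coset ?L (r \<otimes> v)"
    if "r \<in> carrier R" "x \<in> S" "v \<in> carrier R" "F x = coset ?L v" for r x v
    using F that quot_smult[OF M K(2,3) LK] by (simp add: graded_hom_def sub_regular_simps[OF M] left_shift_def)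
  have Fpart: "\<exists>v. v \<in> H (g \<otimes>\<^bsub>G\<^esub> \<tau>) \<and> F x = coset ?L v" if "x \<in> S" "x \<in> H g" for x g
  proof -
    have g: "g \<in> carrier G" using H_D[OF that(2)] by simp
    have "F ` (ring_part R g \<inter> S) \<subseteq> coset ?L ` (ring_part R (g \<otimes>\<^bsub>G\<^esub> \<tau>) \<inter> ?K')"
      using F g by (simp add: graded_hom_def sub_regular_simps[OF M] left_shift_def quot_mod_part[OF M K(2,3) LK])
    then show ?thesis using that g \<tau> by (auto simp: hpart_def)
  qed
  have Fex: "\<exists>v\<in>?K'. F z = coset ?L v" if "z \<in> S" for z
  proof -
    have "F z \<in> coset ?L ` ?K'" using bij that unfolding bij_betw_def by blast
    then show ?thesis by blast
  qed
  have K'c: "v \<in> carrier R" if "v \<in> ?K'" for v using glD(2)[OF K(2) that] .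
  have F0: "F \<zero> = coset ?L \<zero>"
  proof -
    obtain v where v: "v \<in> ?K'" "F \<zero> = coset ?L v" using Fex glD(3)[OF S] by blast
    have "v \<in> carrier R" using K'c[OF v(1)] .
    then show ?thesis using Fsmult[of \<zero> \<zero> v] v(2) glD(3)[OF S] by simp
  qed
  \<comment> \<open>\<open>F\<close> commutes with taking components, up to the shift of degrees by
    \<open>\<tau>\<close>. A class has no canonical representative, so the claim is made for every
    representative \<open>w\<close>; membership in \<open>S\<close> is carried along for the
    additive step.\<close>
  have comp: "z \<in> S \<and> (\<forall>w\<in>carrier R. F z = coset ?L w \<longrightarrow>
      (\<forall>g\<in>carrier G. F (cmp g z) = coset ?L (cmp (g \<otimes>\<^bsub>G\<^esub> \<tau>) w)))" if z: "z \<in> S" for z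
    using Sc[OF z]
  proof (induction rule: homogeneous_induct)
    case zero
    have "F (cmp g \<zero>) = coset ?L (cmp (g \<otimes>\<^bsub>G\<^esub> \<tau>) w)"
      if "w \<in> carrier R" "F \<zero> = coset ?L w" "g \<in> carrier G" for w g
    proof -
      have "coset ?L w = coset ?L \<zero>" using that(2) F0 by simp
      then have "w \<ominus> \<zero> \<in> ?L" using coset_eq_iff[OF K(3) that(1)] by simp
      then have "w \<in> ?L" using that by (simp add: a_minus_def)
      then have "cmp (g \<otimes>\<^bsub>G\<^esub> \<tau>) w \<in> ?L" using that \<tau> by (intro glD(8)[OF K(3)]) simp_all
      then have "coset ?L (cmp (g \<otimes>\<^bsub>G\<^esub> \<tau>) w) = coset ?L \<zero>"
        using that coset_eq_iff[OF K(3), of "cmp (g \<otimes>\<^bsub>G\<^esub> \<tau>) w" \<zero>] by (simp add: a_minus_def)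
      then show ?thesis using F0 by (simp add: component_zero)
    qed
    then show ?case using glD(3)[OF S] by blast
  next
    case (homogeneous k y)
    then have y: "y \<in> H k" "y \<in> S" using glD(8)[OF S z] by (auto simp: hpart_def)
    have "F (cmp g y) = coset ?L (cmp (g \<otimes>\<^bsub>G\<^esub> \<tau>) w)"
      if w: "w \<in> carrier R" "F y = coset ?L w" and g: "g \<in> carrier G" for w g
    proof -
      obtain v where v: "v \<in> H (k \<otimes>\<^bsub>G\<^esub> \<tau>)" "F y = coset ?L v" using Fpart[OF y(2,1)] by blast
      have vc: "v \<in> carrier R" using H_D[OF v(1)] by simp
      have "v \<ominus> w \<in> ?L" using v(2) w coset_eq_iff[OF K(3) vc w(1)] by simp
      then have "cmp (g \<otimes>\<^bsub>G\<^esub> \<tau>) (v \<ominus> w) \<in> ?L" using g \<tau> by (intro glD(8)[OF K(3)]) simp_all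
      then have eq: "coset ?L (cmp (g \<otimes>\<^bsub>G\<^esub> \<tau>) v) = coset ?L (cmp (g \<otimes>\<^bsub>G\<^esub> \<tau>) w)"
        using coset_eq_iff[OF K(3)] vc w by (simp add: component_diff)
      show ?thesis
      proof (cases "g = k")
        case True then show ?thesis using eq v y(1) by simp
      next
        case False
        then have "g \<otimes>\<^bsub>G\<^esub> \<tau> \<noteq> k \<otimes>\<^bsub>G\<^esub> \<tau>" using g \<tau> homogeneous(1) by simp
        then have "cmp (g \<otimes>\<^bsub>G\<^esub> \<tau>) v = \<zero>" using component_H[OF v(1)] by simp
        moreover have "cmp g y = \<zero>" using component_H[OF y(1)] False by simp
        ultimately show ?thesis using eq F0 by simp
      qed
    qed
    then show ?case using y(2) by blast
  next
    case (add a b)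
    have "F (cmp g (a \<oplus> b)) = coset ?L (cmp (g \<otimes>\<^bsub>G\<^esub> \<tau>) w)"
      if w: "w \<in> carrier R" "F (a \<oplus> b) = coset ?L w" and g: "g \<in> carrier G" for w g
    proof -
      obtain u v where uv: "u \<in> ?K'" "F a = coset ?L u" "v \<in> ?K'" "F b = coset ?L v"
        using Fex add by meson
      have c [simp]: "u \<in> carrier R" "v \<in> carrier R" using uv K'c by auto
      have "coset ?L (u \<oplus> v) = coset ?L w" using Fadd[of a b u v] uv w add by simp
      then have "u \<oplus> v \<ominus> w \<in> ?L" using coset_eq_iff[OF K(3)] w by simp
      then have "cmp (g \<otimes>\<^bsub>G\<^esub> \<tau>) (u \<oplus> v \<ominus> w) \<in> ?L" using g \<tau> by (intro glD(8)[OF K(3)]) simp_all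
      then have eq: "coset ?L (cmp (g \<otimes>\<^bsub>G\<^esub> \<tau>) u \<oplus> cmp (g \<otimes>\<^bsub>G\<^esub> \<tau>) v) = coset ?L (cmp (g \<otimes>\<^bsub>G\<^esub> \<tau>) w)"
        using coset_eq_iff[OF K(3)] w by (simp add: component_diff component_add)
      have "F (cmp g a) = coset ?L (cmp (g \<otimes>\<^bsub>G\<^esub> \<tau>) u)" "F (cmp g b) = coset ?L (cmp (g \<otimes>\<^bsub>G\<^esub> \<tau>) v)"
        using add uv c g by blast+
      then have "F (cmp g a \<oplus> cmp g b) = coset ?L (cmp (g \<otimes>\<^bsub>G\<^esub> \<tau>) u \<oplus> cmp (g \<otimes>\<^bsub>G\<^esub> \<tau>) v)"
        using Fadd[of "cmp g a" "cmp g b"] add g glD(8)[OF S] by simp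
      then show ?thesis using eq add by (simp add: component_add)
    qed
    then show ?case using add glD(4)[OF S] by blast
  qed
  have eK: "e' \<in> ?K'" using principal_image[of e' e'] primD[OF e'] by simp
  then have "coset ?L e' \<in> F ` S" using bij by (simp add: bij_betw_def)
  then obtain x where x: "x \<in> S" "F x = coset ?L e'" by force
  have xc [simp]: "x \<in> carrier R" using Sc[OF x(1)] .
  have x_link: "e' \<otimes> x = x"
    using Fsmult[of e' x e'] x primD[OF e'] glD(7)[OF S, of e' x] by (intro inj) simp_all
  have x0: "x \<noteq> \<zero>"
  proof
    assume "x = \<zero>"
    then have "coset ?L e' = coset ?L \<zero>" using x(2) F0 by simp
    then have "e' \<ominus> \<zero> \<in> ?L" using coset_eq_iff[OF K(3), of e' \<zero>] by simp
    then show False using LD[of e'] prim_not_jac[OF e'] by (simp add: a_minus_def)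
  qed
  \<comment> \<open>\<open>e'\<close> has a neutral component only, which in the shifted module sits
    in degree \<open>inv \<tau>\<close>.\<close>
  have cx: "cmp g x = (if g = inv\<^bsub>G\<^esub> \<tau> then x else \<zero>)" if g: "g \<in> carrier G" for g
  proof -
    have "F (cmp g x) = coset ?L (cmp (g \<otimes>\<^bsub>G\<^esub> \<tau>) e')" using comp[OF x(1)] x(2) g by simp
    moreover have "g \<otimes>\<^bsub>G\<^esub> \<tau> = \<one>\<^bsub>G\<^esub> \<longleftrightarrow> g = inv\<^bsub>G\<^esub> \<tau>"
      using g \<tau> G.inv_equality[of g \<tau>] by auto
    ultimately have "F (cmp g x) = F (if g = inv\<^bsub>G\<^esub> \<tau> then x else \<zero>)"
      using x(2) F0 component_H[OF primD(1)[OF e']] by simp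
    then show ?thesis using x(1) glD(3,8)[OF S] g by (intro inj) auto
  qed
  have "x \<ominus> cmp (inv\<^bsub>G\<^esub> \<tau>) x = \<zero>"
  proof (rule eq_zero_if_components)
    fix g assume g: "g \<in> carrier G"
    have "cmp (inv\<^bsub>G\<^esub> \<tau>) x = x" using cx[of "inv\<^bsub>G\<^esub> \<tau>"] \<tau> by simp
    then show "cmp g (x \<ominus> cmp (inv\<^bsub>G\<^esub> \<tau>) x) = \<zero>" by (simp add: a_minus_def r_neg component_zero)
  qed simp
  then have "x = cmp (inv\<^bsub>G\<^esub> \<tau>) x" by (simp add: r_right_minus_eq)
  then have xH: "x \<in> H (inv\<^bsub>G\<^esub> \<tau>)" using H_component[of x "inv\<^bsub>G\<^esub> \<tau>"] \<tau> by simp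
  have S_eq: "S = {z \<in> rann jac. z \<otimes> e = z}"
    unfolding S_def using principal_image[OF primD(2,4)[OF e]] by (auto simp: rann_def)
  have "S = (\<lambda>r. r \<otimes> x) ` carrier R"
  proof
    show "(\<lambda>r. r \<otimes> x) ` carrier R \<subseteq> S" using glD(7)[OF S _ x(1)] by blast
    show "S \<subseteq> (\<lambda>r. r \<otimes> x) ` carrier R"
    proof
      fix z assume z: "z \<in> S"
      then obtain v where "v \<in> ?K'" "F z = coset ?L v" using Fex by blast
      then obtain r where r: "r \<in> carrier R" "F z = coset ?L (r \<otimes> e')" by blast
      have "F (r \<otimes> x) = coset ?L (r \<otimes> e')" using Fsmult[OF r(1) x(1) _ x(2)] by simp
      then have "z = r \<otimes> x" using r z glD(7)[OF S r(1) x(1)] by (intro inj) simp_all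
      then show "z \<in> (\<lambda>r. r \<otimes> x) ` carrier R" using r(1) by blast
    qed
  qed
  moreover have "x \<otimes> e = x" using x(1) unfolding S_eq by simp
  ultimately have "left_link e' e (inv\<^bsub>G\<^esub> \<tau>) x"
    unfolding left_link_def S_eq using xH x0 x_link by simp
  then show ?thesis ..
qed

text \<open>The isomorphism is \<open>rx |-> re' + Je'\<close>. The annihilator of \<open>x\<close>
  in \<open>Re'\<close> is exactly \<open>Je'\<close>: one inclusion is
  \<open>prim_annihilator\<close>, the other holds as \<open>x\<close> is killed by the radical. So
  the map is well defined and injective.\<close>

lemma link_imp_socle_iso_top:
  assumes M: "regular M" and e: "prim e" and e': "prim e'" and \<tau>: "\<tau> \<in> carrier G"
    and link: "left_link e' e (inv\<^bsub>G\<^esub> \<tau>) x"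
  shows "graded_iso G R (graded_soc G R (sub_gmodule M ((\<lambda>r. r \<otimes> e) ` carrier R)))
       (left_shift G (quot_gmodule (sub_gmodule M ((\<lambda>r. r \<otimes> e') ` carrier R)) ((\<lambda>j. j \<otimes> e') ` jac)) \<tau>)"
proof -
  let ?K = "(\<lambda>r. r \<otimes> e) ` carrier R" and ?K' = "(\<lambda>r. r \<otimes> e') ` carrier R" and ?L = "(\<lambda>j. j \<otimes> e') ` jac"
  have K: "gl ?K" "gl ?K'" "gl ?L"
    using gl_image[OF gl_carrier primD(1)[OF e]] gl_image[OF gl_carrier primD(1)[OF e']]
      gl_image[OF gl_jac primD(1)[OF e']] by simp_all
  have LK: "?L \<subseteq> ?K'" using glD(1)[OF gl_jac] by blast
  have LD: "r \<otimes> e' \<in> jac \<Longrightarrow> r \<in> carrier R \<Longrightarrow> r \<otimes> e' \<in> ?L" for r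
    using jac_image[OF e', of "r \<otimes> e'"] primD[OF e'] by (simp add: m_assoc)
  define S where "S = rann jac \<inter> ?K"
  note x = left_linkD[OF link]
  have [simp]: "e' \<in> carrier R" "x \<in> carrier R" using primD[OF e'] x by auto
  have S_eq: "S = (\<lambda>r. r \<otimes> x) ` carrier R"
  proof -
    have "S = {z \<in> rann jac. z \<otimes> e = z}"
      unfolding S_def using principal_image[OF primD(2,4)[OF e]] by (auto simp: rann_def)
    then show ?thesis using link by (simp add: left_link_def)
  qed
  define F where "F z = coset ?L ((SOME r. r \<in> carrier R \<and> z = r \<otimes> x) \<otimes> e')" for z
  have eq_iff: "coset ?L (r \<otimes> e') = coset ?L (s \<otimes> e') \<longleftrightarrow> r \<otimes> x = s \<otimes> x"
    if rs: "r \<in> carrier R" "s \<in> carrier R" for r s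
  proof -
    have d: "r \<otimes> e' \<ominus> s \<otimes> e' = (r \<ominus> s) \<otimes> e'" "r \<otimes> x \<ominus> s \<otimes> x = (r \<ominus> s) \<otimes> x"
      using rs by (simp_all add: a_minus_def l_distr l_minus)
    have "(r \<ominus> s) \<otimes> e' \<in> ?L \<longleftrightarrow> (r \<ominus> s) \<otimes> x = \<zero>"
    proof
      assume "(r \<ominus> s) \<otimes> e' \<in> ?L"
      then have "(r \<ominus> s) \<otimes> e' \<in> jac" using jac_image[OF e'] by blast
      then have "(r \<ominus> s) \<otimes> e' \<otimes> x = \<zero>" using x(9) by (simp add: rann_def)
      then show "(r \<ominus> s) \<otimes> x = \<zero>" using x(3) rs by (simp add: m_assoc)
    next
      assume "(r \<ominus> s) \<otimes> x = \<zero>"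
      then show "(r \<ominus> s) \<otimes> e' \<in> ?L" using prim_annihilator[OF e' x(1-3)] rs by (intro LD) auto
    qed
    then show ?thesis
      using coset_eq_iff[OF K(3), of "r \<otimes> e'" "s \<otimes> e'"] rs d r_right_minus_eq[of "r \<otimes> x" "s \<otimes> x"] by simp
  qed
  have F: "F (r \<otimes> x) = coset ?L (r \<otimes> e')" if r: "r \<in> carrier R" for r
  proof -
    define s where "s = (SOME s. s \<in> carrier R \<and> r \<otimes> x = s \<otimes> x)"
    have "s \<in> carrier R \<and> r \<otimes> x = s \<otimes> x" unfolding s_def by (rule someI[of _ r]) (simp add: r)
    then have "coset ?L (s \<otimes> e') = coset ?L (r \<otimes> e')" using eq_iff[of s r] r by simp
    then show ?thesis by (simp add: F_def s_def)
  qed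
  note simps = left_shift_def quot_carrier[OF M K(2,3) LK] sub_regular_simps[OF M]
    quot_mod_part[OF M K(2,3) LK]
  have "F \<in> graded_hom G R (sub_gmodule M S) (left_shift G (quot_gmodule (sub_gmodule M ?K') ?L) \<tau>)"
    unfolding graded_hom_def
  proof (intro CollectI conjI ballI)
    show "F \<in> carrier (sub_gmodule M S) \<rightarrow> carrier (left_shift G (quot_gmodule (sub_gmodule M ?K') ?L) \<tau>)"
      by (auto simp: simps S_eq F)
  next
    fix z w assume "z \<in> carrier (sub_gmodule M S)" "w \<in> carrier (sub_gmodule M S)"
    then obtain r s where rs: "r \<in> carrier R" "s \<in> carrier R" "z = r \<otimes> x" "w = s \<otimes> x"
      by (auto simp: simps S_eq)
    then have "F (z \<oplus> w) = coset ?L (r \<otimes> e' \<oplus> s \<otimes> e')" using F[of "r \<oplus> s"] by (simp add: l_distr)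
    then show "F (z \<oplus>\<^bsub>sub_gmodule M S\<^esub> w) =
        F z \<oplus>\<^bsub>left_shift G (quot_gmodule (sub_gmodule M ?K') ?L) \<tau>\<^esub> F w"
      using rs quot_add[OF M K(2,3) LK] by (simp add: sub_regular_simps[OF M] left_shift_def F)
  next
    fix r z assume r: "r \<in> carrier R" and "z \<in> carrier (sub_gmodule M S)"
    then obtain s where s: "s \<in> carrier R" "z = s \<otimes> x" by (auto simp: simps S_eq)
    then have "F (r \<otimes> z) = coset ?L (r \<otimes> (s \<otimes> e'))" using F[of "r \<otimes> s"] r by (simp add: m_assoc)
    then show "F (r \<odot>\<^bsub>sub_gmodule M S\<^esub> z) = r \<odot>\<^bsub>left_shift G (quot_gmodule (sub_gmodule M ?K') ?L) \<tau>\<^esub> F z"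
      using r s quot_smult[OF M K(2,3) LK r, of "s \<otimes> e'"] by (simp add: sub_regular_simps[OF M] left_shift_def F)
  next
    fix g assume g: "g \<in> carrier G"
    show "F ` mod_part (sub_gmodule M S) g \<subseteq> mod_part (left_shift G (quot_gmodule (sub_gmodule M ?K') ?L) \<tau>) g"
    proof
      fix u assume "u \<in> F ` mod_part (sub_gmodule M S) g"
      then obtain z where z: "z \<in> ring_part R g" "z \<in> S" "u = F z" by (auto simp: simps)
      then obtain r where r: "r \<in> carrier R" "z = r \<otimes> x" by (auto simp: S_eq)
      have zH: "z \<in> H g" using z g by (simp add: hpart_def)
      define b where "b = cmp (g \<otimes>\<^bsub>G\<^esub> \<tau>) r"
      have b: "b \<in> H (g \<otimes>\<^bsub>G\<^esub> \<tau>)" unfolding b_def using r g \<tau> by (intro H_component) simp_all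
      have bc: "b \<in> carrier R" using H_D[OF b] by simp
      have "z = cmp g z" using zH by simp
      also have "\<dots> = b \<otimes> x" unfolding r(2) using component_mult_H'[OF x(1) r(1) g] \<tau> by (simp add: b_def)
      finally have "u = coset ?L (b \<otimes> e')" using z(3) F[OF bc] by simp
      moreover have "b \<otimes> e' \<in> H (g \<otimes>\<^bsub>G\<^esub> \<tau>)" using H_mult[OF b primD(1)[OF e']] g \<tau> by simp
      then have "b \<otimes> e' \<in> ring_part R (g \<otimes>\<^bsub>G\<^esub> \<tau>) \<inter> ?K'" using g \<tau> bc by (auto simp: hpart_def)
      ultimately show "u \<in> mod_part (left_shift G (quot_gmodule (sub_gmodule M ?K') ?L) \<tau>) g"
        by (auto simp: simps)
    qed
  qed
  moreover have "inj_on F S" using eq_iff by (auto simp: inj_on_def S_eq F)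
  moreover have "y \<in> F ` S" if "y \<in> coset ?L ` ?K'" for y using that F by (force simp: S_eq)
  ultimately show ?thesis
    unfolding graded_soc_sub[OF M K(1), folded S_def]
    by (intro graded_isoI[of F]) (simp_all add: simps)
qed

text \<open>Take \<open>u\<close> to be the image of \<open>f\<close>, so that the isomorphism is
  right multiplication by \<open>u\<close>. The preimage \<open>r\<close> of \<open>e\<close>
  satisfies \<open>ru = e\<close>, and its component of degree \<open>inv \<tau>\<close>, cut down
  by \<open>e\<close> and \<open>f\<close>, is \<open>v\<close>. Then \<open>uv\<close> and
  \<open>f\<close> have the same image, so \<open>uv = f\<close>.\<close>

lemma iso_imp_iso_idem:
  assumes e: "e \<in> H \<one>\<^bsub>G\<^esub>" "e \<otimes> e = e" and f: "f \<in> H \<one>\<^bsub>G\<^esub>" "f \<otimes> f = f" and \<tau>: "\<tau> \<in> carrier G"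
    and iso: "graded_iso G R (left_principal R f) (left_shift G (left_principal R e) \<tau>)"
  shows "iso_idem f e"
proof -
  note M = regular_left_regular
  let ?K = "(\<lambda>r. r \<otimes> f) ` carrier R" and ?K' = "(\<lambda>r. r \<otimes> e) ` carrier R"
  have c [simp]: "e \<in> carrier R" "f \<in> carrier R" using H_D e f by auto
  note KD = principal_image[OF c(2) f(2)] and KD' = principal_image[OF c(1) e(2)]
  obtain F where F: "F \<in> graded_hom G R (left_principal R f) (left_shift G (left_principal R e) \<tau>)"
    and bij: "bij_betw F ?K ?K'"
    using iso unfolding graded_iso_def left_principal_def by (auto simp: left_shift_def sub_regular_simps[OF M])
  have Fm: "F (r \<otimes> z) = r \<otimes> F z" if "r \<in> carrier R" "z \<in> ?K" for r z
    using graded_homD(3)[OF F, of r z] that by (simp add: left_principal_def left_shift_def sub_regular_simps[OF M])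
  have "F ` mod_part (left_principal R f) \<one>\<^bsub>G\<^esub> \<subseteq> mod_part (left_shift G (left_principal R e) \<tau>) \<one>\<^bsub>G\<^esub>"
    using F unfolding graded_hom_def by blast
  then have "F ` (ring_part R \<one>\<^bsub>G\<^esub> \<inter> ?K) \<subseteq> ring_part R \<tau> \<inter> ?K'"
    using \<tau> unfolding left_principal_def by (simp add: left_shift_def sub_regular_simps[OF M])
  moreover have fK: "f \<in> ?K" using KD f by simp
  moreover have "f \<in> ring_part R \<one>\<^bsub>G\<^esub>" using f by (simp add: hpart_def)
  ultimately have u: "F f \<in> H \<tau>" "F f \<in> ?K'" using \<tau> by (auto simp: hpart_def)
  define u where "u = F f"
  have uc [simp]: "u \<in> carrier R" using H_D u by (simp add: u_def)
  have uH: "u \<in> H \<tau>" using u by (simp add: u_def)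
  have ue: "u \<otimes> e = u" using u KD' by (simp add: u_def)
  have fu: "f \<otimes> u = u" using Fm[of f f] f fK by (simp add: u_def)
  have Fu: "F z = z \<otimes> u" if "z \<in> ?K" for z using Fm[of z f] that fK KD[of z] by (simp add: u_def)
  have "e \<in> ?K'" using KD' e by simp
  then have "e \<in> F ` ?K" using bij by (simp add: bij_betw_def)
  then obtain r where r: "r \<in> ?K" "F r = e" by blast
  have rc: "r \<in> carrier R" using r KD by blast
  have ru: "r \<otimes> u = e" using Fu r by simp
  define v where "v = e \<otimes> cmp (inv\<^bsub>G\<^esub> \<tau>) r \<otimes> f"
  have w: "cmp (inv\<^bsub>G\<^esub> \<tau>) r \<in> H (inv\<^bsub>G\<^esub> \<tau>)" using rc \<tau> by (intro H_component) simp_all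
  have wc [simp]: "cmp (inv\<^bsub>G\<^esub> \<tau>) r \<in> carrier R" using rc by simp
  have v: "v \<in> H (inv\<^bsub>G\<^esub> \<tau>)" using H_mult[OF H_mult[OF e(1) w] f(1)] \<tau> by (simp add: v_def)
  have vc [simp]: "v \<in> carrier R" using H_D[OF v] by simp
  have "cmp \<one>\<^bsub>G\<^esub> (r \<otimes> u) = cmp (inv\<^bsub>G\<^esub> \<tau>) r \<otimes> u" using component_mult_H'[OF uH rc, of "\<one>\<^bsub>G\<^esub>"] \<tau> by simp
  then have wu: "cmp (inv\<^bsub>G\<^esub> \<tau>) r \<otimes> u = e" using ru e by simp
  have vu: "v \<otimes> u = e" using fu wu e by (simp add: v_def m_assoc)
  have ev: "e \<otimes> v = v" "v \<otimes> f = v" using e f by (simp_all add: v_def m_assoc) (simp add: m_assoc[symmetric])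
  have uvK: "u \<otimes> v \<in> ?K" using KD ev by (simp add: m_assoc)
  have "F (u \<otimes> v) = u \<otimes> (v \<otimes> u)" using Fu[OF uvK] by (simp add: m_assoc)
  then have "F (u \<otimes> v) = F f" using vu ue by (simp add: u_def)
  then have "u \<otimes> v = f" using bij uvK fK unfolding bij_betw_def by (blast dest: inj_onD)
  then show ?thesis unfolding iso_idem_def using uH v vu fu ue ev by blast
qed

text \<open>The isomorphism is right multiplication by \<open>u\<close>; right multiplication by
  \<open>v\<close> inverts it.\<close>

lemma iso_idem_imp_iso:
  assumes "iso_idem f e"
  shows "\<exists>\<tau>\<in>carrier G. graded_iso G R (left_principal R f) (left_shift G (left_principal R e) \<tau>)"
proof -
  note M = regular_left_regular
  obtain g u v where uv: "u \<in> H g" "v \<in> H (inv\<^bsub>G\<^esub> g)" "u \<in> carrier R" "v \<in> carrier R" "g \<in> carrier G"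
    "u \<otimes> v = f" "v \<otimes> u = e" "f \<otimes> u = u" "u \<otimes> e = u" "e \<otimes> v = v" "v \<otimes> f = v"
    by (rule iso_idemE[OF assms])
  have c [simp]: "e \<in> carrier R" "f \<in> carrier R" using m_closed[OF uv(4,3)] m_closed[OF uv(3,4)] unfolding uv(6,7) .
  have idem: "f \<otimes> f = f" "e \<otimes> e = e"
  proof -
    have "f \<otimes> (u \<otimes> v) = (f \<otimes> u) \<otimes> v" using m_assoc[OF c(2) uv(3,4)] by simp
    then show "f \<otimes> f = f" using uv(6,8) by simp
    have "e \<otimes> (v \<otimes> u) = (e \<otimes> v) \<otimes> u" using m_assoc[OF c(1) uv(4,3)] by simp
    then show "e \<otimes> e = e" using uv(7,10) by simp
  qed
  note KD = principal_image[OF c(2) idem(1)] and KD' = principal_image[OF c(1) idem(2)]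
  let ?F = "\<lambda>z. z \<otimes> u"
  have cancel: "z \<otimes> u \<otimes> v = z" if "z \<in> carrier R" "z \<otimes> f = z" for z using that uv by (simp add: m_assoc)
  have "graded_iso G R (left_principal R f) (left_shift G (left_principal R e) g)"
  proof (rule graded_isoI[of ?F])
    show "?F \<in> graded_hom G R (left_principal R f) (left_shift G (left_principal R e) g)"
      unfolding graded_hom_def left_principal_def
    proof (intro CollectI conjI ballI)
      fix k assume k: "k \<in> carrier G"
      have "z \<otimes> u \<in> ring_part R (k \<otimes>\<^bsub>G\<^esub> g)" if "z \<in> ring_part R k" for z
        using H_mult[OF _ uv(1), of z k] that k uv(5) by (simp add: hpart_def)
      then show "?F ` mod_part (sub_gmodule (left_regular R) ((\<lambda>r. r \<otimes> f) ` carrier R)) k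
          \<subseteq> mod_part (left_shift G (sub_gmodule (left_regular R) ((\<lambda>r. r \<otimes> e) ` carrier R)) g) k"
        using KD KD' uv by (auto simp: left_shift_def sub_regular_simps[OF M] m_assoc)
    qed (use KD KD' uv in \<open>auto simp: left_shift_def sub_regular_simps[OF M] m_assoc l_distr\<close>)
    show "inj_on ?F (carrier (left_principal R f))"
      unfolding left_principal_def sub_regular_simps[OF M]
      by (rule inj_on_inverseI[of _ "\<lambda>z. z \<otimes> v"]) (use KD cancel in blast)
    fix y assume "y \<in> carrier (left_shift G (left_principal R e) g)"
    then have y: "y \<in> carrier R" "y \<otimes> e = y" using KD' by (auto simp: left_shift_def left_principal_def sub_regular_simps[OF M])
    then have "y \<otimes> v \<in> carrier (left_principal R f)" "y = ?F (y \<otimes> v)"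
      using KD uv by (auto simp: left_principal_def sub_regular_simps[OF M] m_assoc)
    then show "y \<in> ?F ` carrier (left_principal R f)" by blast
  qed
  then show ?thesis using uv(5) by blast
qed

section \<open>Principal graded indecomposable modules and injectivity\<close>

text \<open>Write \<open>f = a + b\<close> with elements \<open>a\<close>, \<open>b\<close> of
  neutral degree in the two summands. As the summands meet in zero, \<open>a\<close> and
  \<open>b\<close> are orthogonal idempotents, so one of them vanishes and \<open>f\<close> lies in
  a single summand.\<close>

lemma prim_indecomposable:
  assumes f: "prim f"
  shows "graded_indecomposable G R (sub_gmodule (left_regular R) ((\<lambda>r. r \<otimes> f) ` carrier R))"
proof -
  note M = regular_left_regular
  let ?K = "(\<lambda>r. r \<otimes> f) ` carrier R"
  have K: "gl ?K" by (rule gl_image[OF gl_carrier primD(1)[OF f]])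
  note KD = principal_image[OF primD(2,4)[OF f]] and sub = graded_submodule_sub[OF M K] sub_regular_simps[OF M]
  have fc [simp]: "f \<in> carrier R" using primD[OF f] by simp
  have fK: "f \<in> ?K" using KD primD[OF f] by simp
  have "A = {\<zero>} \<or> B = {\<zero>}"
    if A: "gl A" "A \<subseteq> ?K" and B: "gl B" "B \<subseteq> ?K" and sum: "A <+>\<^bsub>sub_gmodule (left_regular R) ?K\<^esub> B = ?K"
      and int: "A \<inter> B = {\<zero>}" for A B
  proof -
    note Ac = glD(2)[OF A(1)] and Bc = glD(2)[OF B(1)]
    have "f \<in> A <+>\<^bsub>sub_gmodule (left_regular R) ?K\<^esub> B" using sum fK by simp
    then obtain a0 b0 where ab0: "a0 \<in> A" "b0 \<in> B" "f = a0 \<oplus> b0"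
      by (auto simp: set_add_def set_mult_def sub)
    define a where "a = cmp \<one>\<^bsub>G\<^esub> a0"
    define b where "b = cmp \<one>\<^bsub>G\<^esub> b0"
    have a: "a \<in> A" "a \<in> H \<one>\<^bsub>G\<^esub>" and b: "b \<in> B" "b \<in> H \<one>\<^bsub>G\<^esub>"
      using glD(8)[OF A(1) ab0(1)] glD(8)[OF B(1) ab0(2)] H_component Ac[OF ab0(1)] Bc[OF ab0(2)]
      by (auto simp: a_def b_def)
    have c [simp]: "a \<in> carrier R" "b \<in> carrier R" using a b H_D by auto
    have "cmp \<one>\<^bsub>G\<^esub> f = a \<oplus> b"
      unfolding ab0(3) a_def b_def by (rule component_add[OF Ac[OF ab0(1)] Bc[OF ab0(2)]])
    then have fab: "f = a \<oplus> b" using primD(1)[OF f] by simp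
    have af: "a \<otimes> f = a" "b \<otimes> f = b" using a(1) b(1) A(2) B(2) KD by blast+
    \<comment> \<open>\<open>pq = p - pp\<close> lies in both summands. General \<open>P\<close> and
      \<open>Q\<close> let this serve the two summands in either order.\<close>
    have key: "p \<otimes> p = p \<and> p \<otimes> q = \<zero>"
      if P: "gl P" "p \<in> P" and Q: "gl Q" "q \<in> Q" and pq: "P \<inter> Q = {\<zero>}" "p \<otimes> (p \<oplus> q) = p" for P Q p q
    proof -
      have pc [simp]: "p \<in> carrier R" "q \<in> carrier R" using glD(2)[OF P] glD(2)[OF Q] by auto
      have "p \<otimes> p \<oplus> p \<otimes> q = p" using pq(2) by (simp add: r_distr)
      moreover have "(p \<otimes> p \<oplus> p \<otimes> q) \<ominus> p \<otimes> p = p \<otimes> q \<oplus> (p \<otimes> p \<ominus> p \<otimes> p)"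
        by (simp add: a_minus_def a_ac)
      then have "p \<otimes> q = (p \<otimes> p \<oplus> p \<otimes> q) \<ominus> p \<otimes> p" by (simp add: a_minus_def r_neg)
      ultimately have "p \<otimes> q = p \<ominus> p \<otimes> p" by simp
      also have "\<dots> \<in> P" by (rule glD(6)[OF P(1)]) (use P glD(7)[OF P(1)] in auto)
      finally have "p \<otimes> q \<in> P \<inter> Q" using glD(7)[OF Q(1) _ Q(2)] by simp
      then have "p \<otimes> q = \<zero>" using pq(1) by auto
      then show ?thesis using pq(2) by (simp add: r_distr)
    qed
    have "a \<otimes> a = a \<and> a \<otimes> b = \<zero>" using key[OF A(1) a(1) B(1) b(1) int] af(1) fab by simp
    moreover have "b \<otimes> b = b \<and> b \<otimes> a = \<zero>"
      using key[OF B(1) b(1) A(1) a(1)] int af(2) fab by (simp add: Int_commute a_comm)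
    ultimately have ab: "a = \<zero> \<or> b = \<zero>"
      using f a(2) b(2) fab unfolding primitive_idempotent_in_unit_part_def by (auto simp: hpart_def)
    have contained: "P \<subseteq> Q" if "P \<subseteq> ?K" "gl Q" "f \<in> Q" for P Q
      using that glD(7)[OF that(2)] by blast
    from ab show ?thesis
    proof
      assume "a = \<zero>"
      then have "f \<in> B" using fab b(1) by simp
      then show ?thesis using contained[OF A(2) B(1)] int by blast
    next
      assume "b = \<zero>"
      then have "f \<in> A" using fab a(1) by simp
      then show ?thesis using contained[OF B(2) A(1)] int by blast
    qed
  qed
  moreover have "?K \<noteq> {\<zero>}" using fK primD(3)[OF f] by blast
  ultimately show ?thesis unfolding graded_indecomposable_def sub by blast
qed

text \<open>A decomposition of \<open>1 - f\<close> into orthogonal primitive idempotents, together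
  with \<open>f\<close>, gives a decomposition of \<open>R\<close> with \<open>Rf\<close> as a
  summand. Hence the given representatives cover \<open>Rf\<close> for every primitive
  \<open>f\<close>.\<close>

lemma prim_principal:
  assumes f: "prim f"
  shows "principal_graded_indecomposable G R ((\<lambda>r. r \<otimes> f) ` carrier R)"
proof -
  have fc [simp]: "f \<in> carrier R" and ff [simp]: "f \<otimes> f = f" using primD[OF f] by auto
  have f1: "\<one> \<ominus> f \<in> H \<one>\<^bsub>G\<^esub>" using H_diff[OF one_H primD(1)[OF f]] .
  have f2: "(\<one> \<ominus> f) \<otimes> (\<one> \<ominus> f) = \<one> \<ominus> f"
    by (simp add: a_minus_def l_distr r_distr l_minus r_minus r_neg minus_add[symmetric])
  obtain T where T: "finite T" "\<forall>h\<in>T. prim h \<and> (\<one> \<ominus> f) \<otimes> h = h \<and> h \<otimes> (\<one> \<ominus> f) = h"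
    "\<forall>h\<in>T. \<forall>k\<in>T. h \<noteq> k \<longrightarrow> h \<otimes> k = \<zero>" "\<one> \<ominus> f = finsum R (\<lambda>f. f) T"
    using idempotent_decomposition[OF f1 f2] by (elim exE conjE) (rule that)
  have Tc: "h \<in> carrier R" if "h \<in> T" for h using T(2) primD(2) that by blast
  have fT: "f \<otimes> h = \<zero>" "h \<otimes> f = \<zero>" if h: "h \<in> T" for h
  proof -
    have "f \<otimes> h = f \<otimes> ((\<one> \<ominus> f) \<otimes> h)" using T(2) h by simp
    also have "\<dots> = \<zero>" using Tc[OF h] by (simp add: m_assoc[symmetric] a_minus_def r_distr r_minus r_neg)
    finally show "f \<otimes> h = \<zero>" .
    have "h \<otimes> f = (h \<otimes> (\<one> \<ominus> f)) \<otimes> f" using T(2) h by simp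
    also have "\<dots> = \<zero>" using Tc[OF h] by (simp add: m_assoc a_minus_def l_distr l_minus r_neg)
    finally show "h \<otimes> f = \<zero>" .
  qed
  have fnT: "f \<notin> T" using fT(1)[of f] primD(3)[OF f] by auto
  define S where "S = insert f T"
  have S: "finite S" "\<And>h. h \<in> S \<Longrightarrow> prim h" using T f by (auto simp: S_def)
  have Sc: "h \<in> carrier R" if "h \<in> S" for h using S(2) primD(2) that by blast
  have orth: "h \<otimes> k = \<zero>" if "h \<in> S" "k \<in> S" "h \<noteq> k" for h k
    using that T(3) fT by (auto simp: S_def)
  have one: "finsum R (\<lambda>f. f) S = \<one>"
  proof -
    have "finsum R (\<lambda>f. f) S = f \<oplus> (\<one> \<ominus> f)"
      unfolding S_def T(4) using T(1) fnT Tc by (subst finsum_insert) auto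
    also have "\<dots> = \<one> \<oplus> (f \<ominus> f)" by (simp add: a_minus_def a_ac)
    finally show ?thesis by (simp add: a_minus_def r_neg)
  qed
  let ?P = "\<lambda>h. (\<lambda>r. r \<otimes> h) ` carrier R"
  have PD: "z \<in> ?P h \<longleftrightarrow> z \<in> carrier R \<and> z \<otimes> h = z" if "h \<in> S" for z h
    using principal_image primD[OF S(2)[OF that]] by blast
  \<comment> \<open>The summands are indexed by themselves, so different idempotents must give
    different left ideals.\<close>
  have inj: "inj_on ?P S"
  proof (rule inj_onI, rule ccontr)
    fix h k assume hk: "h \<in> S" "k \<in> S" "?P h = ?P k" "h \<noteq> k"
    have "h \<in> ?P h" using PD[OF hk(1)] primD[OF S(2)[OF hk(1)]] by simp
    then have "h \<otimes> k = h" using hk(3) PD[OF hk(2)] by blast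
    then show False using orth[OF hk(1,2,4)] primD(3)[OF S(2)[OF hk(1)]] by simp
  qed
  let ?\<D> = "?P ` S"
  define q where "q = the_inv_into S ?P"
  have q: "q (?P h) = h" if "h \<in> S" for h unfolding q_def by (rule the_inv_into_f_f[OF inj that])
  have "internal_direct_sum R ?\<D> (\<lambda>D. D)"
    unfolding internal_direct_sum_def
  proof (intro conjI ballI ex1I)
    show "additive_subgroup D R" if "D \<in> ?\<D>" for D
      using that gl_image[OF gl_carrier primD(1)[OF S(2)]] by (auto simp: gl_iff)
  next
    fix x assume x: "x \<in> carrier R"
    define c where "c D = (if D \<in> ?\<D> then x \<otimes> q D else \<zero>)" for D
    have cP: "c (?P h) = x \<otimes> h" if "h \<in> S" for h using that q by (simp add: c_def)
    have cc: "c D \<in> carrier R" for D using cP Sc x by (cases "D \<in> ?\<D>") (auto simp: c_def q)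
    show "is_decomp R ?\<D> (\<lambda>D. D) c x"
      unfolding is_decomp_def
    proof (intro conjI ballI allI impI)
      show "c D \<in> D" if "D \<in> ?\<D>" for D using that cP x by auto
      show "c D = \<zero>" if "D \<notin> ?\<D>" for D using that by (simp add: c_def)
      have sub: "{D. c D \<noteq> \<zero>} \<subseteq> ?\<D>" by (auto simp: c_def)
      then show fin: "finite {D. c D \<noteq> \<zero>}" using S(1) by (auto intro: finite_subset)
      have "x = x \<otimes> finsum R (\<lambda>f. f) S" using one x by simp
      also have "\<dots> = finsum R (\<lambda>h. x \<otimes> h) S" using S(1) Sc x by (intro finsum_rdistr) auto
      also have "\<dots> = finsum R (\<lambda>h. c (?P h)) S" using cP Sc x by (intro finsum_cong') auto
      also have "\<dots> = finsum R c ?\<D>" using inj cc by (intro finsum_reindex[symmetric]) auto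
      also have "\<dots> = finsum R c {D. c D \<noteq> \<zero>}"
        using sub S(1) cc by (intro add.finprod_mono_neutral_cong_right) auto
      finally show "x = finsum R c {D. c D \<noteq> \<zero>}" .
    qed
    fix d assume d: "is_decomp R ?\<D> (\<lambda>D. D) d x"
    have dP: "d (?P h) \<in> ?P h" if "h \<in> S" for h using d that by (simp add: is_decomp_def)
    have dout: "d D = \<zero>" if "D \<notin> ?\<D>" for D using d that by (simp add: is_decomp_def)
    have dc: "d D \<in> carrier R" for D using dP dout PD by (cases "D \<in> ?\<D>") auto
    \<comment> \<open>Multiplying any decomposition of \<open>x\<close> by \<open>h\<close> on the
      right kills all summands but the one in \<open>Rh\<close>, by orthogonality; this gives
      uniqueness.\<close>
    have "d (?P h) = x \<otimes> h" if h: "h \<in> S" for h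
    proof -
      have sub: "{D. d D \<noteq> \<zero>} \<subseteq> ?\<D>" using dout by blast
      have "x = finsum R d {D. d D \<noteq> \<zero>}" using d by (simp add: is_decomp_def)
      also have "\<dots> = finsum R d ?\<D>" using sub S(1) dc by (intro add.finprod_mono_neutral_cong_left) auto
      also have "\<dots> = finsum R (\<lambda>k. d (?P k)) S" using inj dc by (intro finsum_reindex) auto
      finally have x': "x = finsum R (\<lambda>k. d (?P k)) S" .
      have "x \<otimes> h = finsum R (\<lambda>k. d (?P k)) S \<otimes> h" using x' by simp
      also have "\<dots> = finsum R (\<lambda>k. d (?P k) \<otimes> h) S" using S(1) dc Sc[OF h] by (intro finsum_ldistr) auto
      also have "\<dots> = finsum R (\<lambda>k. if h = k then d (?P k) else \<zero>) S"
      proof (rule finsum_cong')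
        fix k assume k: "k \<in> S"
        have dk: "d (?P k) \<otimes> k = d (?P k)" using dP[OF k] PD[OF k] by blast
        show "d (?P k) \<otimes> h = (if h = k then d (?P k) else \<zero>)"
        proof (cases "h = k")
          case False
          have "d (?P k) \<otimes> h = (d (?P k) \<otimes> k) \<otimes> h" using dk by simp
          also have "\<dots> = d (?P k) \<otimes> (k \<otimes> h)" using dc Sc k h by (simp add: m_assoc)
          finally show ?thesis using orth[OF k h] False dc by simp
        qed (use dk in simp)
      qed (use dc in auto)
      also have "\<dots> = d (?P h)" using S(1) h dc by (intro add.finprod_singleton) auto
      finally show ?thesis by simp
    qed
    then show "d = c" using cP dout by (auto simp: fun_eq_iff c_def)
  qed
  then have "internal_direct_sum (left_regular R) ?\<D> (\<lambda>D. D)"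
    by (subst internal_direct_sum_add_cong[of "left_regular R" R]) (simp_all add: left_regular_simps)
  moreover have "gl D \<and> graded_indecomposable G R (sub_gmodule (left_regular R) D)" if "D \<in> ?\<D>" for D
  proof -
    obtain h where h: "h \<in> S" "D = ?P h" using \<open>D \<in> ?\<D>\<close> by blast
    show ?thesis unfolding h(2)
      using gl_image[OF gl_carrier primD(1)[OF S(2)[OF h(1)]]] prim_indecomposable[OF S(2)[OF h(1)]] by simp
  qed
  moreover have "?P f \<in> ?\<D>" by (simp add: S_def)
  ultimately show ?thesis unfolding principal_graded_indecomposable_def
    using S(1) by (intro exI[of _ ?\<D>]) simp
qed

end

section \<open>Graded left modules and the extension property\<close>

lemma additive_map_zero:
  assumes "abelian_group M" "abelian_group N" and h: "h \<in> carrier M \<rightarrow> carrier N"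
    "\<And>x y. \<lbrakk>x \<in> carrier M; y \<in> carrier M\<rbrakk> \<Longrightarrow> h (x \<oplus>\<^bsub>M\<^esub> y) = h x \<oplus>\<^bsub>N\<^esub> h y"
  shows "h \<zero>\<^bsub>M\<^esub> = \<zero>\<^bsub>N\<^esub>"
proof -
  interpret M: abelian_group M by fact
  interpret N: abelian_group N by fact
  have "h \<zero>\<^bsub>M\<^esub> = h \<zero>\<^bsub>M\<^esub> \<oplus>\<^bsub>N\<^esub> h \<zero>\<^bsub>M\<^esub>" using h(2)[of "\<zero>\<^bsub>M\<^esub>" "\<zero>\<^bsub>M\<^esub>"] by simp
  then show ?thesis using h(1) by (metis M.zero_closed N.add.r_cancel_one' PiE)
qed

context graded_left_module
begin

sublocale mod: direct_sum M "carrier G" "mod_part M"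
  by unfold_locales (rule mod_grading)

abbreviation mcmp where "mcmp \<equiv> component M (carrier G) (mod_part M)"

lemma zero_smult:
  assumes x: "x \<in> carrier M" shows "\<zero>\<^bsub>R\<^esub> \<odot>\<^bsub>M\<^esub> x = \<zero>\<^bsub>M\<^esub>"
proof (rule additive_map_zero[where h = "\<lambda>r. r \<odot>\<^bsub>M\<^esub> x"])
  show "abelian_group R" by (rule abelian_group_axioms)
  show "abelian_group M" by (rule M.abelian_group_axioms)
qed (use x in \<open>auto simp: smult_closed smult_l_distr\<close>)

lemma minus_smult:
  assumes x: "x \<in> carrier M" shows "(\<ominus>\<^bsub>R\<^esub> \<one>\<^bsub>R\<^esub>) \<odot>\<^bsub>M\<^esub> x = \<ominus>\<^bsub>M\<^esub> x"
proof (rule M.minus_equality[symmetric])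
  have "(\<ominus>\<^bsub>R\<^esub> \<one>\<^bsub>R\<^esub>) \<odot>\<^bsub>M\<^esub> x \<oplus>\<^bsub>M\<^esub> x = (\<ominus>\<^bsub>R\<^esub> \<one>\<^bsub>R\<^esub> \<oplus>\<^bsub>R\<^esub> \<one>\<^bsub>R\<^esub>) \<odot>\<^bsub>M\<^esub> x"
    using x by (simp add: smult_l_distr smult_one)
  then show "(\<ominus>\<^bsub>R\<^esub> \<one>\<^bsub>R\<^esub>) \<odot>\<^bsub>M\<^esub> x \<oplus>\<^bsub>M\<^esub> x = \<zero>\<^bsub>M\<^esub>" using x by (simp add: l_neg zero_smult)
qed (use x in \<open>simp_all add: smult_closed\<close>)

lemma component_smult:
  assumes x: "x \<in> mod_part M g" "g \<in> carrier G" and r: "r \<in> carrier R" and k: "k \<in> carrier G"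
  shows "mcmp k (r \<odot>\<^bsub>M\<^esub> x) = cmp (k \<otimes>\<^bsub>G\<^esub> inv\<^bsub>G\<^esub> g) r \<odot>\<^bsub>M\<^esub> x"
proof -
  have xc: "x \<in> carrier M" using mod.part_closed(4)[OF x(2,1)] .
  have "mcmp (k \<otimes>\<^bsub>G\<^esub> inv\<^bsub>G\<^esub> g \<otimes>\<^bsub>G\<^esub> g) (r \<odot>\<^bsub>M\<^esub> x) = cmp (k \<otimes>\<^bsub>G\<^esub> inv\<^bsub>G\<^esub> g) r \<odot>\<^bsub>M\<^esub> x"
  proof (rule component_additive_map[where h = "\<lambda>r. r \<odot>\<^bsub>M\<^esub> x" and p = "\<lambda>h. h \<otimes>\<^bsub>G\<^esub> g"])
    show "direct_sum R (carrier G) (ring_part R)" by (rule direct_sum_axioms)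
    show "direct_sum M (carrier G) (mod_part M)" by (rule mod.direct_sum_axioms)
    show "inj_on (\<lambda>h. h \<otimes>\<^bsub>G\<^esub> g) (carrier G)" using x by (intro inj_onI) simp
  qed (use x xc r k in \<open>auto simp: smult_closed smult_l_distr smult_mod_part\<close>)
  then show ?thesis using x k by (simp add: G.m_assoc)
qed

end

lemma (in graded_ring) graded_left_module_left_regular: "graded_left_module G R (left_regular R)"
proof -
  have "abelian_group (left_regular R)"
  proof (rule abelian_groupI)
    fix x assume "x \<in> carrier (left_regular R)"
    then show "\<exists>y\<in>carrier (left_regular R). y \<oplus>\<^bsub>left_regular R\<^esub> x = \<zero>\<^bsub>left_regular R\<^esub>"
      by (intro bexI[of _ "\<ominus> x"]) (auto simp: left_regular_simps l_neg)
  qed (auto simp: left_regular_simps a_ac)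
  then have "left_module R (left_regular R)"
    by (intro left_module.intro left_module_axioms.intro ring_axioms)
      (auto simp: left_regular_simps l_distr r_distr m_assoc)
  moreover have "internal_direct_sum (left_regular R) (carrier G) (ring_part R)"
    using ring_grading by (subst internal_direct_sum_add_cong[of "left_regular R" R]) (simp_all add: left_regular_simps)
  ultimately show ?thesis
    by (intro graded_left_module.intro graded_left_module_axioms.intro graded_ring_axioms)
      (auto simp: left_regular_simps ring_part_mult)
qed

context graded_artinian_ring
begin

text \<open>Baer's criterion: partial extensions are represented by their graphs, and a maximal one is
  defined everywhere.\<close>

lemma baer_imp_extension:
  fixes M N :: "('a, 'm, 'g) gmodule"
  assumes B: baer and M: "graded_left_module G R M" and N: "graded_left_module G R N"
    and i: "i \<in> graded_hom G R M N" "inj_on i (carrier M)" and f: "f \<in> graded_hom G R M (left_regular R)"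
  shows "\<exists>h\<in>graded_hom G R N (left_regular R). \<forall>x\<in>carrier M. h (i x) = f x"
proof -
  interpret M: graded_left_module G R M by fact
  interpret N: graded_left_module G R N by fact
  note iD = graded_homD[OF i(1)] and fD = graded_homD[OF f, unfolded left_regular_simps]
  have i0: "i \<zero>\<^bsub>M\<^esub> = \<zero>\<^bsub>N\<^esub>"
    by (rule additive_map_zero[OF M.M.abelian_group_axioms N.M.abelian_group_axioms]) (use iD in auto)
  have f0: "f \<zero>\<^bsub>M\<^esub> = \<zero>"
    by (rule additive_map_zero[OF M.M.abelian_group_axioms abelian_group_axioms]) (use fD in auto)
  \<comment> \<open>\<open>P\<close> is the graph of a graded linear partial map extending
    \<open>f\<close> along \<open>i\<close>. Single-valuedness is required at zero only, as such
    graphs are closed under differences.\<close>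
  define pg where "pg P \<longleftrightarrow> P \<subseteq> carrier N \<times> carrier R \<and> (\<forall>m\<in>carrier M. (i m, f m) \<in> P) \<and>
     (\<forall>n y n' y'. (n, y) \<in> P \<longrightarrow> (n', y') \<in> P \<longrightarrow> (n \<oplus>\<^bsub>N\<^esub> n', y \<oplus> y') \<in> P) \<and>
     (\<forall>r\<in>carrier R. \<forall>n y. (n, y) \<in> P \<longrightarrow> (r \<odot>\<^bsub>N\<^esub> n, r \<otimes> y) \<in> P) \<and>
     (\<forall>g\<in>carrier G. \<forall>n y. (n, y) \<in> P \<longrightarrow> (N.mcmp g n, cmp g y) \<in> P) \<and>
     (\<forall>y. (\<zero>\<^bsub>N\<^esub>, y) \<in> P \<longrightarrow> y = \<zero>)" for P
  have pgD: "P \<subseteq> carrier N \<times> carrier R" "m \<in> carrier M \<Longrightarrow> (i m, f m) \<in> P"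
    "(n, y) \<in> P \<Longrightarrow> (n', y') \<in> P \<Longrightarrow> (n \<oplus>\<^bsub>N\<^esub> n', y \<oplus> y') \<in> P"
    "r \<in> carrier R \<Longrightarrow> (n, y) \<in> P \<Longrightarrow> (r \<odot>\<^bsub>N\<^esub> n, r \<otimes> y) \<in> P"
    "g \<in> carrier G \<Longrightarrow> (n, y) \<in> P \<Longrightarrow> (N.mcmp g n, cmp g y) \<in> P"
    "(\<zero>\<^bsub>N\<^esub>, y) \<in> P \<Longrightarrow> y = \<zero>" "(n, y) \<in> P \<Longrightarrow> n \<in> carrier N" "(n, y) \<in> P \<Longrightarrow> y \<in> carrier R"
    if "pg P" for P m n y n' y' r g
  proof -
    have *: "P \<subseteq> carrier N \<times> carrier R" "\<forall>m\<in>carrier M. (i m, f m) \<in> P"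
      "\<forall>n y n' y'. (n, y) \<in> P \<longrightarrow> (n', y') \<in> P \<longrightarrow> (n \<oplus>\<^bsub>N\<^esub> n', y \<oplus> y') \<in> P"
      "\<forall>r\<in>carrier R. \<forall>n y. (n, y) \<in> P \<longrightarrow> (r \<odot>\<^bsub>N\<^esub> n, r \<otimes> y) \<in> P"
      "\<forall>g\<in>carrier G. \<forall>n y. (n, y) \<in> P \<longrightarrow> (N.mcmp g n, cmp g y) \<in> P"
      "\<forall>y. (\<zero>\<^bsub>N\<^esub>, y) \<in> P \<longrightarrow> y = \<zero>"
      using that unfolding pg_def by - (elim conjE, assumption)+
    show "P \<subseteq> carrier N \<times> carrier R" by (rule *(1))
    show "m \<in> carrier M \<Longrightarrow> (i m, f m) \<in> P" using *(2) by blast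
    show "(n, y) \<in> P \<Longrightarrow> (n', y') \<in> P \<Longrightarrow> (n \<oplus>\<^bsub>N\<^esub> n', y \<oplus> y') \<in> P" using *(3) by blast
    show "r \<in> carrier R \<Longrightarrow> (n, y) \<in> P \<Longrightarrow> (r \<odot>\<^bsub>N\<^esub> n, r \<otimes> y) \<in> P" using *(4) by blast
    show "g \<in> carrier G \<Longrightarrow> (n, y) \<in> P \<Longrightarrow> (N.mcmp g n, cmp g y) \<in> P" using *(5) by blast
    show "(\<zero>\<^bsub>N\<^esub>, y) \<in> P \<Longrightarrow> y = \<zero>" using *(6) by blast
    show "(n, y) \<in> P \<Longrightarrow> n \<in> carrier N" "(n, y) \<in> P \<Longrightarrow> y \<in> carrier R" using *(1) by auto
  qed
  let ?base = "(\<lambda>m. (i m, f m)) ` carrier M"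
  have "pg ?base"
    unfolding pg_def
  proof (intro conjI allI impI ballI)
    show "?base \<subseteq> carrier N \<times> carrier R" using iD fD by auto
    show "(i m, f m) \<in> ?base" if "m \<in> carrier M" for m using that by blast
    show "(n \<oplus>\<^bsub>N\<^esub> n', y \<oplus> y') \<in> ?base" if ny: "(n, y) \<in> ?base" "(n', y') \<in> ?base" for n y n' y'
    proof -
      obtain m m' where "m \<in> carrier M" "m' \<in> carrier M" "n = i m" "y = f m" "n' = i m'" "y' = f m'" using ny by blast
      then show ?thesis using iD(2) fD(2) by (intro image_eqI[of _ _ "m \<oplus>\<^bsub>M\<^esub> m'"]) auto
    qed
    show "(r \<odot>\<^bsub>N\<^esub> n, r \<otimes> y) \<in> ?base" if r: "r \<in> carrier R" and ny: "(n, y) \<in> ?base" for r n y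
    proof -
      obtain m where "m \<in> carrier M" "n = i m" "y = f m" using ny by blast
      then show ?thesis using iD(3) fD(3) r M.smult_closed by (intro image_eqI[of _ _ "r \<odot>\<^bsub>M\<^esub> m"]) auto
    qed
    show "(N.mcmp g n, cmp g y) \<in> ?base" if g: "g \<in> carrier G" and ny: "(n, y) \<in> ?base" for g n y
    proof -
      obtain m where m: "m \<in> carrier M" "n = i m" "y = f m" using ny by blast
      have "N.mcmp (id g) (i m) = i (M.mcmp g m)"
        by (rule component_additive_map[OF M.mod.direct_sum_axioms N.mod.direct_sum_axioms])
          (use iD m g in auto)
      moreover have "cmp (id g) (f m) = f (M.mcmp g m)"
        by (rule component_additive_map[OF M.mod.direct_sum_axioms direct_sum_axioms])
          (use fD m g in auto)
      ultimately show ?thesis using m by (intro image_eqI[of _ _ "M.mcmp g m"]) auto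
    qed
    show "y = \<zero>" if y: "(\<zero>\<^bsub>N\<^esub>, y) \<in> ?base" for y
    proof -
      obtain m where m: "m \<in> carrier M" "i m = \<zero>\<^bsub>N\<^esub>" "y = f m" using y by auto
      then have "m = \<zero>\<^bsub>M\<^esub>" using inj_onD[OF i(2), of m "\<zero>\<^bsub>M\<^esub>"] i0 by simp
      then show ?thesis using m f0 by simp
    qed
  qed
  have "\<exists>P\<in>{P. pg P}. \<forall>Q\<in>{P. pg P}. P \<subseteq> Q \<longrightarrow> Q = P"
  proof (rule subset_Zorn_nonempty)
    show "{P. pg P} \<noteq> {}" using \<open>pg ?base\<close> by blast
    fix C assume C: "C \<noteq> {}" "subset.chain {P. pg P} C"
    then have p: "pg P" if "P \<in> C" for P using that by (auto simp: subset_chain_def)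
    have "pg (\<Union>C)"
      unfolding pg_def
    proof (intro conjI allI impI ballI)
      show "\<Union>C \<subseteq> carrier N \<times> carrier R" using pgD(1)[OF p] by blast
      show "(i m, f m) \<in> \<Union>C" if "m \<in> carrier M" for m using pgD(2)[OF p that] C(1) by blast
      show "(n \<oplus>\<^bsub>N\<^esub> n', y \<oplus> y') \<in> \<Union>C" if ny: "(n, y) \<in> \<Union>C" "(n', y') \<in> \<Union>C" for n y n' y'
      proof -
        obtain P Q where PQ: "P \<in> C" "Q \<in> C" "(n, y) \<in> P" "(n', y') \<in> Q" using ny by blast
        then have "P \<subseteq> Q \<or> Q \<subseteq> P" using C(2) by (auto simp: subset_chain_def)
        then show ?thesis
        proof
          assume "P \<subseteq> Q"
          then have "(n \<oplus>\<^bsub>N\<^esub> n', y \<oplus> y') \<in> Q" using PQ by (intro pgD(3)[OF p]) auto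
          then show ?thesis using PQ(2) by blast
        next
          assume "Q \<subseteq> P"
          then have "(n \<oplus>\<^bsub>N\<^esub> n', y \<oplus> y') \<in> P" using PQ by (intro pgD(3)[OF p]) auto
          then show ?thesis using PQ(1) by blast
        qed
      qed
      show "(r \<odot>\<^bsub>N\<^esub> n, r \<otimes> y) \<in> \<Union>C" if "r \<in> carrier R" "(n, y) \<in> \<Union>C" for r n y
        using pgD(4)[OF p that(1)] that(2) by blast
      show "(N.mcmp g n, cmp g y) \<in> \<Union>C" if "g \<in> carrier G" "(n, y) \<in> \<Union>C" for g n y
        using pgD(5)[OF p that(1)] that(2) by blast
      show "y = \<zero>" if "(\<zero>\<^bsub>N\<^esub>, y) \<in> \<Union>C" for y using pgD(6)[OF p] that by blast
    qed
    then show "\<Union>C \<in> {P. pg P}" by simp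
  qed
  then obtain P where "P \<in> {P. pg P}" and Pmax: "\<forall>Q\<in>{P. pg P}. P \<subseteq> Q \<longrightarrow> Q = P" by (rule bexE)
  then have P: "pg P" by simp
  note PD = pgD[OF P]
  have functional: "y = y'" if "(n, y) \<in> P" "(n, y') \<in> P" for n y y'
  proof -
    have c: "n \<in> carrier N" "y \<in> carrier R" "y' \<in> carrier R" using PD(7,8) that by auto
    have "((\<ominus> \<one>) \<odot>\<^bsub>N\<^esub> n, (\<ominus> \<one>) \<otimes> y') \<in> P" using that by (intro PD(4)) auto
    then have "(n \<oplus>\<^bsub>N\<^esub> (\<ominus> \<one>) \<odot>\<^bsub>N\<^esub> n, y \<oplus> (\<ominus> \<one>) \<otimes> y') \<in> P" by (rule PD(3)[OF that(1)])
    then have "(\<zero>\<^bsub>N\<^esub>, y \<oplus> (\<ominus> \<one>) \<otimes> y') \<in> P" using c by (simp add: N.minus_smult N.M.r_neg)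
    then have "y \<ominus> y' = \<zero>" using PD(6) c by (simp add: l_minus a_minus_def)
    then show ?thesis using c by (simp add: r_right_minus_eq)
  qed
  \<comment> \<open>For homogeneous \<open>x\<close> outside the domain, let \<open>I\<close>
    consist of the \<open>r\<close> with \<open>rx\<close> in the domain. Sending \<open>r\<close>
    to the value at \<open>rx\<close> is a map of degree \<open>g\<close> on \<open>I\<close>;
    Baer's criterion gives \<open>y0\<close>, the value to be assigned to \<open>x\<close>.\<close>
  have total_hom: "\<exists>y. (x, y) \<in> P" if x: "x \<in> mod_part N g" "g \<in> carrier G" for x g
  proof (rule ccontr)
    assume nx: "\<nexists>y. (x, y) \<in> P"
    have xc: "x \<in> carrier N" using N.mod.part_closed(4)[OF x(2,1)] .
    define I where "I = {r \<in> carrier R. \<exists>y. (r \<odot>\<^bsub>N\<^esub> x, y) \<in> P}"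
    have "(i \<zero>\<^bsub>M\<^esub>, f \<zero>\<^bsub>M\<^esub>) \<in> P" by (rule PD(2)) simp
    then have P0: "(\<zero>\<^bsub>N\<^esub>, \<zero>) \<in> P" using i0 f0 by simp
    have I: "gl I"
    proof (rule glI)
      show "I \<subseteq> carrier R" by (auto simp: I_def)
      show "\<zero> \<in> I" using P0 xc by (auto simp: I_def N.zero_smult)
      show "r \<oplus> s \<in> I" if "r \<in> I" "s \<in> I" for r s
        using that PD(3) xc by (fastforce simp: I_def N.smult_l_distr)
      show "s \<otimes> r \<in> I" if "s \<in> carrier R" "r \<in> I" for s r
        using that PD(4)[OF that(1)] xc by (fastforce simp: I_def N.smult_assoc)
      show "cmp k r \<in> I" if r: "r \<in> I" and k: "k \<in> carrier G" for r k
      proof -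
        obtain y where y: "r \<in> carrier R" "(r \<odot>\<^bsub>N\<^esub> x, y) \<in> P" using r by (auto simp: I_def)
        have "(N.mcmp (k \<otimes>\<^bsub>G\<^esub> g) (r \<odot>\<^bsub>N\<^esub> x), cmp (k \<otimes>\<^bsub>G\<^esub> g) y) \<in> P" using k x y by (intro PD(5)) auto
        then have "(cmp k r \<odot>\<^bsub>N\<^esub> x, cmp (k \<otimes>\<^bsub>G\<^esub> g) y) \<in> P"
          using N.component_smult[OF x y(1), of "k \<otimes>\<^bsub>G\<^esub> g"] k x by (simp add: G.m_assoc)
        then show ?thesis using y by (auto simp: I_def)
      qed
    qed
    define \<phi> where "\<phi> r = (THE y. (r \<odot>\<^bsub>N\<^esub> x, y) \<in> P)" for r
    have \<phi>: "\<phi> r = y" if "(r \<odot>\<^bsub>N\<^esub> x, y) \<in> P" for r y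
      unfolding \<phi>_def by (rule the_equality, rule that) (rule functional[OF _ that])
    have \<phi>P: "(r \<odot>\<^bsub>N\<^esub> x, \<phi> r) \<in> P" if "r \<in> I" for r using that \<phi> by (auto simp: I_def)
    have Ic: "r \<in> carrier R" if "r \<in> I" for r using that by (simp add: I_def)
    obtain y0 where y0: "y0 \<in> H g" "\<And>r. r \<in> I \<Longrightarrow> \<phi> r = r \<otimes> y0"
    proof (rule baerD[OF B I x(2), of \<phi>])
      show "\<phi> r \<in> carrier R" if "r \<in> I" for r using PD(8)[OF \<phi>P[OF that]] .
      show "\<phi> (r \<oplus> s) = \<phi> r \<oplus> \<phi> s" if "r \<in> I" "s \<in> I" for r s
        using PD(3)[OF \<phi>P[OF \<open>r \<in> I\<close>] \<phi>P[OF \<open>s \<in> I\<close>]] that xc Ic by (intro \<phi>) (simp add: N.smult_l_distr)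
      show "\<phi> (s \<otimes> r) = s \<otimes> \<phi> r" if "s \<in> carrier R" "r \<in> I" for s r
        using PD(4)[OF \<open>s \<in> carrier R\<close> \<phi>P[OF \<open>r \<in> I\<close>]] that xc Ic by (intro \<phi>) (simp add: N.smult_assoc)
      show "\<phi> r \<in> H (a \<otimes>\<^bsub>G\<^esub> g)" if r: "r \<in> I" "r \<in> H a" for r a
      proof -
        have a: "a \<in> carrier G" using H_D[OF r(2)] by simp
        have "(N.mcmp (a \<otimes>\<^bsub>G\<^esub> g) (r \<odot>\<^bsub>N\<^esub> x), cmp (a \<otimes>\<^bsub>G\<^esub> g) (\<phi> r)) \<in> P"
          using a x \<phi>P[OF r(1)] by (intro PD(5)) auto
        then have "(r \<odot>\<^bsub>N\<^esub> x, cmp (a \<otimes>\<^bsub>G\<^esub> g) (\<phi> r)) \<in> P"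
          using N.component_smult[OF x Ic[OF r(1)], of "a \<otimes>\<^bsub>G\<^esub> g"] a x r(2) by (simp add: G.m_assoc)
        then have "\<phi> r = cmp (a \<otimes>\<^bsub>G\<^esub> g) (\<phi> r)" by (rule \<phi>)
        then show ?thesis using H_component[OF PD(8)[OF \<phi>P[OF r(1)]], of "a \<otimes>\<^bsub>G\<^esub> g"] a x by simp
      qed
    qed blast
    have y0c [simp]: "y0 \<in> carrier R" using H_D[OF y0(1)] by simp
    let ?Q = "{(n \<oplus>\<^bsub>N\<^esub> r \<odot>\<^bsub>N\<^esub> x, m \<oplus> r \<otimes> y0) | n m r. (n, m) \<in> P \<and> r \<in> carrier R}"
    have QI: "(n \<oplus>\<^bsub>N\<^esub> r \<odot>\<^bsub>N\<^esub> x, m \<oplus> r \<otimes> y0) \<in> ?Q" if "(n, m) \<in> P" "r \<in> carrier R" for n m r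
      using that by blast
    have sub: "P \<subseteq> ?Q"
    proof (rule subrelI)
      fix n m assume nm: "(n, m) \<in> P"
      then show "(n, m) \<in> ?Q"
        using QI[OF nm zero_closed] xc PD(7,8)[OF nm] by (simp add: N.zero_smult)
    qed
    have "pg ?Q"
      unfolding pg_def
    proof (intro conjI allI impI ballI)
      show "?Q \<subseteq> carrier N \<times> carrier R" using PD(7,8) xc N.smult_closed by auto
      show "(i m, f m) \<in> ?Q" if "m \<in> carrier M" for m using sub PD(2)[OF that] by blast
    next
      fix n y n' y' assume "(n, y) \<in> ?Q" "(n', y') \<in> ?Q"
      then obtain p m r p' m' r' where *: "(p, m) \<in> P" "r \<in> carrier R" "n = p \<oplus>\<^bsub>N\<^esub> r \<odot>\<^bsub>N\<^esub> x" "y = m \<oplus> r \<otimes> y0"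
        "(p', m') \<in> P" "r' \<in> carrier R" "n' = p' \<oplus>\<^bsub>N\<^esub> r' \<odot>\<^bsub>N\<^esub> x" "y' = m' \<oplus> r' \<otimes> y0" by blast
      have "n \<oplus>\<^bsub>N\<^esub> n' = (p \<oplus>\<^bsub>N\<^esub> p') \<oplus>\<^bsub>N\<^esub> (r \<oplus> r') \<odot>\<^bsub>N\<^esub> x"
        using * PD(7)[OF *(1)] PD(7)[OF *(5)] xc by (simp add: N.smult_l_distr N.smult_closed N.M.a_ac)
      moreover have "y \<oplus> y' = (m \<oplus> m') \<oplus> (r \<oplus> r') \<otimes> y0"
        using * PD(8)[OF *(1)] PD(8)[OF *(5)] by (simp add: l_distr a_ac)
      ultimately show "(n \<oplus>\<^bsub>N\<^esub> n', y \<oplus> y') \<in> ?Q" using QI[OF PD(3)[OF *(1,5)], of "r \<oplus> r'"] *(2,6) by simp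
    next
      fix s n y assume s: "s \<in> carrier R" and "(n, y) \<in> ?Q"
      then obtain p m r where *: "(p, m) \<in> P" "r \<in> carrier R" "n = p \<oplus>\<^bsub>N\<^esub> r \<odot>\<^bsub>N\<^esub> x" "y = m \<oplus> r \<otimes> y0" by blast
      have "s \<odot>\<^bsub>N\<^esub> n = s \<odot>\<^bsub>N\<^esub> p \<oplus>\<^bsub>N\<^esub> (s \<otimes> r) \<odot>\<^bsub>N\<^esub> x"
        using * s PD(7)[OF *(1)] xc by (simp add: N.smult_r_distr N.smult_closed N.smult_assoc)
      moreover have "s \<otimes> y = s \<otimes> m \<oplus> (s \<otimes> r) \<otimes> y0"
        using * s PD(8)[OF *(1)] by (simp add: r_distr m_assoc)
      ultimately show "(s \<odot>\<^bsub>N\<^esub> n, s \<otimes> y) \<in> ?Q" using QI[OF PD(4)[OF s *(1)], of "s \<otimes> r"] s *(2) by simp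
    next
      fix k n y assume k: "k \<in> carrier G" and "(n, y) \<in> ?Q"
      then obtain p m r where *: "(p, m) \<in> P" "r \<in> carrier R" "n = p \<oplus>\<^bsub>N\<^esub> r \<odot>\<^bsub>N\<^esub> x" "y = m \<oplus> r \<otimes> y0" by blast
      let ?r = "cmp (k \<otimes>\<^bsub>G\<^esub> inv\<^bsub>G\<^esub> g) r"
      have "N.mcmp k n = N.mcmp k p \<oplus>\<^bsub>N\<^esub> ?r \<odot>\<^bsub>N\<^esub> x"
        using * k PD(7)[OF *(1)] xc by (simp add: N.mod.component_add N.smult_closed N.component_smult[OF x])
      moreover have "cmp k y = cmp k m \<oplus> ?r \<otimes> y0"
        using * k PD(8)[OF *(1)] by (simp add: component_add component_mult_H'[OF y0(1)])
      ultimately show "(N.mcmp k n, cmp k y) \<in> ?Q" using QI[OF PD(5)[OF k *(1)], of ?r] *(2) by simp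
    next
      \<comment> \<open>If \<open>p + rx = 0\<close>, then \<open>rx = - p\<close> is in the domain,
        with value \<open>- m\<close>. So \<open>r\<close> lies in \<open>I\<close> and
        \<open>r y0 = - m\<close>: the new value is compatible with the old ones.\<close>
      fix y assume "(\<zero>\<^bsub>N\<^esub>, y) \<in> ?Q"
      then obtain p m r where *: "(p, m) \<in> P" "r \<in> carrier R" "\<zero>\<^bsub>N\<^esub> = p \<oplus>\<^bsub>N\<^esub> r \<odot>\<^bsub>N\<^esub> x" "y = m \<oplus> r \<otimes> y0" by blast
      have c: "p \<in> carrier N" "m \<in> carrier R" "r \<odot>\<^bsub>N\<^esub> x \<in> carrier N"
        using PD(7,8)[OF *(1)] *(2) xc N.smult_closed by auto
      have "((\<ominus> \<one>) \<odot>\<^bsub>N\<^esub> p, (\<ominus> \<one>) \<otimes> m) \<in> P" by (rule PD(4)[OF _ *(1)]) simp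
      then have "(\<ominus>\<^bsub>N\<^esub> p, \<ominus> m) \<in> P" using c by (simp add: N.minus_smult l_minus)
      moreover have "\<ominus>\<^bsub>N\<^esub> p = r \<odot>\<^bsub>N\<^esub> x"
        using N.M.minus_equality[of "r \<odot>\<^bsub>N\<^esub> x" p] c *(3) by (simp add: N.M.a_comm)
      ultimately have rP: "(r \<odot>\<^bsub>N\<^esub> x, \<ominus> m) \<in> P" by simp
      then have "r \<in> I" using *(2) by (auto simp: I_def)
      then have "r \<otimes> y0 = \<ominus> m" using \<phi>[OF rP] y0(2) by simp
      then show "y = \<zero>" using *(4) c by (simp add: r_neg)
    qed
    then have "?Q = P" by (intro Pmax[rule_format] CollectI sub)
    moreover have "(x, y0) \<in> ?Q" using QI[OF P0 one_closed] xc by (simp add: N.smult_one)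
    ultimately show False using nx by blast
  qed
  have total: "\<exists>y. (x, y) \<in> P" if "x \<in> carrier N" for x
    using that
  proof (induction rule: N.mod.homogeneous_induct)
    case zero
    have "(i \<zero>\<^bsub>M\<^esub>, f \<zero>\<^bsub>M\<^esub>) \<in> P" by (rule PD(2)) simp
    then show ?case using i0 by auto
  next
    case (homogeneous g y) then show ?case using total_hom by blast
  next
    case (add y z) then show ?case using PD(3) by blast
  qed
  define h where "h x = (THE y. (x, y) \<in> P)" for x
  have h: "h x = y" if "(x, y) \<in> P" for x y
    unfolding h_def by (rule the_equality, rule that) (rule functional[OF _ that])
  have hP: "(x, h x) \<in> P" if "x \<in> carrier N" for x using total[OF that] h by auto
  have "h \<in> graded_hom G R N (left_regular R)"
    unfolding graded_hom_def left_regular_simps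
  proof (intro CollectI conjI ballI)
    show "h \<in> carrier N \<rightarrow> carrier R" using PD(8)[OF hP] by blast
    show "h (x \<oplus>\<^bsub>N\<^esub> y) = h x \<oplus> h y" if "x \<in> carrier N" "y \<in> carrier N" for x y
      by (rule h, rule PD(3)[OF hP hP]) (use that in auto)
    show "h (r \<odot>\<^bsub>N\<^esub> x) = r \<otimes> h x" if "r \<in> carrier R" "x \<in> carrier N" for r x
      by (rule h, rule PD(4)[OF that(1) hP[OF that(2)]])
    fix g assume g: "g \<in> carrier G"
    show "h ` mod_part N g \<subseteq> ring_part R g"
    proof
      fix y assume "y \<in> h ` mod_part N g"
      then obtain x where x: "x \<in> mod_part N g" "y = h x" by blast
      have xc: "x \<in> carrier N" using N.mod.part_closed(4)[OF g x(1)] .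
      have "(N.mcmp g x, cmp g (h x)) \<in> P" by (rule PD(5)[OF g hP[OF xc]])
      then have "(x, cmp g (h x)) \<in> P" using N.mod.component_homogeneous[OF g x(1)] by simp
      then have "h x = cmp g (h x)" by (rule h)
      then show "y \<in> ring_part R g" using component_in[OF g PD(8)[OF hP[OF xc]]] x(2) by simp
    qed
  qed
  moreover have "\<forall>x\<in>carrier M. h (i x) = f x" using h PD(2) by blast
  ultimately show ?thesis by blast
qed

text \<open>A copy of the shift \<open>I(g\<^sup>-\<^sup>1)\<close> of a graded left ideal inside the test type. The
  shift turns maps \<open>I \<rightarrow> R\<close> of degree \<open>g\<close> into degree-preserving ones.\<close>

definition shifted_copy :: "'a set \<Rightarrow> 'g \<Rightarrow> ('a, 'a + 'u, 'g) gmodule" where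
  "shifted_copy I g = \<lparr>carrier = Inl ` I, monoid.mult = undefined, one = undefined, ring.zero = Inl \<zero>,
     ring.add = (\<lambda>x y. Inl (projl x \<oplus> projl y)), smult = (\<lambda>r x. Inl (r \<otimes> projl x)),
     mod_part = (\<lambda>h. Inl ` (ring_part R (h \<otimes>\<^bsub>G\<^esub> inv\<^bsub>G\<^esub> g) \<inter> I))\<rparr>"

lemma shifted_copy_simps [simp]:
  "carrier (shifted_copy I g) = Inl ` I" "\<zero>\<^bsub>shifted_copy I g\<^esub> = Inl \<zero>"
  "x \<oplus>\<^bsub>shifted_copy I g\<^esub> y = Inl (projl x \<oplus> projl y)" "r \<odot>\<^bsub>shifted_copy I g\<^esub> x = Inl (r \<otimes> projl x)"
  "mod_part (shifted_copy I g) h = Inl ` (ring_part R (h \<otimes>\<^bsub>G\<^esub> inv\<^bsub>G\<^esub> g) \<inter> I)"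
  by (simp_all add: shifted_copy_def)

text \<open>The grading is moved along the translation \<open>k |-> k g\<close> of the group; the
  work lies in identifying decompositions in the copy with those in \<open>R\<close>.\<close>

lemma graded_left_module_shifted_copy:
  assumes I: "gl I" and g: "g \<in> carrier G"
  shows "graded_left_module G R (shifted_copy I g :: ('a, 'a + 'u, 'g) gmodule)"
proof -
  let ?M = "shifted_copy I g :: ('a, 'a + 'u, 'g) gmodule"
  note Ic [simp] = glD(2)[OF I]
  interpret M: abelian_group ?M
  proof (rule abelian_groupI)
    show "\<exists>y\<in>carrier ?M. y \<oplus>\<^bsub>?M\<^esub> x = \<zero>\<^bsub>?M\<^esub>" if "x \<in> carrier ?M" for x
    proof -
      obtain a where "a \<in> I" "x = Inl a" using \<open>x \<in> carrier ?M\<close> by auto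
      then show ?thesis using glD(5)[OF I] by (intro bexI[of _ "Inl (\<ominus> a)"]) (auto simp: l_neg)
    qed
  qed (use glD(3,4)[OF I] in \<open>auto simp: a_ac\<close>)
  have left: "left_module R ?M"
    by (intro left_module.intro left_module_axioms.intro ring_axioms M.abelian_group_axioms)
      (use glD(7)[OF I] in \<open>auto simp: l_distr r_distr m_assoc\<close>)
  have minus: "\<ominus>\<^bsub>?M\<^esub> (Inl x) = Inl (\<ominus> x)" if "x \<in> I" for x
    using that glD(5)[OF I] by (intro M.minus_equality) (auto simp: l_neg)
  have finsum: "finsum ?M (\<lambda>h. Inl (f h)) A = Inl (finsum R f A)" if "finite A" "f \<in> A \<rightarrow> I" for f A
    using that
  proof (induction A rule: finite_induct)
    case (insert a A)
    then have *: "f \<in> A \<rightarrow> I" "f a \<in> I" by auto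
    then have "f \<in> A \<rightarrow> carrier R" "f a \<in> carrier R" "(\<lambda>h. Inl (f h)) \<in> A \<rightarrow> carrier ?M"
      using glD(1)[OF I] by auto
    then show ?case using insert by (simp add: M.finsum_insert finsum_insert)
  qed (simp add: M.finsum_empty)
  \<comment> \<open>Outside the group the value is set to zero explicitly, because the product of
    \<open>h\<close> and \<open>inv g\<close> is unspecified there.\<close>
  have decomp: "is_decomp ?M (carrier G) (mod_part ?M) c (Inl x) \<longleftrightarrow>
      c = (\<lambda>h. Inl (if h \<in> carrier G then cmp (h \<otimes>\<^bsub>G\<^esub> inv\<^bsub>G\<^esub> g) x else \<zero>))"
    (is "_ \<longleftrightarrow> c = ?c") if x: "x \<in> I" for x c
  proof
    have cI: "cmp h x \<in> I" for h
      using glD(3,8)[OF I] x component_outside[OF Ic[OF x]] by (cases "h \<in> carrier G") auto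
    let ?d = "\<lambda>h. if h \<in> carrier G then cmp (h \<otimes>\<^bsub>G\<^esub> inv\<^bsub>G\<^esub> g) x else \<zero>"
    assume "c = ?c"
    moreover have "is_decomp ?M (carrier G) (mod_part ?M) ?c (Inl x)"
      unfolding is_decomp_def
    proof (intro conjI ballI allI impI)
      show "?c h \<in> mod_part ?M h" if "h \<in> carrier G" for h
        using that g x cI component_in[of "h \<otimes>\<^bsub>G\<^esub> inv\<^bsub>G\<^esub> g" x] by auto
      show "?c h = \<zero>\<^bsub>?M\<^esub>" if "h \<notin> carrier G" for h using that by simp
      let ?S = "{k. cmp k x \<noteq> \<zero>}"
      have SG: "?S \<subseteq> carrier G" using component_outside[OF Ic[OF x]] by blast
      have supp: "{h. ?c h \<noteq> \<zero>\<^bsub>?M\<^esub>} = (\<lambda>k. k \<otimes>\<^bsub>G\<^esub> g) ` ?S"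
      proof (intro equalityI subsetI)
        fix h assume "h \<in> {h. ?c h \<noteq> \<zero>\<^bsub>?M\<^esub>}"
        then have "h \<in> carrier G" "cmp (h \<otimes>\<^bsub>G\<^esub> inv\<^bsub>G\<^esub> g) x \<noteq> \<zero>" by (auto split: if_splits)
        then show "h \<in> (\<lambda>k. k \<otimes>\<^bsub>G\<^esub> g) ` ?S" using g
          by (intro image_eqI[of _ _ "h \<otimes>\<^bsub>G\<^esub> inv\<^bsub>G\<^esub> g"]) (auto simp: G.m_assoc)
      next
        fix h assume "h \<in> (\<lambda>k. k \<otimes>\<^bsub>G\<^esub> g) ` ?S"
        then show "h \<in> {h. ?c h \<noteq> \<zero>\<^bsub>?M\<^esub>}" using g SG by (auto simp: G.m_assoc)
      qed
      have fin: "finite ?S" by (rule component_support[OF Ic[OF x]])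
      then show fin': "finite {h. ?c h \<noteq> \<zero>\<^bsub>?M\<^esub>}" unfolding supp by simp
      have inj: "inj_on (\<lambda>k. k \<otimes>\<^bsub>G\<^esub> g) ?S" by (rule inj_on_subset[OF _ SG]) (use g in \<open>auto intro!: inj_onI\<close>)
      have "finsum ?M ?c {h. ?c h \<noteq> \<zero>\<^bsub>?M\<^esub>} = Inl (finsum R ?d {h. ?c h \<noteq> \<zero>\<^bsub>?M\<^esub>})"
        using fin' cI glD(3)[OF I] by (intro finsum) auto
      also have "finsum R ?d {h. ?c h \<noteq> \<zero>\<^bsub>?M\<^esub>} = finsum R (\<lambda>k. ?d (k \<otimes>\<^bsub>G\<^esub> g)) ?S"
        unfolding supp using inj x by (intro finsum_reindex) auto
      also have "\<dots> = finsum R (\<lambda>k. cmp k x) ?S"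
        using SG g x by (intro finsum_cong') (auto simp: G.m_assoc)
      also have "\<dots> = x" by (rule component_sum[OF Ic[OF x], symmetric])
      finally show "Inl x = finsum ?M ?c {h. ?c h \<noteq> \<zero>\<^bsub>?M\<^esub>}" by simp
    qed
    ultimately show "is_decomp ?M (carrier G) (mod_part ?M) c (Inl x)" by simp
  next
    assume c: "is_decomp ?M (carrier G) (mod_part ?M) c (Inl x)"
    define d where "d k = projl (c (k \<otimes>\<^bsub>G\<^esub> g))" for k
    have cin: "c h \<in> Inl ` (ring_part R (h \<otimes>\<^bsub>G\<^esub> inv\<^bsub>G\<^esub> g) \<inter> I)" if "h \<in> carrier G" for h
      using c that unfolding is_decomp_def by simp
    have cout: "c h = Inl \<zero>" if "h \<notin> carrier G" for h
      using c that unfolding is_decomp_def by simp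
    have cInl: "c h = Inl (projl (c h))" "projl (c h) \<in> I" for h
      using cin[of h] cout[of h] glD(3)[OF I] by (cases "h \<in> carrier G"; auto)+
    let ?S = "{h. c h \<noteq> \<zero>\<^bsub>?M\<^esub>}"
    have SG: "?S \<subseteq> carrier G" using cout by auto
    have fin: "finite ?S" using c unfolding is_decomp_def by blast
    have "Inl x = finsum ?M (\<lambda>h. Inl (projl (c h))) ?S"
      using c cInl(1) unfolding is_decomp_def by simp
    also have "\<dots> = Inl (finsum R (\<lambda>h. projl (c h)) ?S)" using fin cInl(2) by (intro finsum) auto
    finally have xs: "x = finsum R (\<lambda>h. projl (c h)) ?S" by simp
    have "cmp (k \<otimes>\<^bsub>G\<^esub> inv\<^bsub>G\<^esub> g) x = projl (c k)" if k: "k \<in> carrier G" for k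
    proof -
      have "cmp (k \<otimes>\<^bsub>G\<^esub> inv\<^bsub>G\<^esub> g) (finsum R (\<lambda>h. projl (c h)) A) = (if k \<in> A then projl (c k) else \<zero>)"
        if "finite A" "A \<subseteq> carrier G" for A
        using that
      proof (induction A rule: finite_induct)
        case (insert h A)
        have h: "h \<in> carrier G" using insert by simp
        have "projl (c h) \<in> ring_part R (h \<otimes>\<^bsub>G\<^esub> inv\<^bsub>G\<^esub> g)" using cin[OF h] by auto
        then have "cmp (k \<otimes>\<^bsub>G\<^esub> inv\<^bsub>G\<^esub> g) (projl (c h)) = (if k = h then projl (c h) else \<zero>)"
          using component_homogeneous[of "h \<otimes>\<^bsub>G\<^esub> inv\<^bsub>G\<^esub> g" "projl (c h)" "k \<otimes>\<^bsub>G\<^esub> inv\<^bsub>G\<^esub> g"] h g k by simp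
        then show ?case using insert cInl(2) by (auto simp: finsum_insert component_add)
      qed (simp add: component_zero)
      from this[OF fin SG] show ?thesis using xs cInl(1)[of k] by auto
    qed
    then show "c = ?c" using cInl(1) cout by (auto simp: fun_eq_iff)
  qed
  have "internal_direct_sum ?M (carrier G) (mod_part ?M)"
    unfolding internal_direct_sum_def
  proof (intro conjI ballI)
    fix h assume h: "h \<in> carrier G"
    then have hg: "h \<otimes>\<^bsub>G\<^esub> inv\<^bsub>G\<^esub> g \<in> carrier G" using g by simp
    show "additive_subgroup (mod_part ?M h) ?M"
      unfolding M.additive_subgroup_iff
      using part_closed[OF hg] glD[OF I] by (auto simp: minus)
  next
    fix y assume "y \<in> carrier ?M"
    then show "\<exists>!c. is_decomp ?M (carrier G) (mod_part ?M) c y" using decomp by auto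
  qed
  moreover have "r \<odot>\<^bsub>?M\<^esub> x \<in> mod_part ?M (k \<otimes>\<^bsub>G\<^esub> h)"
    if "k \<in> carrier G" "h \<in> carrier G" "r \<in> ring_part R k" "x \<in> mod_part ?M h" for k h r x
    using that g ring_part_mult[of k "h \<otimes>\<^bsub>G\<^esub> inv\<^bsub>G\<^esub> g" r] glD(7)[OF I, of r] part_closed(4)[of k r]
    by (auto simp: G.m_assoc)
  ultimately show ?thesis
    by (intro graded_left_module.intro graded_left_module_axioms.intro graded_ring_axioms left)
qed

text \<open>The inclusion of the shifted copy of \<open>I\<close> into that of \<open>R\<close> is a
  test map. Injectivity extends \<open>\<phi>\<close> to the copy of \<open>R\<close>, and
  \<open>y\<close> is the image of \<open>1\<close>, which has degree \<open>g\<close> in the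
  shift.\<close>

lemma injective_imp_baer:
  assumes inj: "graded_injective TYPE('a + 'u) G R (left_regular R)"
  shows baer
  unfolding baer_def
proof (intro allI impI)
  fix I g \<phi>
  assume I: "gl I" and g: "g \<in> carrier G" and \<phi>c: "\<forall>x\<in>I. \<phi> x \<in> carrier R"
    and \<phi>a: "\<forall>x\<in>I. \<forall>y\<in>I. \<phi> (x \<oplus> y) = \<phi> x \<oplus> \<phi> y"
    and \<phi>m: "\<forall>r\<in>carrier R. \<forall>x\<in>I. \<phi> (r \<otimes> x) = r \<otimes> \<phi> x"
    and \<phi>h: "\<forall>a. \<forall>x\<in>I. x \<in> H a \<longrightarrow> \<phi> x \<in> H (a \<otimes>\<^bsub>G\<^esub> g)"
  let ?M = "shifted_copy I g :: ('a, 'a + 'u, 'g) gmodule"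
  let ?N = "shifted_copy (carrier R) g :: ('a, 'a + 'u, 'g) gmodule"
  have id: "(\<lambda>x. x) \<in> graded_hom G R ?M ?N" using glD(1)[OF I] by (auto simp: graded_hom_def)
  have \<phi>': "(\<lambda>x. \<phi> (projl x)) \<in> graded_hom G R ?M (left_regular R)"
    unfolding graded_hom_def left_regular_simps
  proof (intro CollectI conjI ballI)
    fix h assume h: "h \<in> carrier G"
    have "\<phi> x \<in> ring_part R h" if x: "x \<in> ring_part R (h \<otimes>\<^bsub>G\<^esub> inv\<^bsub>G\<^esub> g)" "x \<in> I" for x
    proof -
      have "x \<in> H (h \<otimes>\<^bsub>G\<^esub> inv\<^bsub>G\<^esub> g)" using x h g by (simp add: hpart_def)
      then have "\<phi> x \<in> H (h \<otimes>\<^bsub>G\<^esub> inv\<^bsub>G\<^esub> g \<otimes>\<^bsub>G\<^esub> g)" using \<phi>h x(2) by blast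
      then show ?thesis using h g by (simp add: G.m_assoc hpart_def)
    qed
    then show "(\<lambda>x. \<phi> (projl x)) ` mod_part ?M h \<subseteq> ring_part R h" by auto
  qed (use \<phi>c \<phi>a \<phi>m in auto)
  note ext = conjunct2[OF inj[unfolded graded_injective_def], rule_format, of ?M ?N "\<lambda>x. x" "\<lambda>x. \<phi> (projl x)"]
  have "\<exists>h\<in>graded_hom G R ?N (left_regular R). \<forall>x\<in>carrier ?M. h x = \<phi> (projl x)"
    by (rule ext, intro conjI id \<phi>' graded_left_module_shifted_copy I gl_carrier g) (simp add: inj_on_def)
  then obtain h where h: "h \<in> graded_hom G R ?N (left_regular R)"
    and ext: "\<forall>x\<in>carrier ?M. h x = \<phi> (projl x)" by blast
  let ?y = "h (Inl \<one>)"
  have "\<one> \<in> ring_part R \<one>\<^bsub>G\<^esub>" using one_H by (simp add: hpart_def)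
  then have "?y \<in> ring_part R g" using graded_homD(4)[OF h g, of "Inl \<one>"] g by (simp add: left_regular_simps)
  then have "?y \<in> H g" using g by (simp add: hpart_def)
  moreover have "\<phi> x = x \<otimes> ?y" if x: "x \<in> I" for x
  proof -
    have xc: "x \<in> carrier R" using glD(2)[OF I x] .
    have "h (x \<odot>\<^bsub>?N\<^esub> Inl \<one>) = x \<otimes> ?y"
      using graded_homD(3)[OF h xc, of "Inl \<one>"] by (simp add: left_regular_simps)
    then show ?thesis using ext x xc by simp
  qed
  ultimately show "\<exists>y\<in>H g. \<forall>x\<in>I. \<phi> x = x \<otimes> y" by blast
qed

text \<open>\<open>baer\<close> mentions no modules, so testing injectivity on any type of the form
  \<open>'a + 'u\<close> gives the same property; the ascending chain condition is
  \<open>acc_gl\<close>.\<close>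

lemma quasi_frobenius_iff_baer:
  "graded_quasi_frobenius TYPE('a + 'u) G R \<longleftrightarrow> baer"
proof
  assume "graded_quasi_frobenius TYPE('a + 'u) G R"
  then show baer using injective_imp_baer[where 'u = 'u] by (simp add: graded_quasi_frobenius_def)
next
  assume B: baer
  have "graded_injective TYPE('a + 'u) G R (left_regular R)"
    unfolding graded_injective_def
  proof (intro conjI allI impI, goal_cases)
    case 1 show ?case by (rule graded_left_module_left_regular)
  next
    case (2 M N i f) then show ?case by (elim conjE) (rule baer_imp_extension[OF B])
  qed
  then show "graded_quasi_frobenius TYPE('a + 'u) G R" by (simp add: graded_quasi_frobenius_def acc_gl)
qed

lemma left_socle_iso_iff:
  assumes "prim e" "prim e'" "\<tau> \<in> carrier G"
  shows "graded_iso G R (graded_soc G R (left_principal R e)) (left_shift G (left_top G R e') \<tau>) \<longleftrightarrow>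
    (\<exists>x. left_link e' e (inv\<^bsub>G\<^esub> \<tau>) x)"
  unfolding left_principal_def left_top_def
  using socle_iso_top_imp_link[OF regular_left_regular assms] link_imp_socle_iso_top[OF regular_left_regular assms]
  by blast

text \<open>This is the left version over the opposite ring: there \<open>left_shift\<close> by
  \<open>\<tau>\<close> is \<open>right_shift\<close>, and \<open>e\<close> and \<open>e'\<close>
  exchange roles.\<close>

lemma right_socle_iso_iff:
  assumes "prim e" "prim e'" "\<tau> \<in> carrier G"
  shows "graded_iso G R (graded_soc G R (right_principal R e')) (right_shift G \<tau> (right_top G R e)) \<longleftrightarrow>
    (\<exists>x. right_link e' e (inv\<^bsub>G\<^esub> \<tau>) x)"
proof -
  interpret O: graded_artinian_ring "op_group G" "op_ring R" by (rule op)
  have M: "O.regular (right_regular R)" by (simp add: O.regular_def right_regular_def)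
  have p: "O.prim e'" "O.prim e" "\<tau> \<in> carrier (op_group G)" using assms by (simp_all add: prim_op)
  \<comment> \<open>Homomorphisms and socles use the group and the ring through their carriers only,
    so passing to the opposites changes nothing.\<close>
  have iso: "graded_iso (op_group G) (op_ring R) = (graded_iso G R :: _ \<Rightarrow> ('a, 'a set, 'g) gmodule \<Rightarrow> bool)"
    by (simp add: graded_iso_def graded_hom_def fun_eq_iff)
  have soc: "graded_soc (op_group G) (op_ring R) N = graded_soc G R N" for N :: "('a, 'a, 'g) gmodule"
    by (simp add: graded_soc_def graded_simple_def graded_submodule_def)
  show ?thesis
    using O.socle_iso_top_imp_link[OF M p] O.link_imp_socle_iso_top[OF M p]
    unfolding iso soc jac_op left_link_op inv_op_group
    unfolding right_principal_def right_top_def right_shift_def left_shift_def by (simp, blast)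
qed

end

text \<open>\<open>'u\<close> is arbitrary: the test type contains a copy of the carrier type of
  \<open>R\<close> and may be as large as desired.\<close>

theorem corollary6p7:
  fixes G :: "('g, 'k) monoid_scheme"
    and R :: "('r, 'g) gring"
    and e :: "nat \<Rightarrow> 'r"
    and t :: nat
  assumes "graded_ring G R"
    and "graded_artinian G R"
    and "principal_isoshift_representatives G R t e"
  shows "graded_quasi_frobenius TYPE('r + 'u) G R \<longleftrightarrow>
    (\<exists>\<pi> \<sigma>. \<pi> permutes {1..t} \<and> (\<forall>i\<in>{1..t}. \<sigma> i \<in> carrier G) \<and>
       (\<forall>i\<in>{1..t}.
          graded_iso G R (graded_soc G R (left_principal R (e i)))
            (left_shift G (left_top G R (e (\<pi> i))) (\<sigma> i)) \<and>
          graded_iso G R (graded_soc G R (right_principal R (e (\<pi> i))))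
            (right_shift G (\<sigma> i) (right_top G R (e i)))))"
proof -
  interpret graded_artinian_ring G R
    using assms(1,2) by (intro graded_artinian_ring.intro graded_artinian_ring_axioms.intro)
  note reps = assms(3)[unfolded principal_isoshift_representatives_def]
  have p: "prim (e i)" if "i \<in> {1..t}" for i using reps that by blast
  have dist: "i = j" if ij: "i \<in> {1..t}" "j \<in> {1..t}" "iso_idem (e i) (e j)" for i j
  proof (rule ccontr)
    assume "i \<noteq> j"
    then have "\<not> same_left_isoshift_type G R (left_principal R (e i)) (left_principal R (e j))"
      using reps ij(1,2) by blast
    then show False
      using iso_idem_imp_iso[OF ij(3)] by (simp add: same_left_isoshift_type_def)
  qed
  have rep: "\<exists>i\<in>{1..t}. iso_idem f (e i)" if f: "prim f" for f
  proof -
    obtain i where i: "i \<in> {1..t}" "same_left_isoshift_type G R (left_principal R f) (left_principal R (e i))"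
      using reps prim_principal[OF f] unfolding left_principal_def by blast
    have f': "f \<in> H \<one>\<^bsub>G\<^esub>" "f \<otimes>\<^bsub>R\<^esub> f = f" and e': "e i \<in> H \<one>\<^bsub>G\<^esub>" "e i \<otimes>\<^bsub>R\<^esub> e i = e i"
      using primD[OF f] primD[OF p[OF i(1)]] by auto
    \<comment> \<open>The isoshift type allows an isomorphism in either direction; symmetry of
      \<open>iso_idem\<close> merges the two cases.\<close>
    from i(2) have "iso_idem f (e i)"
      unfolding same_left_isoshift_type_def
    proof
      assume "\<exists>\<tau>\<in>carrier G. graded_iso G R (left_principal R f) (left_shift G (left_principal R (e i)) \<tau>)"
      then show ?thesis using iso_imp_iso_idem[OF e' f'] by blast
    next
      assume "\<exists>\<tau>\<in>carrier G. graded_iso G R (left_principal R (e i)) (left_shift G (left_principal R f) \<tau>)"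
      then have "iso_idem (e i) f" using iso_imp_iso_idem[OF f' e'] by blast
      then show ?thesis by (rule iso_idem_sym)
    qed
    then show ?thesis using i(1) by blast
  qed
  have sides: "(graded_iso G R (graded_soc G R (left_principal R (e i))) (left_shift G (left_top G R (e (\<pi> i))) (\<sigma> i)) \<and>
      graded_iso G R (graded_soc G R (right_principal R (e (\<pi> i)))) (right_shift G (\<sigma> i) (right_top G R (e i)))) \<longleftrightarrow>
      (\<exists>x. left_link (e (\<pi> i)) (e i) (inv\<^bsub>G\<^esub> (\<sigma> i)) x) \<and> (\<exists>y. right_link (e (\<pi> i)) (e i) (inv\<^bsub>G\<^esub> (\<sigma> i)) y)"
    if "\<pi> permutes {1..t}" "\<forall>i\<in>{1..t}. \<sigma> i \<in> carrier G" "i \<in> {1..t}" for \<pi> \<sigma> i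
  proof -
    have "\<pi> i \<in> {1..t}" using permutes_in_image[OF that(1)] that(3) by blast
    then show ?thesis
      using left_socle_iso_iff[OF p p] right_socle_iso_iff[OF p p] that(2,3) by blast
  qed
  have "baer \<longleftrightarrow> (\<exists>\<pi> \<sigma>. \<pi> permutes {1..t} \<and> (\<forall>i\<in>{1..t}. \<sigma> i \<in> carrier G) \<and>
      (\<forall>i\<in>{1..t}. (\<exists>x. left_link (e (\<pi> i)) (e i) (inv\<^bsub>G\<^esub> (\<sigma> i)) x) \<and>
        (\<exists>y. right_link (e (\<pi> i)) (e i) (inv\<^bsub>G\<^esub> (\<sigma> i)) y)))"
    by (rule baer_iff_links) (use p dist rep in blast)+
  then show ?thesis
    unfolding quasi_frobenius_iff_baer
    by (elim ssubst) (intro iff_exI conj_cong refl ball_cong sides[symmetric])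
qed

end
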